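(* For a prime $p\ge 5$ let $g=g(X_0(p))$ denote the genus of the modular curve $X_0(p)$, i.e., $$g=\begin{cases}\left[\frac{p}{12}\right]\mp 1, & \text{when } p\equiv\pm1 \bmod 12,\\ \left[\frac{p}{12}\right], & \text{otherwise.}\end{cases}$$ Then $$\overline{\mathcal{B}}_2^{[p]}/(\mathcal{C}\cap\overline{\mathcal{B}}_2^{[p]})\cong\begin{cases}\mathbb{Z}/2\mathbb{Z}\oplus\mathbb{Z}^g, & \text{if } p\equiv1\bmod 4,\\ \mathbb{Z}^g, & \text{if } p\equiv3\bmod4.\end{cases}$$
   Context: The module $\overline{\mathcal{B}}$. $\overline{\mathcal{B}}$ is the $\mathbb{Z}[t]$-module obtained from the free $\mathbb{Z}$-module on pairs $(A,S)$, where $A$ is a finite abelian group and $S$ is a finite sequence of elements generating $A$, with $t$ acting by appending the element $0$ to $S$, by passing to the quotient by the following relations: (i) $(A,S)\sim(A,S')$ if $S'$ is a permutation of $S$; (ii) $(A,S)\sim(A',S')$ if some isomorphism $A\cong A'$ transforms $S$ to $S'$; (iii) for $S=(a_1,\dots,a_m)$ and any $2\le j\le m$, $(A,S)$ is equivalent to $$\sum_{\emptyset\ne I\subset\{1,\dots,j\}}(-t)^{|I|-1}\Big(A/\langle a_i-a_{i_0}\rangle_{i\in I},\ (\bar a_{i_0},\ (\bar a_i-\bar a_{i_0})_{1\le i\le j,\, i\notin I},\ \bar a_{j+1},\dots,\bar a_m)\Big),$$ where $i_0$ denotes any element of $I$ (the result does not depend on the choice) and bars denote images in the quotient group. Write $[A,S]$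 for the class of $(A,S)$. Assigning degree $|S|$ (the length of the sequence) to $[A,S]$ gives a grading $\overline{\mathcal{B}}=\bigoplus_{n\ge0}\overline{\mathcal{B}}_n$. For a positive integer $e$, $\overline{\mathcal{B}}^{[e]}$ is the $\mathbb{Z}[t]$-module defined in the same way but using only $e$-torsion groups $A$ (i.e. $eA=0$); the evident homomorphism $\overline{\mathcal{B}}^{[e]}\to\overline{\mathcal{B}}$ is a split monomorphism (split by $[A,S]\mapsto[A/eA,S]$), by which $\overline{\mathcal{B}}^{[e]}$ is regarded as a submodule of $\overline{\mathcal{B}}$. $\overline{\mathcal{B}}_n^{[e]}$ denotes its degree $n$ part. $\mathcal{C}\subset\overline{\mathcal{B}}$ is the $\mathbb{Z}[t]$-submodule generated by the classes of pairs $(C_{a_1}\oplus\dots\oplus C_{a_r},(g_1,\dots,g_r))$, where $C_a=\mathbb{Z}/a\mathbb{Z}$ and each $g_i$ is a generator of the $i$-th summand $C_{a_i}$. $[x]$ for a rational number $x$ denotes the integer part. The isomorphism is one of abelian groups. *)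

theory Defs
  imports
    "HOL-Algebra.Elementary_Groups"
    "HOL-Algebra.Product_Groups"
    "HOL-Algebra.Free_Abelian_Groups"
    "HOL-Computational_Algebra.Primes"
begin

text \<open>
  Abelian groups are written multiplicatively, following \<open>HOL-Algebra\<close>: the sum, the difference
  \<open>a - b\<close> and the element \<open>0\<close> of the mathematical text become \<open>a \<otimes> b\<close>, \<open>a \<otimes> inv b\<close> and \<open>\<one>\<close>.
  Sequences are lists, so their positions are numbered from 0.
\<close>

section \<open>Finite abelian groups with a generating sequence\<close>

type_synonym 'a marked = "'a monoid \<times> 'a list"

definition marked_group :: "'a marked \<Rightarrow> bool" where
  "marked_group = (\<lambda>(A, S). comm_group A \<and> finite (carrier A) \<and> set S \<subseteq> carrier A
     \<and> generate A (set S) = carrier A)"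

definition marked_iso :: "'a marked \<Rightarrow> 'b marked \<Rightarrow> bool" where
  "marked_iso = (\<lambda>(A, S) (A', S'). \<exists>h \<in> iso A A'. map h S = S')"

definition append_zero :: "'a marked \<Rightarrow> 'a marked" where
  "append_zero = (\<lambda>(A, S). (A, S @ [\<one>\<^bsub>A\<^esub>]))"

text \<open>
  The summand of relation (iii) indexed by \<open>I \<subseteq> {0,\<dots>,j-1}\<close>, with \<open>k \<in> I\<close> in the role
  of \<open>i\<^sub>0\<close>.
\<close>

definition marked_quotient :: "'a marked \<Rightarrow> nat \<Rightarrow> nat set \<Rightarrow> nat \<Rightarrow> 'a set marked" where
  "marked_quotient = (\<lambda>(A, S) j I k.
     let d = (\<lambda>i. S ! i \<otimes>\<^bsub>A\<^esub> inv\<^bsub>A\<^esub> (S ! k));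
         H = generate A (d ` I)
     in (A Mod H,
         map (\<lambda>x. H #>\<^bsub>A\<^esub> x) (S ! k # map d (filter (\<lambda>i. i \<notin> I) [0..<j]) @ drop j S)))"

text \<open>
  All finite abelian groups do not form a set, so the free module is built on the groups whose
  elements are natural numbers; up to isomorphism these are all of them
  (\<open>nat_copy\<close>, proved below). Pairs on other carrier types, such as quotient groups,
  enter through an isomorphic copy; by relation (ii) the class of the copy does not depend
  on its choice.
\<close>

definition nat_copy :: "'a marked \<Rightarrow> nat marked" where
  "nat_copy P = (SOME Q. marked_group Q \<and> marked_iso P Q)"

definition all_pairs :: "nat marked set" where
  "all_pairs = {P. marked_group P}"

definition torsion_pairs :: "nat \<Rightarrow> nat marked set" where
  "torsion_pairs e =
     {(A, S). marked_group (A, S) \<and> (\<forall>x \<in> carrier A. x [^]\<^bsub>A\<^esub> e = \<one>\<^bsub>A\<^esub>)}"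

section \<open>The modules\<close>

text \<open>
  A \<open>\<int>[t]\<close>-module is an abelian group together with the endomorphism by which \<open>t\<close>
  acts; its submodules are the subgroups stable under that endomorphism.
\<close>

definition zt_span :: "'a monoid \<Rightarrow> ('a \<Rightarrow> 'a) \<Rightarrow> 'a set \<Rightarrow> 'a set" where
  "zt_span M t X = \<Inter> {N. subgroup N M \<and> t ` N \<subseteq> N \<and> X \<subseteq> N}"

type_synonym frag = "nat marked \<Rightarrow>\<^sub>0 int"

definition t_free :: "frag \<Rightarrow> frag" where
  "t_free = frag_extend (\<lambda>P. frag_of (append_zero P))"

definition perm_relators :: "nat marked set \<Rightarrow> frag set" where
  "perm_relators T = {frag_of (A, S) - frag_of (A, S') | A S S'. (A, S) \<in> T \<and> mset S' = mset S}"

definition iso_relators :: "nat marked set \<Rightarrow> frag set" where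
  "iso_relators T = {frag_of P - frag_of Q | P Q. P \<in> T \<and> Q \<in> T \<and> marked_iso P Q}"

text \<open>In relation (iii), \<open>c\<close> chooses the element \<open>i\<^sub>0 = c I\<close> of each \<open>I\<close>; all choices are allowed.\<close>

definition quotient_relators :: "nat marked set \<Rightarrow> frag set" where
  "quotient_relators T =
     {frag_of P - (\<Sum>I \<in> {I. I \<noteq> {} \<and> I \<subseteq> {..<j}}.
         frag_cmul ((-1) ^ (card I - 1))
           ((t_free ^^ (card I - 1)) (frag_of (nat_copy (marked_quotient P j I (c I))))))
      | P j c. P \<in> T \<and> 2 \<le> j \<and> j \<le> length (snd P)
          \<and> (\<forall>I. I \<noteq> {} \<and> I \<subseteq> {..<j} \<longrightarrow> c I \<in> I)}"

definition relations :: "nat marked set \<Rightarrow> frag set" where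
  "relations T = zt_span (free_Abelian_group T) t_free
     (perm_relators T \<union> iso_relators T \<union> quotient_relators T)"

text \<open>
  \<open>B_module all_pairs\<close> is \<open>B\<close> with a bar, and \<open>B_module (torsion_pairs e)\<close> is its variant
  that uses only \<open>e\<close>-torsion groups.
\<close>

definition B_module :: "nat marked set \<Rightarrow> frag set monoid" where
  "B_module T = free_Abelian_group T Mod relations T"

definition B_class :: "nat marked set \<Rightarrow> frag \<Rightarrow> frag set" where
  "B_class T x = relations T #>\<^bsub>free_Abelian_group T\<^esub> x"

definition B_symbol :: "nat marked set \<Rightarrow> nat marked \<Rightarrow> frag set" where
  "B_symbol T P = B_class T (frag_of P)"

text \<open>
  Maps out of \<open>B_module T\<close> induced by maps of the free modules: the union runs over the
  representatives of the coset \<open>X\<close>, all of which give the same coset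
  (\<open>t_module_B_class\<close> and \<open>torsion_embed_B_class\<close> below).
\<close>

definition t_module :: "nat marked set \<Rightarrow> frag set \<Rightarrow> frag set" where
  "t_module T X = (\<Union>x \<in> X. B_class T (t_free x))"

definition torsion_embed :: "frag set \<Rightarrow> frag set" where
  "torsion_embed X = (\<Union>x \<in> X. B_class all_pairs x)"

definition B_degree :: "nat marked set \<Rightarrow> nat \<Rightarrow> frag set set" where
  "B_degree T n = generate (B_module T) {B_symbol T (A, S) | A S. (A, S) \<in> T \<and> length S = n}"

text \<open>The degree \<open>n\<close> part of the \<open>e\<close>-torsion module, as a subgroup of \<open>B_module all_pairs\<close>.\<close>

definition torsion_degree :: "nat \<Rightarrow> nat \<Rightarrow> frag set set" where
  "torsion_degree e n = torsion_embed ` B_degree (torsion_pairs e) n"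

definition cyclic_sum :: "nat \<Rightarrow> (nat \<Rightarrow> nat) \<Rightarrow> (nat \<Rightarrow> int) \<Rightarrow> (nat \<Rightarrow> int) marked" where
  "cyclic_sum r a g =
     (product_group {..<r} (\<lambda>i. integer_mod_group (a i)),
      map (\<lambda>i. \<lambda>k\<in>{..<r}. if k = i then g i else 0) [0..<r])"

definition C_submodule :: "frag set set" where
  "C_submodule = zt_span (B_module all_pairs) (t_module all_pairs)
     {B_symbol all_pairs (nat_copy (cyclic_sum r a g)) | r a g.
        \<forall>i<r. 0 < a i \<and> g i \<in> carrier (integer_mod_group (a i))
          \<and> generate (integer_mod_group (a i)) {g i} = carrier (integer_mod_group (a i))}"

definition C_quotient :: "nat \<Rightarrow> nat \<Rightarrow> frag set set monoid" where
  "C_quotient e n =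
     (B_module all_pairs)\<lparr>carrier := torsion_degree e n\<rparr> Mod (C_submodule \<inter> torsion_degree e n)"

text \<open>
  The genus of the modular curve \<open>X\<^sub>0(p)\<close>, for a prime \<open>p \<ge> 5\<close>, by its explicit formula.
  For a prime \<open>p\<close> congruent to 1 modulo 12 the subtraction does not truncate.
\<close>

definition genus_X0 :: "nat \<Rightarrow> nat" where
  "genus_X0 p =
     (if p mod 12 = 1 then p div 12 - 1
      else if p mod 12 = 11 then p div 12 + 1
      else p div 12)"

abbreviation free_Z :: "nat \<Rightarrow> (nat \<Rightarrow> int) monoid" where
  "free_Z n \<equiv> product_group {..<n} (\<lambda>_. integer_group)"

section \<open>The constructions are well defined\<close>

lemma nat_copy:
  fixes P :: "'a marked"
  assumes "marked_group P"
  shows "marked_group (nat_copy P) \<and> marked_iso P (nat_copy P)"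
proof -
  obtain A S where P: "P = (A, S)" by (cases P)
  have A: "comm_group A" and fin: "finite (carrier A)" and S: "set S \<subseteq> carrier A"
    and gen: "generate A (set S) = carrier A"
    using assms by (auto simp: P marked_group_def)
  interpret A: comm_group A by (rule A)
  obtain f :: "'a \<Rightarrow> nat" where inj: "inj_on f (carrier A)"
    using finite_imp_inj_to_nat_seg[OF fin] by blast
  define g where "g = inv_into (carrier A) f"
  define B :: "nat monoid" where
    "B = \<lparr>carrier = f ` carrier A, monoid.mult = (\<lambda>x y. f (g x \<otimes>\<^bsub>A\<^esub> g y)), one = f \<one>\<^bsub>A\<^esub>\<rparr>"
  have cB: "carrier B = f ` carrier A" by (simp add: B_def)
  have gf: "g (f x) = x" if "x \<in> carrier A" for x
    using that inj by (simp add: g_def)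
  have iso: "f \<in> iso A B"
    by (auto simp: iso_def hom_def B_def gf inj bij_betw_def)
  have "comm_group (B\<lparr>one := f \<one>\<^bsub>A\<^esub>\<rparr>)"
    using A.iso_imp_img_comm_group[OF iso] .
  then have B: "comm_group B" by (simp add: B_def)
  interpret B: comm_group B by (rule B)
  interpret f: group_hom A B f
    using iso by (simp add: group_hom_def group_hom_axioms_def iso_def A.group_axioms B.group_axioms)
  have "generate B (f ` set S) = f ` carrier A"
    using f.generate_img[OF S] by (simp only: gen)
  moreover have "f ` set S \<subseteq> f ` carrier A" using S by (rule image_mono)
  moreover have "finite (f ` carrier A)" using fin by (rule finite_imageI)
  ultimately have "marked_group (B, map f S)"
    unfolding marked_group_def prod.case set_map cB using B by blast
  moreover have "marked_iso P (B, map f S)"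
    using iso by (auto simp: P marked_iso_def)
  ultimately have "\<exists>Q :: nat marked. marked_group Q \<and> marked_iso P Q" by blast
  then show ?thesis
    unfolding nat_copy_def by (rule someI_ex)
qed

lemma marked_group_marked_quotient:
  assumes P: "marked_group P" and I: "I \<subseteq> {..<j}" and k: "k \<in> I" and j: "j \<le> length (snd P)"
  shows "marked_group (marked_quotient P j I k)"
proof -
  obtain A S where PA: "P = (A, S)" by (cases P)
  have A: "comm_group A" and fin: "finite (carrier A)" and S: "set S \<subseteq> carrier A"
    and gen: "generate A (set S) = carrier A"
    using P by (auto simp: PA marked_group_def)
  interpret A: comm_group A by (rule A)
  have jS: "j \<le> length S" using j by (simp add: PA)
  have Sc: "S ! i \<in> carrier A" if "i < length S" for i
    using that S by auto
  have kS: "k < length S" using I k jS by auto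
  define d where "d = (\<lambda>i. S ! i \<otimes>\<^bsub>A\<^esub> inv\<^bsub>A\<^esub> (S ! k))"
  define H where "H = generate A (d ` I)"
  define L where "L = S ! k # map d (filter (\<lambda>i. i \<notin> I) [0..<j]) @ drop j S"
  have dc: "d i \<in> carrier A" if "i < length S" for i
    using that Sc kS by (auto simp: d_def)
  have dI: "d ` I \<subseteq> carrier A" using dc I jS by auto
  have Hsub: "subgroup H A" unfolding H_def by (rule A.generate_is_subgroup[OF dI])
  have Hn: "H \<lhd> A" using Hsub by (simp add: A.normal_iff_subgroup)
  have Q: "comm_group (A Mod H)" by (rule A.abelian_FactGroup[OF Hsub])
  interpret Q: comm_group "A Mod H" by (rule Q)
  interpret q: group_hom A "A Mod H" "\<lambda>x. H #>\<^bsub>A\<^esub> x"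
    using normal.r_coset_hom_Mod[OF Hn]
    by (simp add: group_hom_def group_hom_axioms_def A.group_axioms Q.group_axioms)
  have L: "set L \<subseteq> carrier A"
    using Sc[OF kS] dc jS S set_drop_subset[of j S] by (auto simp: L_def)
  have img: "set (map (\<lambda>x. H #>\<^bsub>A\<^esub> x) L) = (\<lambda>x. H #>\<^bsub>A\<^esub> x) ` set L" by simp
  have c: "carrier (A Mod H) = (\<lambda>x. H #>\<^bsub>A\<^esub> x) ` carrier A" by (rule carrier_FactGroup)
  have sub: "(\<lambda>x. H #>\<^bsub>A\<^esub> x) ` set L \<subseteq> carrier (A Mod H)"
    unfolding c using L by blast
  let ?G = "generate (A Mod H) ((\<lambda>x. H #>\<^bsub>A\<^esub> x) ` set L)"
  have Gsub: "subgroup ?G (A Mod H)" by (rule Q.generate_is_subgroup[OF sub])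
  have mem: "H #>\<^bsub>A\<^esub> x \<in> ?G" if "x \<in> set S" for x
  proof -
    obtain i where i: "i < length S" "x = S ! i" using \<open>x \<in> set S\<close> by (auto simp: in_set_conv_nth)
    have kG: "H #>\<^bsub>A\<^esub> (S ! k) \<in> ?G" by (rule generate.incl) (simp add: L_def)
    have xd: "x = d i \<otimes>\<^bsub>A\<^esub> S ! k"
      using i Sc kS by (simp add: d_def A.m_assoc)
    then have xd': "H #>\<^bsub>A\<^esub> x = (H #>\<^bsub>A\<^esub> d i) \<otimes>\<^bsub>A Mod H\<^esub> (H #>\<^bsub>A\<^esub> (S ! k))"
      using q.hom_mult[OF dc[OF i(1)] Sc[OF kS]] by simp
    have "H #>\<^bsub>A\<^esub> d i \<in> ?G" if "i < j"
    proof (cases "i \<in> I")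
      case True
      then have "d i \<in> H" unfolding H_def by (blast intro: generate.incl)
      then have "H #>\<^bsub>A\<^esub> d i = H"
        using A.coset_join2[OF dc[OF i(1)] Hsub] by simp
      also have "H = \<one>\<^bsub>A Mod H\<^esub>" by simp
      finally show ?thesis using subgroup.one_closed[OF Gsub] by simp
    next
      case False
      then have "d i \<in> set L" using \<open>i < j\<close> by (auto simp: L_def)
      then show ?thesis by (blast intro: generate.incl)
    qed
    moreover have "H #>\<^bsub>A\<^esub> x \<in> ?G" if "\<not> i < j"
    proof -
      have "S ! i = drop j S ! (i - j)" "i - j < length (drop j S)" using that i by auto
      then have "x \<in> set (drop j S)" unfolding i(2) by (metis nth_mem)
      then have "x \<in> set L" by (simp add: L_def)
      then show ?thesis by (blast intro: generate.incl)
    qed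
    ultimately show ?thesis
      using xd' subgroup.m_closed[OF Gsub _ kG] by (cases "i < j") auto
  qed
  have "carrier (A Mod H) = generate (A Mod H) ((\<lambda>x. H #>\<^bsub>A\<^esub> x) ` set S)"
    using q.generate_img[OF S] gen c by simp
  also have "\<dots> \<subseteq> ?G"
    using mem by (intro Q.generate_subgroup_incl[OF _ Gsub]) auto
  finally have "?G = carrier (A Mod H)"
    using subgroup.subset[OF Gsub] by auto
  moreover have "finite (carrier (A Mod H))" unfolding c using fin by simp
  ultimately have "marked_group (A Mod H, map (\<lambda>x. H #>\<^bsub>A\<^esub> x) L)"
    using Q sub by (simp add: marked_group_def)
  then show ?thesis
    by (simp add: PA marked_quotient_def Let_def d_def H_def L_def)
qed

text \<open>What the two index sets \<open>all_pairs\<close> and \<open>torsion_pairs e\<close> have in common.\<close>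

definition admissible :: "nat marked set \<Rightarrow> bool" where
  "admissible T \<longleftrightarrow> T = all_pairs \<or> (\<exists>e. T = torsion_pairs e)"

lemma admissible_simps [simp]: "admissible all_pairs" "admissible (torsion_pairs e)"
  by (auto simp: admissible_def)

lemma admissible_subset: "admissible T \<Longrightarrow> T \<subseteq> all_pairs"
  by (auto simp: admissible_def all_pairs_def torsion_pairs_def)

lemma admissible_mset:
  assumes T: "admissible T" and AS: "(A, S) \<in> T" and S': "mset S' = mset S"
  shows "(A, S') \<in> T"
proof -
  have "set S' = set S" using S' by (metis set_mset_mset)
  then show ?thesis
    using T AS by (auto simp: admissible_def all_pairs_def torsion_pairs_def marked_group_def)
qed

lemma admissible_append_zero:
  assumes "admissible T" "P \<in> T"
  shows "append_zero P \<in> T"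
proof -
  have "marked_group (A, S @ [\<one>\<^bsub>A\<^esub>])" if "marked_group (A, S)" for A :: "nat monoid" and S
  proof -
    have A: "comm_group A" using that by (simp add: marked_group_def)
    interpret A: comm_group A by (rule A)
    have sub: "set (S @ [\<one>\<^bsub>A\<^esub>]) \<subseteq> carrier A" using that by (auto simp: marked_group_def)
    have "generate A (set S) \<subseteq> generate A (set (S @ [\<one>\<^bsub>A\<^esub>]))"
      by (rule A.mono_generate) auto
    then show ?thesis
      using that sub A.generate_incl[OF sub] by (auto simp: marked_group_def)
  qed
  then show ?thesis
    using assms
    by (cases P) (auto simp: admissible_def all_pairs_def torsion_pairs_def append_zero_def)
qed

lemma admissible_marked_quotient:
  assumes T: "admissible T" and P: "P \<in> T"
    and I: "I \<subseteq> {..<j}" and k: "k \<in> I" and j: "j \<le> length (snd P)"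
  shows "nat_copy (marked_quotient P j I k) \<in> T"
proof -
  obtain A S where PA: "P = (A, S)" by (cases P)
  obtain B U where BU: "marked_quotient P j I k = (B, U)" by (cases "marked_quotient P j I k")
  obtain C V where CV: "nat_copy (B, U) = (C, V)" by (cases "nat_copy (B, U)")
  have mP: "marked_group P" using admissible_subset[OF T] P by (auto simp: all_pairs_def)
  have mB: "marked_group (B, U)" using marked_group_marked_quotient[OF mP I k j] by (simp add: BU)
  have mC: "marked_group (C, V)" and "marked_iso (B, U) (C, V)" using nat_copy[OF mB] by (simp_all add: CV)
  then obtain h where h: "h \<in> iso B C" by (auto simp: marked_iso_def)
  have A: "comm_group A" and B: "comm_group B" and C: "comm_group C"
    using mP mB mC by (auto simp: PA marked_group_def)
  interpret A: comm_group A by (rule A)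
  interpret B: comm_group B by (rule B)
  interpret C: comm_group C by (rule C)
  interpret h: group_hom B C h
    using h by (simp add: group_hom_def group_hom_axioms_def iso_def B.group_axioms C.group_axioms)
  define H where "H = generate A ((\<lambda>i. S ! i \<otimes>\<^bsub>A\<^esub> inv\<^bsub>A\<^esub> (S ! k)) ` I)"
  have BH: "B = A Mod H" using BU by (simp add: PA marked_quotient_def Let_def H_def)
  have "(\<lambda>i. S ! i \<otimes>\<^bsub>A\<^esub> inv\<^bsub>A\<^esub> (S ! k)) ` I \<subseteq> carrier A"
  proof -
    have "S ! i \<in> carrier A" if "i \<in> I" for i
    proof -
      have "i < length S" using that I j by (auto simp: PA)
      then show ?thesis using mP nth_mem[of i S] by (auto simp: PA marked_group_def)
    qed
    then show ?thesis using k by auto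
  qed
  then have "H \<lhd> A"
    unfolding H_def using A.generate_is_subgroup by (simp add: A.normal_iff_subgroup)
  then interpret q: group_hom A B "\<lambda>x. H #>\<^bsub>A\<^esub> x"
    using normal.r_coset_hom_Mod[of H A]
    by (simp add: group_hom_def group_hom_axioms_def A.group_axioms B.group_axioms[unfolded BH] BH)
  have "y [^]\<^bsub>C\<^esub> e = \<one>\<^bsub>C\<^esub>" if e: "\<forall>x \<in> carrier A. x [^]\<^bsub>A\<^esub> e = \<one>\<^bsub>A\<^esub>" and y: "y \<in> carrier C"
    for e :: nat and y
  proof -
    obtain b where b: "b \<in> carrier B" "y = h b"
      using y h by (auto simp: iso_def bij_betw_def)
    obtain a where a: "a \<in> carrier A" "b = H #>\<^bsub>A\<^esub> a"
      using b by (auto simp: BH carrier_FactGroup)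
    have "b [^]\<^bsub>B\<^esub> e = H #>\<^bsub>A\<^esub> (a [^]\<^bsub>A\<^esub> e)"
      using q.hom_nat_pow[OF a(1), of e] a(2) by simp
    also have "\<dots> = \<one>\<^bsub>B\<^esub>" using e a q.hom_one by simp
    finally have "b [^]\<^bsub>B\<^esub> e = \<one>\<^bsub>B\<^esub>" .
    then show ?thesis using h.hom_nat_pow[OF b(1), of e] b(2) by simp
  qed
  then have "(C, V) \<in> T"
    using T P mC by (auto simp: admissible_def all_pairs_def torsion_pairs_def PA)
  then show ?thesis by (simp add: BU CV)
qed

lemma t_free_simps [simp]:
  "t_free 0 = 0" "t_free (x + y) = t_free x + t_free y" "t_free (- x) = - t_free x"
  "t_free (x - y) = t_free x - t_free y" "t_free (frag_of P) = frag_of (append_zero P)"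
  by (simp_all add: t_free_def frag_extend_add frag_extend_minus frag_extend_diff)

lemma t_free_closed:
  assumes T: "admissible T" and x: "x \<in> carrier (free_Abelian_group T)"
  shows "t_free x \<in> carrier (free_Abelian_group T)"
proof -
  have "Poly_Mapping.keys x \<subseteq> T" using x by simp
  then have "Poly_Mapping.keys (t_free x) \<subseteq> T"
  proof (rule free_Abelian_group_induct[where P = "\<lambda>x. Poly_Mapping.keys (t_free x) \<subseteq> T"])
    show "Poly_Mapping.keys (t_free 0) \<subseteq> T" by simp
    show "Poly_Mapping.keys (t_free (x - y)) \<subseteq> T"
      if "Poly_Mapping.keys (t_free x) \<subseteq> T" "Poly_Mapping.keys (t_free y) \<subseteq> T" for x y
      using that keys_diff[of "t_free x" "t_free y"] by auto
    show "Poly_Mapping.keys (t_free (frag_of P)) \<subseteq> T" if "P \<in> T" for P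
      using that admissible_append_zero[OF T] by (simp add: keys_frag_of)
  qed
  then show ?thesis by simp
qed

lemma relators_closed:
  assumes T: "admissible T"
  shows "perm_relators T \<union> iso_relators T \<union> quotient_relators T \<subseteq> carrier (free_Abelian_group T)"
proof -
  let ?F = "carrier (free_Abelian_group T)"
  have diff: "x - y \<in> ?F" if "x \<in> ?F" "y \<in> ?F" for x y
    using that keys_diff[of x y] by fastforce
  have of: "frag_of P \<in> ?F" if "P \<in> T" for P using that by simp
  have "perm_relators T \<subseteq> ?F"
  proof
    fix x assume "x \<in> perm_relators T"
    then obtain A S S' where "x = frag_of (A, S) - frag_of (A, S')" "(A, S) \<in> T" "mset S' = mset S"
      by (auto simp: perm_relators_def)
    then show "x \<in> ?F" using diff of admissible_mset[OF T] by metis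
  qed
  moreover have "iso_relators T \<subseteq> ?F"
  proof
    fix x assume "x \<in> iso_relators T"
    then obtain P Q where "x = frag_of P - frag_of Q" "P \<in> T" "Q \<in> T"
      by (auto simp: iso_relators_def)
    then show "x \<in> ?F" using diff of by metis
  qed
  moreover have "quotient_relators T \<subseteq> ?F"
  proof
    fix x assume "x \<in> quotient_relators T"
    then obtain P j c where x: "x = frag_of P - (\<Sum>I \<in> {I. I \<noteq> {} \<and> I \<subseteq> {..<j}}.
         frag_cmul ((-1) ^ (card I - 1))
           ((t_free ^^ (card I - 1)) (frag_of (nat_copy (marked_quotient P j I (c I))))))"
      and P: "P \<in> T" and j: "j \<le> length (snd P)"
      and c: "\<forall>I. I \<noteq> {} \<and> I \<subseteq> {..<j} \<longrightarrow> c I \<in> I"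
      unfolding quotient_relators_def by blast
    have pow: "(t_free ^^ n) y \<in> ?F" if "y \<in> ?F" for n y
      using that by (induction n) (auto intro: t_free_closed[OF T] simp del: carrier_free_Abelian_group_iff)
    have "frag_cmul ((-1) ^ (card I - 1))
           ((t_free ^^ (card I - 1)) (frag_of (nat_copy (marked_quotient P j I (c I))))) \<in> ?F"
      if "I \<in> {I. I \<noteq> {} \<and> I \<subseteq> {..<j}}" for I
    proof -
      have "c I \<in> I" "I \<subseteq> {..<j}" using that c by auto
      then have "frag_of (nat_copy (marked_quotient P j I (c I))) \<in> ?F"
        by (intro of admissible_marked_quotient[OF T P _ _ j])
      from pow[OF this, of "card I - 1"] show ?thesis using keys_cmul by fastforce
    qed
    then have "(\<Sum>I \<in> {I. I \<noteq> {} \<and> I \<subseteq> {..<j}}.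
         frag_cmul ((-1) ^ (card I - 1))
           ((t_free ^^ (card I - 1)) (frag_of (nat_copy (marked_quotient P j I (c I)))))) \<in> ?F"
      by (intro sum_closed_free_Abelian_group)
    then show "x \<in> ?F" unfolding x using P by (intro diff of)
  qed
  ultimately show ?thesis by blast
qed

lemma zt_span_closed:
  assumes M: "group M" and t: "t ` carrier M \<subseteq> carrier M" and X: "X \<subseteq> carrier M"
  shows "subgroup (zt_span M t X) M" "t ` zt_span M t X \<subseteq> zt_span M t X" "X \<subseteq> zt_span M t X"
proof -
  have "carrier M \<in> {N. subgroup N M \<and> t ` N \<subseteq> N \<and> X \<subseteq> N}"
    using group.subgroup_self[OF M] t X by auto
  then show "subgroup (zt_span M t X) M"
    unfolding zt_span_def by (intro group.subgroups_Inter[OF M]) auto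
qed (auto simp: zt_span_def)

lemma zt_span_least:
  "\<lbrakk>subgroup N M; t ` N \<subseteq> N; X \<subseteq> N\<rbrakk> \<Longrightarrow> zt_span M t X \<subseteq> N"
  by (auto simp: zt_span_def)

lemma relations_closed:
  assumes T: "admissible T"
  shows "subgroup (relations T) (free_Abelian_group T)" "t_free ` relations T \<subseteq> relations T"
    "perm_relators T \<union> iso_relators T \<union> quotient_relators T \<subseteq> relations T"
proof -
  have t: "t_free ` carrier (free_Abelian_group T) \<subseteq> carrier (free_Abelian_group T)"
    using t_free_closed[OF T] by blast
  note * = zt_span_closed[OF group_free_Abelian_group t relators_closed[OF T], folded relations_def]
  show "subgroup (relations T) (free_Abelian_group T)" "t_free ` relations T \<subseteq> relations T"
    "perm_relators T \<union> iso_relators T \<union> quotient_relators T \<subseteq> relations T"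
    by (rule *)+
qed

lemma comm_group_B_module: "admissible T \<Longrightarrow> comm_group (B_module T)"
  unfolding B_module_def
  by (intro comm_group.abelian_FactGroup abelian_free_Abelian_group relations_closed)

lemma relations_torsion_subset: "relations (torsion_pairs e) \<subseteq> relations all_pairs"
proof -
  let ?T = "torsion_pairs e" and ?A = all_pairs
  let ?N = "relations ?A \<inter> carrier (free_Abelian_group ?T)"
  have TA: "?T \<subseteq> ?A" by (simp add: admissible_subset)
  have gT: "group (free_Abelian_group ?T)" and gA: "group (free_Abelian_group ?A)" by simp_all
  have RA: "subgroup (relations ?A) (free_Abelian_group ?A)" by (simp add: relations_closed)
  have "subgroup ?N (free_Abelian_group ?T)"
  proof (rule group.subgroupI[OF gT])
    show "?N \<noteq> {}" using subgroup.one_closed[OF RA] by auto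
    fix x y assume x: "x \<in> ?N" and y: "y \<in> ?N"
    have "- x \<in> relations ?A"
      using subgroup.m_inv_closed[OF RA, of x] x TA by auto
    then show "inv\<^bsub>free_Abelian_group ?T\<^esub> x \<in> ?N"
      using x by simp
    have "x + y \<in> relations ?A" using subgroup.m_closed[OF RA, of x y] x y by simp
    then show "x \<otimes>\<^bsub>free_Abelian_group ?T\<^esub> y \<in> ?N"
      using x y group.is_monoid[OF gT] monoid.m_closed[of "free_Abelian_group ?T" x y] by simp
  qed auto
  moreover have "t_free ` ?N \<subseteq> ?N"
    using relations_closed(2)[of ?A] t_free_closed[of ?T] by (auto simp del: carrier_free_Abelian_group_iff)
  moreover have "perm_relators ?T \<union> iso_relators ?T \<union> quotient_relators ?T \<subseteq> ?N"
  proof -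
    have "perm_relators ?T \<subseteq> perm_relators ?A" using TA unfolding perm_relators_def by blast
    moreover have "iso_relators ?T \<subseteq> iso_relators ?A" using TA unfolding iso_relators_def by blast
    moreover have "quotient_relators ?T \<subseteq> quotient_relators ?A"
      using TA unfolding quotient_relators_def by blast
    ultimately show ?thesis using relations_closed(3)[of ?A] relators_closed[of ?T] by auto
  qed
  ultimately have "relations ?T \<subseteq> ?N" unfolding relations_def[of ?T] by (rule zt_span_least)
  then show ?thesis by blast
qed

text \<open>A map of free modules respecting the relations induces one of cosets.\<close>

lemma B_class_eq: "B_class T x = {r + x | r. r \<in> relations T}"
  by (auto simp: B_class_def r_coset_def)

lemma B_class_absorb:
  assumes "admissible T" "r \<in> relations T"
  shows "B_class T (r + x) = B_class T x"
proof -
  have R: "subgroup (relations T) (free_Abelian_group T)" using assms by (simp add: relations_closed)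
  have sub: "Poly_Mapping.keys r \<subseteq> T" using subgroup.mem_carrier[OF R assms(2)] by simp
  have add: "a + b \<in> relations T" if "a \<in> relations T" "b \<in> relations T" for a b
    using subgroup.m_closed[OF R that] by simp
  have neg: "- r \<in> relations T"
    using subgroup.m_inv_closed[OF R assms(2)] sub by simp
  have "s + x \<in> B_class T (r + x)" if "s \<in> relations T" for s
  proof -
    have "s + x = (s + - r) + (r + x)" by (simp add: algebra_simps)
    then show ?thesis unfolding B_class_eq using add[OF that neg] by blast
  qed
  moreover have "s + (r + x) \<in> B_class T x" if "s \<in> relations T" for s
  proof -
    have "s + (r + x) = (s + r) + x" by (simp add: algebra_simps)
    then show ?thesis unfolding B_class_eq using add[OF that assms(2)] by blast
  qed
  ultimately show ?thesis by (auto simp: B_class_eq)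
qed

lemma t_module_B_class:
  assumes "admissible T"
  shows "t_module T (B_class T x) = B_class T (t_free x)"
proof -
  have 0: "0 \<in> relations T"
    using subgroup.one_closed[OF relations_closed(1)[OF assms]] by simp
  have "B_class T (t_free (r + x)) = B_class T (t_free x)" if "r \<in> relations T" for r
    using that relations_closed(2)[OF assms] B_class_absorb[OF assms, of "t_free r"] by auto
  then have "t_module T (B_class T x) = (\<Union>r \<in> relations T. B_class T (t_free x))"
    by (auto simp: t_module_def B_class_eq[of T x])
  then show ?thesis using 0 by auto
qed

lemma torsion_embed_B_class:
  "torsion_embed (B_class (torsion_pairs e) x) = B_class all_pairs x"
proof -
  have 0: "0 \<in> relations (torsion_pairs e)"
    using subgroup.one_closed[OF relations_closed(1)[of "torsion_pairs e"]] by simp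
  have "B_class all_pairs (r + x) = B_class all_pairs x" if "r \<in> relations (torsion_pairs e)" for r
    using that relations_torsion_subset[of e] by (intro B_class_absorb) auto
  then have "torsion_embed (B_class (torsion_pairs e) x)
      = (\<Union>r \<in> relations (torsion_pairs e). B_class all_pairs x)"
    by (auto simp: torsion_embed_def B_class_eq[of "torsion_pairs e" x])
  then show ?thesis using 0 by auto
qed

lemma marked_group_cyclic_sum:
  assumes g: "\<forall>i<r. 0 < a i \<and> g i \<in> carrier (integer_mod_group (a i))
          \<and> generate (integer_mod_group (a i)) {g i} = carrier (integer_mod_group (a i))"
  shows "marked_group (cyclic_sum r a g)"
proof -
  let ?Z = "\<lambda>i. integer_mod_group (a i)"
  let ?G = "product_group {..<r} ?Z"
  define \<delta> :: "nat \<Rightarrow> int \<Rightarrow> nat \<Rightarrow> int" where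
    "\<delta> = (\<lambda>i x. \<lambda>k\<in>{..<r}. if k = i then x else 0)"
  let ?X = "(\<lambda>i. \<delta> i (g i)) ` {..<r}"
  have G: "group ?G" by simp
  interpret G: group ?G by (rule G)
  have com: "comm_group ?G"
  proof (rule G.group_comm_groupI)
    show "x \<otimes>\<^bsub>?G\<^esub> y = y \<otimes>\<^bsub>?G\<^esub> x" for x y
      by (simp add: add.commute)
  qed
  have fin: "finite (carrier ?G)"
    using g by (auto simp: carrier_product_group carrier_integer_mod_group intro!: finite_PiE)
  have hom: "\<delta> i \<in> hom (?Z i) ?G" if "i < r" for i
    using that by (auto simp: hom_def \<delta>_def carrier_product_group fun_eq_iff)
  have X: "?X \<subseteq> carrier ?G"
    using hom_in_carrier[OF hom] g by blast
  let ?H = "generate ?G ?X"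
  have H: "subgroup ?H ?G" by (rule G.generate_is_subgroup[OF X])
  have \<delta>H: "\<delta> i x \<in> ?H" if i: "i < r" and x: "x \<in> carrier (?Z i)" for i x
  proof -
    interpret d: group_hom "?Z i" ?G "\<delta> i"
      using hom[OF i] G by (simp add: group_hom_def group_hom_axioms_def)
    have "\<delta> i ` generate (?Z i) {g i} = generate ?G (\<delta> i ` {g i})"
      using g i by (intro d.generate_img[symmetric]) auto
    also have "\<dots> \<subseteq> ?H" using i by (intro G.mono_generate) auto
    finally show ?thesis using g i x by auto
  qed
  have "x \<in> ?H" if "n \<le> r" "x \<in> carrier ?G" "\<forall>k. n \<le> k \<and> k < r \<longrightarrow> x k = 0" for n x
    using that
  proof (induction n arbitrary: x)
    case 0
    then have "x = \<one>\<^bsub>?G\<^esub>"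
      by (auto simp: carrier_product_group fun_eq_iff PiE_def extensional_def)
    then show ?case by (simp only: subgroup.one_closed[OF H])
  next
    case (Suc n)
    define y where "y = (\<lambda>k\<in>{..<r}. if k = n then 0 else x k)"
    have xc: "x k \<in> carrier (?Z k)" if "k < r" for k
      using Suc.prems(2) that by (auto simp: carrier_product_group)
    have y: "y \<in> carrier ?G" using xc by (auto simp: y_def carrier_product_group)
    have yn: "\<forall>k. n \<le> k \<and> k < r \<longrightarrow> y k = 0"
    proof (intro allI impI)
      fix k assume "n \<le> k \<and> k < r"
      then show "y k = 0" using Suc.prems(3) by (cases "k = n") (auto simp: y_def)
    qed
    have yH: "y \<in> ?H" by (rule Suc.IH[OF _ y yn]) (use Suc.prems(1) in simp)
    have dH: "\<delta> n (x n) \<in> ?H" by (rule \<delta>H[OF _ xc]) (use Suc.prems(1) in simp_all)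
    have xy: "x = y \<otimes>\<^bsub>?G\<^esub> \<delta> n (x n)"
    proof
      fix k
      have "x k mod int (a k) = x k" if "k < r"
        using xc[OF that] g that by (auto simp: carrier_integer_mod_group)
      moreover have "x k = undefined" if "\<not> k < r"
        using Suc.prems(2) that by (auto simp: carrier_product_group PiE_def extensional_def)
      ultimately show "x k = (y \<otimes>\<^bsub>?G\<^esub> \<delta> n (x n)) k"
        by (auto simp: y_def \<delta>_def)
    qed
    show ?case by (subst xy) (rule subgroup.m_closed[OF H yH dH])
  qed
  from this[of r] have "carrier ?G \<subseteq> ?H" by auto
  then have gen: "?H = carrier ?G" using subgroup.subset[OF H] by (rule equalityI[rotated])
  have S: "set (map (\<lambda>i. \<delta> i (g i)) [0..<r]) = ?X"
    by (simp add: atLeast0LessThan)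
  have "marked_group (?G, map (\<lambda>i. \<delta> i (g i)) [0..<r])"
    unfolding marked_group_def prod.case S using com fin X gen by blast
  then show ?thesis by (simp only: cyclic_sum_def \<delta>_def)
qed

lemma C_submodule_closed:
  "subgroup C_submodule (B_module all_pairs)"
  "t_module all_pairs ` C_submodule \<subseteq> C_submodule"
proof -
  let ?F = "free_Abelian_group all_pairs" and ?B = "B_module all_pairs"
  have c: "carrier ?B = B_class all_pairs ` carrier ?F"
    by (auto simp: B_module_def B_class_def carrier_FactGroup)
  have t: "t_module all_pairs ` carrier ?B \<subseteq> carrier ?B"
    using t_free_closed[of all_pairs]
    by (auto simp: c t_module_B_class simp del: carrier_free_Abelian_group_iff)
  have "B_symbol all_pairs (nat_copy P) \<in> carrier ?B" if "marked_group P" for P :: "(nat \<Rightarrow> int) marked"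
  proof -
    have "frag_of (nat_copy P) \<in> carrier ?F" using nat_copy[OF that] by (simp add: all_pairs_def)
    then show ?thesis unfolding c B_symbol_def by (rule imageI)
  qed
  then have X: "{B_symbol all_pairs (nat_copy (cyclic_sum r a g)) | r a g.
        \<forall>i<r. 0 < a i \<and> g i \<in> carrier (integer_mod_group (a i))
          \<and> generate (integer_mod_group (a i)) {g i} = carrier (integer_mod_group (a i))}
      \<subseteq> carrier ?B"
    using marked_group_cyclic_sum by blast
  note * = zt_span_closed[OF comm_group.axioms(2)[OF comm_group_B_module] t X, folded C_submodule_def]
  show "subgroup C_submodule ?B" "t_module all_pairs ` C_submodule \<subseteq> C_submodule"
    by (rule *, simp)+
qed

end

theory Submission
  imports Defs "HOL-Number_Theory.Cong"
begin

text \<open>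
  A pair \<open>(A, (a, b))\<close> with \<open>A\<close> of exponent \<open>p\<close> is determined by the lattice of integers \<open>(u, v)\<close> with
  \<open>u a + v b = 0\<close>. Either the lattice is a product, and then the class lies in \<open>\<C>\<close>, or it is
  \<open>{u + x v = 0 mod p}\<close> for a unit \<open>x\<close>, the slope; write \<open>q x\<close> for the class. Modulo \<open>\<C>\<close> the relations become
  \<open>q (1/x) = q x\<close> and \<open>q x = q (x - 1) + q (1/x - 1)\<close>, with \<open>q 0 = q (-1) = 0\<close>. The sum \<open>q x + q (-x)\<close> is
  then unchanged under \<open>x \<mapsto> x + 1\<close>, hence zero, and the second relation turns into
  \<open>q x + q (-1 - x) + q (-1 - 1/x) = 0\<close>.

  This presents the first cohomology of a graph. Its half-edges are the classes \<open>{x, 1/x}\<close>, with \<open>x\<close> joined to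
  \<open>-x\<close>, and its vertices are the orbits of the group of order 6 generated by \<open>x \<mapsto> 1/x\<close> and \<open>x \<mapsto> -1 - x\<close>. It
  is connected because \<open>x\<close> and \<open>x - 1\<close> lie at the two ends of an edge. A square root \<open>i\<close> of \<open>-1\<close> gives a half-edge
  joined to itself, so \<open>2 q i = 0\<close>; the degenerate vertices give \<open>2 q (-2) = 0\<close> and \<open>3 q \<omega> = 0\<close> for a
  primitive cube root of unity \<open>\<omega>\<close>. Adding up all vertex relations yields \<open>q (-2) + q \<omega> = q i\<close>, so
  \<open>q \<omega> = 0\<close> and \<open>q (-2) = q i\<close>. The torsion term \<open>q i\<close> is split off by subtracting a flow from
  the vertex of \<open>i\<close> to that of \<open>-2\<close>, and the Euler characteristic of the graph gives the rank.

  Conversely, a solution of these relations with values in \<open>\<int>\<close> or \<open>\<int>/2\<close> defines a function of all pairs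
  \<open>(A, S)\<close>, through the lattice of \<open>A/pA\<close>, that respects the relations and vanishes on \<open>\<C>\<close>.
\<close>

section \<open>Half-edge graphs\<close>

text \<open>The generators of \<open>C_submodule\<close> involve cyclic groups of every order. A
  functional detecting classes of \<open>p\<close>-torsion pairs must therefore be defined on pairs
  over arbitrary groups before it can be said to vanish on \<open>C_submodule\<close>; this is why
  the lattice is taken in A/pA. In degree 2 the multiples of t come from pairs (a, 0), whose lattice
  is a product. The functionals thus kill t, and of relation (iii) only the terms with |I| = 1
  remain.

  The same linear algebra is needed for symbols modulo C, to find generators, and for integers
  modulo 0 or 2, to find functionals. Relations are therefore phrased as membership in a set
  \<open>M\<close> closed under differences, which is either \<open>C_frags\<close> or a set of
  multiples of an integer.

  Cycles of the graph have two uses: as functions of the half-edge they solve the relations and so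
  give functionals, and as coefficients they express every symbol through the basis. This makes
  generators and functionals dual to each other, so upper and lower bound agree.\<close>

definition diff_closed :: "'a::ab_group_add set \<Rightarrow> bool" where
  "diff_closed M \<longleftrightarrow> 0 \<in> M \<and> (\<forall>x\<in>M. \<forall>y\<in>M. x - y \<in> M)"

lemma diff_closed_zero: "diff_closed M \<Longrightarrow> 0 \<in> M"
  by (simp add: diff_closed_def)

lemma diff_closed_diff: "diff_closed M \<Longrightarrow> x \<in> M \<Longrightarrow> y \<in> M \<Longrightarrow> x - y \<in> M"
  by (simp add: diff_closed_def)

lemma diff_closed_uminus: "diff_closed M \<Longrightarrow> x \<in> M \<Longrightarrow> - x \<in> M"
  using diff_closed_diff[of M 0 x] by (simp add: diff_closed_zero)

lemma diff_closed_add: "diff_closed M \<Longrightarrow> x \<in> M \<Longrightarrow> y \<in> M \<Longrightarrow> x + y \<in> M"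
  using diff_closed_diff[of M x "- y"] by (simp add: diff_closed_uminus)

lemma diff_closed_sum: "diff_closed M \<Longrightarrow> (\<And>i. i \<in> I \<Longrightarrow> f i \<in> M) \<Longrightarrow> sum f I \<in> M"
  by (induction I rule: infinite_finite_induct) (auto simp: diff_closed_zero diff_closed_add)

lemma diff_closed_cong_iff: "diff_closed M \<Longrightarrow> x - y \<in> M \<Longrightarrow> x \<in> M \<longleftrightarrow> y \<in> M"
  using diff_closed_add[of M "x - y" y] diff_closed_diff[of M x "x - y"] by auto

lemma diff_closed_frag_cmul:
  assumes "diff_closed M" "x \<in> M"
  shows "frag_cmul k x \<in> M"
  by (rule frag_closure_minus_cmul) (use assms in \<open>auto simp: diff_closed_def\<close>)

lemma diff_closed_dvd: "diff_closed {x. (m::int) dvd x}"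
  by (simp add: diff_closed_def)
text \<open>\<open>N\<close> holds one half of each edge outside a spanning tree, and
  \<open>c h k\<close> is the coefficient at \<open>h\<close> of the cycle that the edge of
  \<open>k\<close> closes with the tree. The count is the Euler characteristic,
  \<open>card H\<close> being twice the number of edges. The induction contracts an edge with
  distinct ends until only loops remain; the contracted edges form the tree.\<close>

lemma half_edge_basis:
  fixes H :: "'h::linorder set" and \<sigma> :: "'h \<Rightarrow> 'h" and V :: "'v set"
  assumes "finite V" "V \<noteq> {}" "finite H"
    and "\<forall>h\<in>H. \<sigma> h \<in> H \<and> \<sigma> (\<sigma> h) = h \<and> \<sigma> h \<noteq> h"
    and "vt ` H \<subseteq> V"
    and "\<forall>W. W \<subseteq> V \<and> W \<noteq> {} \<and> (\<forall>h\<in>H. vt h \<in> W \<longrightarrow> vt (\<sigma> h) \<in> W) \<longrightarrow> W = V"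
  shows "\<exists>N (c :: 'h \<Rightarrow> 'h \<Rightarrow> int). N \<subseteq> H \<and> card H + 2 = 2 * (card N + card V)
    \<and> (\<forall>k\<in>N. \<forall>h\<in>H. c (\<sigma> h) k = - c h k)
    \<and> (\<forall>k\<in>N. \<forall>v\<in>V. (\<Sum>h | h \<in> H \<and> vt h = v. c h k) = 0)
    \<and> (\<forall>j\<in>N. \<forall>k\<in>N. c j k = (if j = k then 1 else 0))
    \<and> (\<forall>M (q :: 'h \<Rightarrow> 'b \<Rightarrow>\<^sub>0 int). diff_closed M \<longrightarrow> (\<forall>h\<in>H. q h + q (\<sigma> h) \<in> M)
         \<longrightarrow> (\<forall>v\<in>V. (\<Sum>h | h \<in> H \<and> vt h = v. q h) \<in> M)
         \<longrightarrow> (\<forall>h\<in>H. q h - (\<Sum>k\<in>N. frag_cmul (c h k) (q k)) \<in> M))"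
  using assms
proof (induction "card V" arbitrary: V H vt rule: less_induct)
  case less
  note finV = less.prems(1) and V = less.prems(2) and finH = less.prems(3)
  have \<sigma>: "\<sigma> h \<in> H \<and> \<sigma> (\<sigma> h) = h \<and> \<sigma> h \<noteq> h" if "h \<in> H" for h
    using less.prems(4) that by blast
  have vt: "vt h \<in> V" if "h \<in> H" for h using less.prems(5) that by blast
  have conn: "W = V" if "W \<subseteq> V" "W \<noteq> {}" "\<And>h. h \<in> H \<Longrightarrow> vt h \<in> W \<Longrightarrow> vt (\<sigma> h) \<in> W" for W
    using less.prems(6) that by blast
  show ?case
  proof (cases "\<exists>h\<in>H. vt h \<noteq> vt (\<sigma> h)")
    case False
    obtain v where v: "v \<in> V" using V by blast
    \<comment> \<open>When all edges are loops, a single vertex is already closed under passing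
      along edges, so connectedness leaves no other.\<close>
    then have "{v} = V" by (intro conn) (use False in auto)
    then have Vv: "V = {v}" by simp
    then have vtv: "vt h = v" if "h \<in> H" for h using vt[OF that] by simp
    \<comment> \<open>The order on half-edges serves only to pick one half of each loop.\<close>
    define N where "N = {h \<in> H. h < \<sigma> h}"
    define c :: "'h \<Rightarrow> 'h \<Rightarrow> int" where
      "c = (\<lambda>h k. (if h = k then 1 else 0) - (if h = \<sigma> k then 1 else 0))"
    have NH: "N \<subseteq> H" and finN: "finite N" using finH by (auto simp: N_def)
    have \<sigma>N: "\<sigma> ` N = H - N"
    proof (intro equalityI subsetI)
      fix h assume "h \<in> H - N"
      then have "\<sigma> h \<in> N" "h = \<sigma> (\<sigma> h)" using \<sigma>[of h] by (auto simp: N_def)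
      then show "h \<in> \<sigma> ` N" by blast
    qed (use \<sigma> in \<open>force simp: N_def\<close>)
    have inj: "inj_on \<sigma> H" using \<sigma> by (metis inj_onI)
    have "card (H - N) = card N" unfolding \<sigma>N[symmetric] by (rule card_image[OF inj_on_subset[OF inj NH]])
    moreover have "card (H - N) = card H - card N" "card N \<le> card H"
      using finH finN NH by (simp_all add: card_Diff_subset card_mono)
    ultimately have cardH: "card H = 2 * card N" by linarith
    have eq\<sigma>: "\<sigma> h = k \<longleftrightarrow> h = \<sigma> k" if "h \<in> H" "k \<in> H" for h k using \<sigma>[OF that(1)] \<sigma>[OF that(2)] by auto
    have 1: "c (\<sigma> h) k = - c h k" if "k \<in> N" "h \<in> H" for h k
    proof -
      have "k \<in> H" using that NH by blast
      then have "\<sigma> h = \<sigma> k \<longleftrightarrow> h = k" using \<sigma> that by metis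
      then show ?thesis using eq\<sigma>[OF that(2) \<open>k \<in> H\<close>] by (auto simp: c_def)
    qed
    have 2: "(\<Sum>h | h \<in> H \<and> vt h = v. c h k) = 0" if "k \<in> N" for k
    proof -
      have "{h. h \<in> H \<and> vt h = v} = H" using vtv by auto
      moreover have "k \<in> H" "\<sigma> k \<in> H" using that NH \<sigma> by auto
      ultimately show ?thesis using finH by (simp add: c_def sum_subtractf)
    qed
    have 3: "c j k = (if j = k then 1 else 0)" if "j \<in> N" "k \<in> N" for j k
      using that \<sigma>N by (auto simp: c_def)
    have 4: "q h - (\<Sum>k\<in>N. frag_cmul (c h k) (q k)) \<in> M"
      if M: "diff_closed M" and q: "\<forall>h\<in>H. q h + q (\<sigma> h) \<in> M" and h: "h \<in> H"
      for M and q :: "'h \<Rightarrow> 'b \<Rightarrow>\<^sub>0 int" and h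
    proof (cases "h \<in> N")
      case True
      then have "(\<Sum>k\<in>N. frag_cmul (c h k) (q k)) = (\<Sum>k\<in>N. if h = k then q h else 0)"
        using 3 by (intro sum.cong) auto
      also have "\<dots> = q h" using True finN by simp
      finally show ?thesis by (simp add: diff_closed_zero[OF M])
    next
      case False
      have \<sigma>h: "\<sigma> h \<in> N" using False h \<sigma>[OF h] by (auto simp: N_def)
      have "(\<Sum>k\<in>N. frag_cmul (c h k) (q k)) = (\<Sum>k\<in>N. if \<sigma> h = k then - q (\<sigma> h) else 0)"
      proof (rule sum.cong[OF refl])
        fix k assume k: "k \<in> N"
        have "c h k = (if \<sigma> h = k then -1 else 0)" using 3[OF \<sigma>h k] 1[OF k h] by (simp split: if_splits)
        then show "frag_cmul (c h k) (q k) = (if \<sigma> h = k then - q (\<sigma> h) else 0)" by auto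
      qed
      also have "\<dots> = - q (\<sigma> h)" using \<sigma>h finN by simp
      finally show ?thesis using q h by simp
    qed
    show ?thesis
      unfolding Vv
      by (intro exI[of _ N] exI[of _ c] conjI ballI allI impI)
        (use NH cardH in \<open>simp_all add: 1 2 3 4\<close>)
  next
    case True
    then obtain h0 where h0: "h0 \<in> H" and ne: "vt h0 \<noteq> vt (\<sigma> h0)" by blast
    define h1 u w where "h1 = \<sigma> h0" and "u = vt h0" and "w = vt h1"
    have h1: "h1 \<in> H" "\<sigma> h1 = h0" "h1 \<noteq> h0" using \<sigma>[OF h0] by (auto simp: h1_def)
    have uw: "u \<noteq> w" "u \<in> V" "w \<in> V" using ne vt h0 h1 by (auto simp: u_def w_def h1_def)
    \<comment> \<open>Contraction of the edge of \<open>h0\<close>: its end \<open>w\<close> is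
      merged into \<open>u\<close> and both halves are deleted.\<close>
    define V' H' vt' where "V' = V - {w}" and "H' = H - {h0, h1}"
      and "vt' = (\<lambda>h. if vt h = w then u else vt h)"
    have V': "finite V'" "V' \<noteq> {}" "card V = Suc (card V')"
      using finV uw by (auto simp: V'_def card.remove[of V w] simp del: card_Diff_insert)
    have H': "finite H'" and cH: "card H = card H' + 2"
    proof -
      have "card H = Suc (Suc (card (H - {h0} - {h1})))"
        using finH h0 h1 by (simp add: card.remove[of H h0] card.remove[of "H - {h0}" h1] del: card_Diff_insert)
      also have "H - {h0} - {h1} = H'" by (auto simp: H'_def)
      finally show "card H = card H' + 2" by simp
      show "finite H'" using finH by (simp add: H'_def)
    qed
    have \<sigma>': "\<sigma> h \<in> H' \<and> \<sigma> (\<sigma> h) = h \<and> \<sigma> h \<noteq> h" if "h \<in> H'" for h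
      using that \<sigma>[of h] \<sigma>[OF h0] h1 by (auto simp: H'_def h1_def)
    have vt': "vt' h \<in> V'" if "h \<in> H'" for h
      using that vt[of h] uw by (auto simp: H'_def V'_def vt'_def)
    have conn': "W = V'" if W: "W \<subseteq> V'" "W \<noteq> {}"
      and cl: "\<And>h. h \<in> H' \<Longrightarrow> vt' h \<in> W \<Longrightarrow> vt' (\<sigma> h) \<in> W" for W
    proof -
      \<comment> \<open>The preimage of \<open>W\<close> under the merging of \<open>w\<close> into
        \<open>u\<close>.\<close>
      define W2 where "W2 = {x \<in> V. (if x = w then u else x) \<in> W}"
      have "W2 = V"
      proof (rule conn)
        show "W2 \<subseteq> V" by (auto simp: W2_def)
        show "W2 \<noteq> {}" using W uw by (auto simp: W2_def V'_def)
        fix h assume h: "h \<in> H" "vt h \<in> W2"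
        have iff: "vt k \<in> W2 \<longleftrightarrow> vt' k \<in> W" if "k \<in> H" for k
          using vt[OF that] by (auto simp: W2_def vt'_def)
        have u01: "vt' h0 = u" "vt' h1 = u" using uw by (auto simp: vt'_def u_def w_def)
        have "vt' (\<sigma> h) \<in> W"
        proof (cases "h \<in> H'")
          case True
          then show ?thesis using cl iff[OF h(1)] h(2) by blast
        next
          case False
          then have "h = h0 \<or> h = h1" using h(1) by (simp add: H'_def)
          then have "vt' (\<sigma> h) = vt' h" using u01 h1(2) h1_def by metis
          then show ?thesis using iff[OF h(1)] h(2) by simp
        qed
        then show "vt (\<sigma> h) \<in> W2" using iff \<sigma>[OF h(1)] by blast
      qed
      have "x \<in> W" if "x \<in> V'" for x
      proof -
        have "x \<in> W2" "x \<noteq> w" using that \<open>W2 = V\<close> by (simp_all add: V'_def)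
        then show ?thesis by (simp add: W2_def)
      qed
      then show ?thesis using W by blast
    qed
    have c1: "card V' < card V" using V'(3) by simp
    have c2: "\<forall>h\<in>H'. \<sigma> h \<in> H' \<and> \<sigma> (\<sigma> h) = h \<and> \<sigma> h \<noteq> h" "vt' ` H' \<subseteq> V'"
      using \<sigma>' vt' by blast+
    have c3: "\<forall>W. W \<subseteq> V' \<and> W \<noteq> {} \<and> (\<forall>h\<in>H'. vt' h \<in> W \<longrightarrow> vt' (\<sigma> h) \<in> W) \<longrightarrow> W = V'"
      using conn' by blast
    from less.hyps[of V' H' vt', OF c1 V'(1,2) H' c2 c3]
    obtain N and c :: "'h \<Rightarrow> 'h \<Rightarrow> int" where NH: "N \<subseteq> H'"
      and cN: "card H' + 2 = 2 * (card N + card V')"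
      and c1': "\<forall>k\<in>N. \<forall>h\<in>H'. c (\<sigma> h) k = - c h k"
      and c2': "\<forall>k\<in>N. \<forall>v\<in>V'. (\<Sum>h | h \<in> H' \<and> vt' h = v. c h k) = 0"
      and c3': "\<forall>j\<in>N. \<forall>k\<in>N. c j k = (if j = k then 1 else 0)"
      and c4': "\<forall>M (q :: 'h \<Rightarrow> 'b \<Rightarrow>\<^sub>0 int). diff_closed M \<longrightarrow> (\<forall>h\<in>H'. q h + q (\<sigma> h) \<in> M)
         \<longrightarrow> (\<forall>v\<in>V'. (\<Sum>h | h \<in> H' \<and> vt' h = v. q h) \<in> M)
         \<longrightarrow> (\<forall>h\<in>H'. q h - (\<Sum>k\<in>N. frag_cmul (c h k) (q k)) \<in> M)"
      by (elim exE conjE)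
    note c1 = c1'[rule_format] and c2 = c2'[rule_format] and c3 = c3'[rule_format]
    have c4: "q h - (\<Sum>k\<in>N. frag_cmul (c h k) (q k)) \<in> M"
      if "diff_closed M" "\<forall>h\<in>H'. q h + q (\<sigma> h) \<in> M"
        "\<forall>v\<in>V'. (\<Sum>h | h \<in> H' \<and> vt' h = v. q h) \<in> M" "h \<in> H'" for M and q :: "'h \<Rightarrow> 'b \<Rightarrow>\<^sub>0 int" and h
      using c4' that by blast
    define e where "e = (\<lambda>v k. \<Sum>h | h \<in> H' \<and> vt h = v. c h k)"
    \<comment> \<open>The value on the contracted edge is forced: it must cancel the amount
      \<open>e u k\<close> that the other half-edges leave at \<open>u\<close>. The sum at
      \<open>w\<close> then vanishes as well, because the merged vertex gives
      \<open>e u k + e w k = 0\<close>.\<close>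
    define c' where "c' = (\<lambda>h k. if h = h0 then - e u k else if h = h1 then e u k else c h k)"
    have c'H: "c' h k = c h k" if "h \<in> H'" for h k using that by (auto simp: c'_def H'_def)
    have split_sum: "(\<Sum>h | h \<in> H' \<and> vt' h = v. F h) =
        (if v = u then (\<Sum>h | h \<in> H' \<and> vt h = u. F h) + (\<Sum>h | h \<in> H' \<and> vt h = w. F h)
         else (\<Sum>h | h \<in> H' \<and> vt h = v. F h))"
      if "v \<in> V'" for v and F :: "'h \<Rightarrow> 'x::comm_monoid_add"
    proof (cases "v = u")
      case True
      then have "{h. h \<in> H' \<and> vt' h = v} = {h. h \<in> H' \<and> vt h = u} \<union> {h. h \<in> H' \<and> vt h = w}"
        by (auto simp: vt'_def)
      then show ?thesis using True uw H' by (subst if_P, simp, subst sum.union_disjoint[symmetric]) auto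
    next
      case False
      then have "{h. h \<in> H' \<and> vt' h = v} = {h. h \<in> H' \<and> vt h = v}"
        using that by (auto simp: vt'_def V'_def)
      then show ?thesis using False by simp
    qed
    have H_sum: "(\<Sum>h | h \<in> H \<and> vt h = v. F h) =
        (if v = u then F h0 else if v = w then F h1 else 0) + (\<Sum>h | h \<in> H' \<and> vt h = v. F h)"
      for v and F :: "'h \<Rightarrow> 'x::comm_monoid_add"
    proof -
      have "{h. h \<in> H \<and> vt h = v} = (if v = u then {h0} else if v = w then {h1} else {}) \<union> {h. h \<in> H' \<and> vt h = v}"
        using h0 h1 uw by (auto simp: H'_def u_def w_def)
      then show ?thesis using H' by (auto simp: H'_def)
    qed
    have 1: "c' (\<sigma> h) k = - c' h k" if "k \<in> N" "h \<in> H" for h k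
    proof (cases "h \<in> H'")
      case True
      then show ?thesis using c1[OF that(1) True] \<sigma>'[OF True] by (simp add: c'H)
    next
      case False
      then have "h = h0 \<or> h = h1" using that by (auto simp: H'_def)
      moreover have "\<sigma> h0 = h1" by (simp add: h1_def)
      ultimately show ?thesis using h1(2,3) by (elim disjE) (simp_all add: c'_def)
    qed
    have 2: "(\<Sum>h | h \<in> H \<and> vt h = v. c' h k) = 0" if "k \<in> N" "v \<in> V" for v k
    proof -
      have s: "(\<Sum>h | h \<in> H' \<and> vt h = v. c' h k) = e v k" for v
        unfolding e_def by (intro sum.cong) (auto simp: c'H)
      have "e u k + e w k = 0" using c2[OF that(1), of u] split_sum[of u "\<lambda>h. c h k"] uw
        by (simp add: e_def V'_def)
      moreover have "e v k = 0" if "v \<noteq> u" "v \<noteq> w"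
        using c2[OF \<open>k \<in> N\<close>, of v] split_sum[of v "\<lambda>h. c h k"] \<open>v \<in> V\<close> that by (simp add: e_def V'_def)
      ultimately show ?thesis unfolding H_sum s using h1 uw by (auto simp: c'_def)
    qed
    have 3: "c' j k = (if j = k then 1 else 0)" if "j \<in> N" "k \<in> N" for j k
      using c3[OF that] c'H NH that by auto
    have 4: "q h - (\<Sum>k\<in>N. frag_cmul (c' h k) (q k)) \<in> M"
      if M: "diff_closed M" and q: "\<forall>h\<in>H. q h + q (\<sigma> h) \<in> M"
        and qv: "\<forall>v\<in>V. (\<Sum>h | h \<in> H \<and> vt h = v. q h) \<in> M" and h: "h \<in> H"
      for M and q :: "'h \<Rightarrow> 'b \<Rightarrow>\<^sub>0 int" and h
    proof -
      let ?S = "\<lambda>h. \<Sum>k\<in>N. frag_cmul (c' h k) (q k)"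
      have q01: "q h0 + q h1 \<in> M" using q h0 by (simp add: h1_def)
      have in': "q h - ?S h \<in> M" if "h \<in> H'" for h
      proof -
        have "(\<Sum>h | h \<in> H' \<and> vt' h = v. q h) \<in> M" if v: "v \<in> V'" for v
        proof (cases "v = u")
          case True
          \<comment> \<open>The sum at the merged vertex is the sum at \<open>u\<close> plus the sum
            at \<open>w\<close>, less the pair \<open>q h0 + q h1\<close>.\<close>
          have "(q h0 + (\<Sum>h | h \<in> H' \<and> vt h = u. q h)) + (q h1 + (\<Sum>h | h \<in> H' \<and> vt h = w. q h)) - (q h0 + q h1) \<in> M"
            using bspec[OF qv uw(2)] bspec[OF qv uw(3)] uw(1) unfolding H_sum
            by (intro diff_closed_diff[OF M diff_closed_add[OF M] q01]) simp_all
          then show ?thesis unfolding split_sum[OF v] using True by (simp add: algebra_simps)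
        next
          case False
          then show ?thesis using qv v unfolding split_sum[OF v] H_sum by (auto simp: V'_def)
        qed
        then show ?thesis using c4[OF M _ _ that, of q] q c'H[OF that] by (simp add: H'_def)
      qed
      \<comment> \<open>The vertex relation at \<open>u\<close> expresses \<open>q h0\<close>
        through half-edges that are already treated.\<close>
      have S0: "q h0 - ?S h0 \<in> M"
      proof -
        have "(\<Sum>h | h \<in> H' \<and> vt h = u. ?S h) = - ?S h0"
        proof -
          have "(\<Sum>h | h \<in> H' \<and> vt h = u. ?S h) = (\<Sum>k\<in>N. \<Sum>h | h \<in> H' \<and> vt h = u. frag_cmul (c' h k) (q k))"
            by (rule sum.swap)
          also have "\<dots> = (\<Sum>k\<in>N. frag_cmul (e u k) (q k))"
          proof (rule sum.cong[OF refl])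
            fix k
            have "(\<Sum>h\<in>A. frag_cmul (f h) x) = frag_cmul (sum f A) x" for A and f :: "'h \<Rightarrow> int" and x :: "'b \<Rightarrow>\<^sub>0 int"
              by (induction A rule: infinite_finite_induct) (auto simp: frag_cmul_distrib)
            then show "(\<Sum>h | h \<in> H' \<and> vt h = u. frag_cmul (c' h k) (q k)) = frag_cmul (e u k) (q k)"
              by (simp add: e_def c'H)
          qed
          also have "\<dots> = - ?S h0" by (simp add: c'_def sum_negf[symmetric])
          finally show ?thesis .
        qed
        moreover have "(\<Sum>h | h \<in> H' \<and> vt h = u. q h - ?S h) \<in> M"
          by (intro diff_closed_sum[OF M] in') simp
        moreover have "q h0 + (\<Sum>h | h \<in> H' \<and> vt h = u. q h) \<in> M"
          using bspec[OF qv uw(2)] unfolding H_sum by simp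
        ultimately have "(q h0 + (\<Sum>h | h \<in> H' \<and> vt h = u. q h)) - ((\<Sum>h | h \<in> H' \<and> vt h = u. q h) - - ?S h0) \<in> M"
          by - (rule diff_closed_diff[OF M], simp_all add: sum_subtractf)
        then show ?thesis by (simp add: algebra_simps)
      qed
      have "?S h1 = - ?S h0"
        using h1 by (simp add: c'_def sum_negf[symmetric])
      then have S1: "q h1 - ?S h1 \<in> M"
        using diff_closed_diff[OF M q01 S0] by (simp add: algebra_simps)
      show ?thesis using in' S0 S1 h by (cases "h \<in> H'") (auto simp: H'_def)
    qed
    have "N \<subseteq> H" "card H + 2 = 2 * (card N + card V)"
      using NH cN cH V' by (auto simp: H'_def)
    then show ?thesis
      by (intro exI[of _ N] exI[of _ c'] conjI ballI allI impI) (simp_all add: 1 2 3 4)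
  qed
qed

section \<open>Residues modulo a prime\<close>

locale prime_residues =
  fixes p :: int
  assumes prime: "prime p" and ge5: "p \<ge> 5"
begin

definition J :: "int \<Rightarrow> int" where
  "J x = (THE y. y \<in> {1..<p} \<and> p dvd x * y - 1)"

definition S :: "int \<Rightarrow> int" where "S x = p - 1 - x"

lemma dvd_mult_iff: "p dvd a * b \<longleftrightarrow> p dvd a \<or> p dvd b"
  using prime by (simp add: prime_dvd_mult_iff)

lemma not_dvd: "x \<in> {1..<p} \<Longrightarrow> \<not> p dvd x"
  by (auto dest: zdvd_imp_le)

lemma dvd_diff_eq: "p dvd x - y \<Longrightarrow> \<bar>x - y\<bar> < p \<Longrightarrow> x = y"
  using dvd_imp_le_int[of "x - y" p] ge5 by force

lemma J_unique:
  assumes "x \<in> {1..<p}" "y \<in> {1..<p}" "p dvd x * y - 1"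
  shows "J x = y"
  unfolding J_def
proof (rule the_equality)
  fix z assume z: "z \<in> {1..<p} \<and> p dvd x * z - 1"
  have "p dvd (x * z - 1) - (x * y - 1)" using z assms by (blast intro: dvd_diff)
  then have "p dvd x * (z - y)" by (simp add: algebra_simps)
  then have "p dvd z - y" using not_dvd[OF assms(1)] by (simp add: dvd_mult_iff)
  then show "z = y" by (rule dvd_diff_eq) (use z assms in auto)
qed (use assms in auto)

lemma J_ex: assumes "x \<in> {1..<p}" shows "J x \<in> {1..<p}" "p dvd x * J x - 1"
proof -
  have "coprime x p" using not_dvd[OF assms] prime by (metis coprime_commute prime_imp_coprime)
  then obtain y where y: "[x * y = 1] (mod p)" using cong_solve_coprime_int by blast
  have d: "p dvd x * (y mod p) - 1"
    using y by (metis cong_iff_dvd_diff cong_mod_right cong_mult cong_refl cong_sym cong_trans cong_def mod_mult_right_eq)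
  moreover have "y mod p \<in> {1..<p}"
  proof -
    have "y mod p \<noteq> 0" using d ge5 by auto
    moreover have "0 \<le> y mod p" "y mod p < p" using ge5 by simp_all
    ultimately show ?thesis by simp
  qed
  ultimately show "J x \<in> {1..<p}" "p dvd x * J x - 1" using J_unique[OF assms] by auto
qed

lemma J_J [simp]: "x \<in> {1..<p} \<Longrightarrow> J (J x) = x"
  using J_ex[of x] by (intro J_unique) (auto simp: mult.commute)

lemma J_uminus: assumes "x \<in> {1..<p}" shows "J (p - x) = p - J x"
proof (rule J_unique)
  have "p dvd p * (p - x - J x) + (x * J x - 1)" using J_ex[OF assms] by (intro dvd_add) auto
  then show "p dvd (p - x) * (p - J x) - 1" by (simp add: algebra_simps)
qed (use assms J_ex[OF assms] in auto)

lemma J_1 [simp]: "J 1 = 1"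
  using ge5 by (intro J_unique) auto

lemma J_minus_1 [simp]: "J (p - 1) = p - 1"
  using J_uminus[of 1] ge5 by simp

lemma J_eq_self: assumes "x \<in> {1..<p}" "J x = x" shows "x = 1 \<or> x = p - 1"
proof -
  have "p dvd x * x - 1" using J_ex[OF assms(1)] assms by simp
  then have "p dvd (x - 1) * (x + 1)" by (simp add: algebra_simps)
  then have "p dvd x - 1 \<or> p dvd x - (-1)" by (simp add: dvd_mult_iff)
  then show ?thesis
  proof
    assume "p dvd x - (-1)"
    then have "p dvd x - (p - 1)" by (metis (no_types, lifting) add_diff_eq diff_minus_eq_add diff_diff_eq2 dvd_diff dvd_refl)
    then show ?thesis using dvd_diff_eq[of x "p - 1"] assms by auto
  next
    assume "p dvd x - 1" then show ?thesis using dvd_diff_eq[of x 1] assms by auto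
  qed
qed

text \<open>The projective line over the field with \<open>p\<close> elements without 0, -1 and
  infinity. \<open>J\<close> and \<open>S\<close> permute these three points as two different
  transpositions, so both preserve \<open>X\<close> and they generate a symmetric group on three
  letters.\<close>

definition X :: "int set" where "X = {1..<p - 1}"

lemma XR: "x \<in> X \<Longrightarrow> x \<in> {1..<p}" by (auto simp: X_def)

lemma J_X: assumes "x \<in> X" shows "J x \<in> X"
proof -
  have "J x \<noteq> p - 1"
  proof
    assume "J x = p - 1"
    then have "x = p - 1" using J_J[OF XR[OF assms]] by simp
    then show False using assms by (simp add: X_def)
  qed
  then show ?thesis using J_ex(1)[OF XR[OF assms]] by (auto simp: X_def)
qed

lemma S_X: "x \<in> X \<Longrightarrow> S x \<in> X" by (auto simp: S_def X_def)

lemma S_S [simp]: "S (S x) = x" by (simp add: S_def)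

lemma JJX [simp]: "x \<in> X \<Longrightarrow> J (J x) = x" by (rule J_J[OF XR])

text \<open>The numbers -1 - 1/x = -(1 + x)/x and -1 + 1/(1 + x) = -x/(1 + x) are inverse to each
  other. It is the braid relation between two transpositions, and it makes the six terms of
  \<open>tau\<close> below a full orbit.\<close>

lemma braid: assumes "x \<in> X" shows "S (J (S x)) = J (S (J x))"
proof (rule J_unique[symmetric])
  have Jx: "J x \<in> X" and Sx: "S x \<in> X" using assms by (simp_all add: J_X S_X)
  then have JSx: "J (S x) \<in> X" by (simp add: J_X)
  show "S (J x) \<in> {1..<p}" "S (J (S x)) \<in> {1..<p}" by (rule XR[OF S_X[OF Jx]], rule XR[OF S_X[OF JSx]])
  define a b where "a = J x" and "b = J (S x)"
  have a: "p dvd x * a - 1" using J_ex(2)[OF XR[OF assms]] by (simp add: a_def)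
  have b: "p dvd S x * b - 1" using J_ex(2)[OF XR[OF Sx]] by (simp add: b_def)
  \<comment> \<open>Multiplying by the unit \<open>x * S x\<close> clears the inverses
    \<open>a\<close> and \<open>b\<close>; the result is a combination of \<open>x * a - 1\<close>,
    \<open>S x * b - 1\<close> and \<open>p\<close>.\<close>
  have "x * S x * (S a * S b - 1)
    = (x * a - 1) * (S x * b - 1) - (x * a - 1) * (p - 1) * S x + (x*a - 1) - (S x * b - 1) * (p - 1) * x + (S x * b - 1)
       + p * (x * S x * (p - 2) + 1 - S x - x) + (1 + S x + x - p)"
    by (simp add: S_def algebra_simps)
  also have "1 + S x + x - p = 0" by (simp add: S_def)
  finally have eq: "x * S x * (S a * S b - 1) = (x * a - 1) * (S x * b - 1) - (x * a - 1) * (p - 1) * S x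
    + (x * a - 1) - (S x * b - 1) * (p - 1) * x + (S x * b - 1) + p * (x * S x * (p - 2) + 1 - S x - x)"
    by simp
  have "p dvd x * S x * (S a * S b - 1)"
    unfolding eq by (intro dvd_add dvd_diff dvd_mult2 a b dvd_refl)
  then show "p dvd S (J x) * S (J (S x)) - 1"
    using not_dvd[OF XR[OF assms]] not_dvd[OF XR[OF Sx]] by (simp add: dvd_mult_iff a_def b_def)
qed

section \<open>Orbits of the group of order 6 and their half-edges\<close>

definition tau :: "int \<Rightarrow> int set" where
  "tau x = {x, J x, S x, J (S x), S (J x), J (S (J x))}"

lemma tau_J: "x \<in> X \<Longrightarrow> tau (J x) = tau x"
  by (auto simp: tau_def J_X S_X)

lemma tau_S: assumes "x \<in> X" shows "tau (S x) = tau x"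
proof -
  have "J (S (J (S x))) = S (J x)" using assms by (simp add: braid J_X S_X)
  then show ?thesis using braid[OF assms] by (auto simp: tau_def)
qed

lemma self_tau: "x \<in> tau x" by (simp add: tau_def)

definition hc :: "int \<Rightarrow> int" where "hc x = min x (J x)"

lemma hc_cases: "hc x = x \<or> hc x = J x" by (auto simp: hc_def min_def)

lemma hc_X: "x \<in> X \<Longrightarrow> hc x \<in> X" using hc_cases[of x] J_X[of x] by metis

lemma hc_J: "x \<in> X \<Longrightarrow> hc (J x) = hc x" by (simp add: hc_def min.commute)

lemma hc_eq_iff: "x \<in> X \<Longrightarrow> y \<in> X \<Longrightarrow> hc x = hc y \<longleftrightarrow> y = x \<or> y = J x"
  using hc_cases[of x] hc_cases[of y] hc_J[of x] by (metis JJX)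

lemma tau_hc: "x \<in> X \<Longrightarrow> tau (hc x) = tau x"
  using hc_cases[of x] tau_J[of x] by metis

text \<open>Half-edges are the classes \<open>{x, J x}\<close>, represented by their smaller element.\<close>

definition H1 :: "int set" where "H1 = {x \<in> X. x \<le> J x}"

lemma finite_H1: "finite H1"
proof -
  have "H1 \<subseteq> {1..<p - 1}" by (auto simp: H1_def X_def)
  then show ?thesis by (rule finite_subset) simp
qed

lemma hc_H1: "x \<in> X \<Longrightarrow> hc x \<in> H1"
  using J_X[of x] by (auto simp: H1_def hc_def min_def)

lemma H1_hc: "x \<in> H1 \<Longrightarrow> hc x = x" by (simp add: H1_def hc_def)

text \<open>\<open>J\<close> pairs off the six terms of the orbit, which leaves three half-edges,
  possibly with repetitions.\<close>

lemma fiber: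
  assumes "x \<in> X"
  shows "{h \<in> H1. tau h = tau x} = {hc x, hc (S x), hc (S (J x))}"
proof (intro equalityI subsetI)
  fix h assume h: "h \<in> {h \<in> H1. tau h = tau x}"
  then have "h \<in> tau x" using self_tau[of h] by auto
  then have "hc h \<in> {hc x, hc (S x), hc (S (J x))}"
    using assms by (auto simp: tau_def hc_J J_X S_X)
  then show "h \<in> {hc x, hc (S x), hc (S (J x))}" using H1_hc h by auto
next
  fix h assume "h \<in> {hc x, hc (S x), hc (S (J x))}"
  then show "h \<in> {h \<in> H1. tau h = tau x}"
    using assms by (auto simp: hc_H1 tau_hc tau_S tau_J J_X S_X)
qed

definition generic :: "int \<Rightarrow> bool" where
  "generic x \<longleftrightarrow> hc x \<noteq> hc (S x) \<and> hc x \<noteq> hc (S (J x)) \<and> hc (S x) \<noteq> hc (S (J x))"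

text \<open>If two of the three half-edges coincide, some nontrivial element of the group fixes
  \<open>x\<close>. The three involutions fix only 1, -1/2 and -2 in \<open>X\<close>, and these
  form the orbit of 1; the elements of order 3 fix only the roots of x^2 + x + 1, which the last
  hypothesis excludes.\<close>

lemma nongeneric:
  assumes "x \<in> X" "\<not> generic x" "S (J x) \<noteq> x"
  shows "tau x = tau 1"
proof -
  note X = assms(1) J_X[OF assms(1)] S_X[OF assms(1)] S_X[OF J_X[OF assms(1)]] J_X[OF S_X[OF assms(1)]]
  have 1: "1 \<in> X" using ge5 by (simp add: X_def)
  have fix1: "y = 1" if "y \<in> X" "J y = y" for y using J_eq_self[OF XR that(2)] that(1) by (auto simp: X_def)
  have SJ: "J x \<noteq> S x" using assms(3) by auto
  have half: "tau x = tau 1" if "x = S x"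
  proof -
    have x: "2 * x = p - 1" using that by (simp add: S_def)
    \<comment> \<open>Here x is -1/2, with inverse -2.\<close>
    have "J x = p - 2"
    proof (rule J_unique[OF XR[OF assms(1)]])
      have "x * (p - 2) - 1 = p * (x - 1)" using x by (simp add: algebra_simps)
      then show "p dvd x * (p - 2) - 1" by simp
    qed (use ge5 in auto)
    then have "S (J x) = 1" by (simp add: S_def)
    then show ?thesis using tau_S[OF X(2)] tau_J[OF X(1)] by simp
  qed
  from assms(2) consider "hc x = hc (S x)" | "hc x = hc (S (J x))" | "hc (S x) = hc (S (J x))"
    by (auto simp: generic_def)
  then show ?thesis
  proof cases
    case 1
    then have "S x = x \<or> S x = J x" using hc_eq_iff[OF X(1) X(3)] by simp
    then show ?thesis using half SJ by auto
  next
    case 2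
    then have "S (J x) = J x" using hc_eq_iff[OF X(1) X(4)] assms(3) by simp
    then have "J (S (J x)) = x" using X by simp
    then have "S (J (S x)) = x" using braid[OF X(1)] by simp
    then have "J (S x) = S x" by (metis S_S)
    then have "S x = 1" using fix1 X by blast
    then show ?thesis using tau_S[OF X(1)] by simp
  next
    case 3
    then have "S (J x) = S x \<or> S (J x) = J (S x)" using hc_eq_iff[OF X(3) X(4)] by simp
    then show ?thesis
    proof
      assume "S (J x) = S x"
      then have "J x = x" by (metis S_S)
      then show ?thesis using fix1[OF X(1)] by simp
    next
      assume "S (J x) = J (S x)"
      then have "J (S (J x)) = S x" using X by simp
      then have "S (J (S x)) = S x" using braid[OF X(1)] by simp
      then have "J (S x) = x" by (metis S_S)
      then have "S x = J x" using X by (metis JJX)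
      then show ?thesis using SJ by simp
    qed
  qed
qed

lemma fixed_iff: assumes "x \<in> X" shows "S (J x) = x \<longleftrightarrow> p dvd x * x + x + 1"
proof -
  have "S (J x) = x \<longleftrightarrow> J x = S x" by (metis S_S)
  also have "\<dots> \<longleftrightarrow> p dvd x * S x - 1"
    using J_ex(2)[OF XR[OF assms]] J_unique[OF XR[OF assms] XR[OF S_X[OF assms]]] by metis
  also have "x * S x - 1 = p * x - (x * x + x + 1)" by (simp add: S_def algebra_simps)
  also have "p dvd p * x - (x * x + x + 1) \<longleftrightarrow> p dvd x * x + x + 1" by (metis dvd_diff_right_iff dvd_triv_left)
  finally show ?thesis .
qed

lemma fixed_unique:
  assumes "x \<in> X" "y \<in> X" "S (J x) = x" "S (J y) = y"
  shows "y = x \<or> y = S x"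
proof -
  have "p dvd (y * y + y + 1) - (x * x + x + 1)" using fixed_iff assms by (blast intro: dvd_diff)
  then have "p dvd (y - x) * (y - (- 1 - x))" by (simp add: algebra_simps)
  then have "p dvd y - x \<or> p dvd y - (- 1 - x)" by (simp add: dvd_mult_iff)
  then show ?thesis
  proof
    assume "p dvd y - x" then show ?thesis using dvd_diff_eq[of y x] assms by (auto simp: X_def)
  next
    assume "p dvd y - (- 1 - x)"
    then have "p dvd y - (- 1 - x) - p" by simp
    then have "p dvd y - S x" by (simp add: S_def algebra_simps)
    then show ?thesis using dvd_diff_eq[of y "S x"] assms(1,2) S_X[of x] by (force simp: X_def)
  qed
qed

text \<open>The number 1 is a root of x^2 + x + 1 only modulo 3, so the two kinds of degenerate
  vertices are different for \<open>p \<ge> 5\<close>.\<close>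

lemma tau_1_not_fixed: assumes "x \<in> X" "tau x = tau 1" shows "S (J x) \<noteq> x"
proof
  assume fx: "S (J x) = x"
  then have "S x = J x" by (metis S_S)
  then have "tau x = {x, J x}" using assms fx by (auto simp: tau_def)
  moreover have "1 \<in> tau x" using assms self_tau by simp
  ultimately have "1 = x \<or> 1 = J x" by auto
  then have "x = 1" using assms(1) by (metis J_1 JJX)
  then have "p dvd 3" using fixed_iff[OF assms(1)] fx by simp
  then show False using ge5 zdvd_imp_le[of p 3] by simp
qed

lemma fiber_1: "{h \<in> H1. tau h = tau 1} = {1, hc (p - 2)}" "hc (p - 2) \<noteq> 1"
proof -
  have 1: "1 \<in> X" "p - 2 \<in> X" using ge5 by (auto simp: X_def)
  show "{h \<in> H1. tau h = tau 1} = {1, hc (p - 2)}"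
    using fiber[OF 1(1)] by (auto simp: S_def hc_def[of 1])
  show "hc (p - 2) \<noteq> 1"
    using hc_eq_iff[OF 1] ge5 by (auto simp: hc_def[of 1])
qed

lemma fiber_fixed:
  assumes "x \<in> X" "S (J x) = x"
  shows "{h \<in> H1. tau h = tau x} = {hc x}"
proof -
  have "S x = J x" using assms by (metis S_S)
  then show ?thesis using fiber[OF assms(1)] assms hc_J by auto
qed

section \<open>Slope relations and vertex relations\<close>


text \<open>\<open>M\<close> plays the role of zero. The last condition is the shadow of relation
  (iii) with \<open>j = 2\<close>: for a pair (a, b) of slope x, the pair (a, b - a) has slope x -
  1, and (b, a - b) has slope 1/x - 1. Both can be 0, so 0 needs a condition of its own.\<close>

definition slope_rel :: "'a::ab_group_add set \<Rightarrow> (int \<Rightarrow> 'a) \<Rightarrow> bool" where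
  "slope_rel M q \<longleftrightarrow> q 0 \<in> M \<and> q (p - 1) \<in> M
     \<and> (\<forall>x\<in>{1..<p}. q (J x) - q x \<in> M \<and> q x - q (x - 1) - q (J x - 1) \<in> M)"

lemma J_succ: assumes "x \<in> X" shows "J (x + 1) - 1 = S (J (S x))"
proof -
  have "x + 1 = p - S x" by (simp add: S_def)
  then have "J (x + 1) = p - J (S x)" using J_uminus[OF XR[OF S_X[OF assms]]] by simp
  then show ?thesis by (simp add: S_def)
qed

lemma slope_rel_1:
  assumes M: "diff_closed M" and q: "slope_rel M q"
  shows "q 1 \<in> M"
proof -
  have "1 \<in> {1..<p}" using ge5 by simp
  then have "q 1 - q (1 - 1) - q (J 1 - 1) \<in> M" using q unfolding slope_rel_def by blast
  then have "(q 1 - q 0 - q 0) + q 0 + q 0 \<in> M"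
    using q by (intro diff_closed_add[OF M]) (auto simp: slope_rel_def)
  then show ?thesis by simp
qed

text \<open>The relations for -x and for x + 1 end in the terms \<open>S (J x)\<close> and
  \<open>S (J (S x))\<close>, which are inverse to each other by \<open>braid\<close>. Subtracting
  them gives q (x + 1) - q x = q (-x) - q (-x - 1) modulo \<open>M\<close>, so the sum of the values
  at x and -x does not depend on x.\<close>

lemma slope_rel_odd:
  assumes M: "diff_closed M" and q: "slope_rel M q" and x: "x \<in> {1..<p}"
  shows "q x + q (p - x) \<in> M"
proof -
  have "1 \<le> x" using x by simp
  then show ?thesis using x
  proof (induction x rule: int_ge_induct)
    case base
    then show ?case using slope_rel_1[OF M q] q by (auto simp: slope_rel_def intro: diff_closed_add[OF M])
  next
    case (step x)
    then have x: "x \<in> X" by (auto simp: X_def)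
    have inv: "q (J y) - q y \<in> M" and rel: "q y - q (y - 1) - q (J y - 1) \<in> M" if "y \<in> {1..<p}" for y
      using q that unfolding slope_rel_def by blast+
    have b: "p - x \<in> {1..<p}" "x + 1 \<in> {1..<p}" using step by auto
    have "J (p - x) - 1 = S (J x)" using J_uminus[OF XR[OF x]] by (simp add: S_def)
    then have 1: "q (p - x) - q (S x) - q (S (J x)) \<in> M"
      using rel[OF b(1)] by (simp add: S_def diff_diff_eq add.commute)
    have 2: "q (x + 1) - q x - q (S (J (S x))) \<in> M"
      using rel[OF b(2)] J_succ[OF x] by simp
    have 3: "q (S (J (S x))) - q (S (J x)) \<in> M"
      using inv[OF XR[OF S_X[OF J_X[OF x]]]] braid[OF x] by simp
    have "q x + q (p - x) \<in> M" using step by simp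
    then have "(q (x + 1) - q x - q (S (J (S x)))) - (q (p - x) - q (S x) - q (S (J x)))
       + (q (S (J (S x))) - q (S (J x))) + (q x + q (p - x)) \<in> M"
      by (rule diff_closed_add[OF M diff_closed_add[OF M diff_closed_diff[OF M 2 1] 3]])
    then show ?case by (simp add: S_def algebra_simps)
  qed
qed

definition T :: "(int \<Rightarrow> 'a::ab_group_add) \<Rightarrow> int \<Rightarrow> 'a" where
  "T q x = q x + q (S x) + q (S (J x))"

lemma slope_rel_T:
  assumes M: "diff_closed M" and q: "slope_rel M q" and x: "x \<in> X"
  shows "T q x \<in> M"
proof -
  have y: "S x \<in> X" "x \<in> {1..<p}" by (rule S_X[OF x], rule XR[OF x])
  then have 1: "S x + 1 \<in> {1..<p}" by (auto simp: X_def)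
  have "q (S x + 1) - q (S x + 1 - 1) - q (J (S x + 1) - 1) \<in> M"
    using q 1 unfolding slope_rel_def by blast
  then have "q (S x + 1) - q (S x) - q (S (J x)) \<in> M" using J_succ[OF y(1)] by simp
  moreover have "q x + q (p - x) \<in> M" by (rule slope_rel_odd[OF M q y(2)])
  ultimately have "(q x + q (p - x)) - (q (S x + 1) - q (S x) - q (S (J x))) \<in> M"
    by (rule diff_closed_diff[OF M, rotated])
  then show ?thesis by (simp add: S_def T_def algebra_simps)
qed

lemma slope_rel_I:
  assumes M: "diff_closed M" and 0: "q 0 \<in> M" and 1: "q 1 \<in> M"
    and inv: "\<And>x. x \<in> {1..<p} \<Longrightarrow> q (J x) - q x \<in> M"
    and odd: "\<And>x. x \<in> {1..<p} \<Longrightarrow> q x + q (p - x) \<in> M"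
    and T: "\<And>x. x \<in> X \<Longrightarrow> T q x \<in> M"
  shows "slope_rel M q"
proof -
  have "q 1 + q (p - 1) \<in> M" using odd[of 1] ge5 by simp
  then have "q (p - 1) \<in> M" using diff_closed_diff[OF M _ 1] by fastforce
  moreover have "q x - q (x - 1) - q (J x - 1) \<in> M" if x: "x \<in> {1..<p}" for x
  proof (cases "x = 1")
    case True
    then show ?thesis by (simp add: diff_closed_diff[OF M] 0 1)
  next
    case False
    define y where "y = x - 1"
    have y: "y \<in> X" using x False by (auto simp: X_def y_def)
    have "q x + q (S y) \<in> M" using odd[OF x] by (simp add: S_def y_def)
    from diff_closed_diff[OF M this T[OF S_X[OF y]]] show ?thesis
      using J_succ[OF y] by (simp add: T_def y_def algebra_simps)
  qed
  ultimately show ?thesis using 0 inv by (simp add: slope_rel_def)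
qed

section \<open>The graph, its connectedness and its flows\<close>

definition V :: "int set set" where "V = tau ` X"
text \<open>Half-edges without a distinct partner are left out: 1, since -1 lies outside
  \<open>X\<close>, and the class of the square roots of -1, which \<open>sg\<close> would
  fix.\<close>

definition H :: "int set" where "H = {h \<in> H1. h \<noteq> 1 \<and> J h \<noteq> p - h}"
definition I :: "int set" where "I = {h \<in> H1. J h = p - h}"
definition sg :: "int \<Rightarrow> int" where "sg h = hc (p - h)"

lemma one_X: "1 \<in> X" using ge5 by (simp add: X_def)

lemma one_H1: "1 \<in> H1" using one_X by (simp add: H1_def)

lemma H1_X: "h \<in> H1 \<Longrightarrow> h \<in> X" by (simp add: H1_def)

lemma one_I: "1 \<notin> I" using ge5 by (auto simp: I_def)

lemma H1_eq: "H1 = insert 1 (H \<union> I)" using one_H1 by (auto simp: H_def I_def)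

lemma H_I: "H \<inter> I = {}" "1 \<notin> H" by (auto simp: H_def I_def)

lemma finite_HI: "finite H" "finite I"
  by (rule finite_subset[OF _ finite_H1], force simp: H_def I_def)+

lemma finite_V: "finite V" by (simp add: V_def X_def)

text \<open>The two square roots of -1 are inverse to each other and so form a single
  half-edge.\<close>

lemma I_unique: assumes "h \<in> I" "k \<in> I" shows "h = k"
proof -
  have sq: "p dvd x * x + 1" if "x \<in> I" for x
  proof -
    have "p dvd x * (p - x) - 1" using that J_ex(2)[OF XR[of x]] by (simp add: I_def H1_def)
    then have "p dvd p * x - (x * (p - x) - 1)" by (rule dvd_diff[OF dvd_triv_left])
    then show ?thesis by (simp add: algebra_simps)
  qed
  have hk: "h \<in> {1..<p}" "k \<in> {1..<p}" using assms XR[OF H1_X, of h] XR[OF H1_X, of k] by (auto simp: I_def)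
  have "p dvd (h * h + 1) - (k * k + 1)" using sq assms by (blast intro: dvd_diff)
  then have "p dvd (h - k) * (h + k)" by (simp add: algebra_simps)
  then consider "p dvd h - k" | "p dvd h + k" by (auto simp: dvd_mult_iff)
  then show ?thesis
  proof cases
    case 1
    then show ?thesis by (rule dvd_diff_eq) (use hk in auto)
  next
    case 2
    then have "p dvd h + k - p" by simp
    then have "p dvd k - (p - h)" by (simp add: algebra_simps)
    then have "k = p - h" by (rule dvd_diff_eq) (use hk in auto)
    then have "k = J h" "h = J k" using assms by (auto simp: I_def)
    then show ?thesis using assms by (auto simp: I_def H1_def)
  qed
qed

lemma I_cases: obtains "I = {}" | i where "I = {i}"
  using I_unique by blast

lemma minus_X: "x \<in> X \<Longrightarrow> x \<noteq> 1 \<Longrightarrow> p - x \<in> X" by (auto simp: X_def)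

lemma sg_H: assumes "h \<in> H" shows "sg h \<in> H" "sg (sg h) = h" "sg h \<noteq> h"
proof -
  have h: "h \<in> X" "h \<noteq> 1" "h \<le> J h" "J h \<noteq> p - h" and hR: "h \<in> {1..<p}"
    using assms XR[of h] by (auto simp: H_def H1_def)
  have m: "p - h \<in> X" by (rule minus_X[OF h(1,2)])
  have Jm: "J (p - h) = p - J h" by (rule J_uminus[OF hR])
  have J1: "J h \<noteq> 1" using h by (metis JJX J_1)
  have Jh: "J h \<in> X" by (rule J_X[OF h(1)])
  have ne: "p - h \<noteq> h"
  proof
    assume "p - h = h"
    then have "2 * h = p" by simp
    then have "p dvd 2 * h" by simp
    then have "p dvd 2 \<or> p dvd h" by (simp add: dvd_mult_iff)
    then show False using ge5 not_dvd[OF hR] zdvd_imp_le[of p 2] by auto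
  qed
  have c: "sg h = p - h \<or> sg h = p - J h" using hc_cases[of "p - h"] Jm by (simp add: sg_def)
  show "sg h \<noteq> h" using c ne h(4) by auto
  have J: "J (sg h) = p - h \<and> sg h = p - J h \<or> J (sg h) = p - J h \<and> sg h = p - h"
    using c Jm JJX[OF m] by auto
  have "sg h \<noteq> 1" using c h(1) Jh by (auto simp: X_def)
  moreover have "sg h \<in> H1" unfolding sg_def by (rule hc_H1[OF m])
  ultimately show "sg h \<in> H" using J h(4) by (auto simp: H_def)
  have "hc (p - sg h) = hc h" using J hc_J[OF h(1)] by auto
  then show "sg (sg h) = h" using h(3) by (simp add: sg_def hc_def)
qed

text \<open>Since \<open>S\<close> sends -x to x - 1, the edge at x leads to the vertex of x - 1,
  and descending in this way ends at 1. Leaving out square roots of -1 does no harm: for these -x =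
  1/x, so x and x - 1 have the same vertex already.\<close>

lemma H_connected:
  assumes W: "W \<subseteq> V" "W \<noteq> {}" and cl: "\<And>h. h \<in> H \<Longrightarrow> tau h \<in> W \<Longrightarrow> tau (sg h) \<in> W"
  shows "W = V"
proof -
  have shift: "tau x \<in> W \<longleftrightarrow> tau (x - 1) \<in> W" if x: "x \<in> X" "x \<noteq> 1" for x
  proof -
    note m = minus_X[OF x]
    have xm: "tau (p - x) = tau (x - 1)" using tau_S[OF m] by (simp add: S_def)
    show ?thesis
    proof (cases "hc x \<in> H")
      case True
      have "tau (sg (hc x)) = tau (p - x)"
        using hc_cases[of x] J_uminus[OF XR[OF x(1)]] tau_hc[OF m] tau_J[OF m] hc_J[OF m] by (auto simp: sg_def)
      moreover have "tau (hc x) \<in> W \<longleftrightarrow> tau (sg (hc x)) \<in> W"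
        using cl[OF True] cl[OF sg_H(1)[OF True]] sg_H(2)[OF True] by auto
      ultimately show ?thesis using tau_hc[OF x(1)] xm by simp
    next
      case False
      have "hc x \<noteq> 1" using x hc_cases[of x] by (metis JJX J_1)
      then have "J (hc x) = p - hc x" using False hc_H1[OF x(1)] by (auto simp: H_def)
      then have "J x = p - x" using hc_cases[of x] x(1) by auto
      then show ?thesis using tau_J[OF x(1)] xm by simp
    qed
  qed
  have all: "tau x \<in> W \<longleftrightarrow> tau 1 \<in> W" if "x \<in> X" for x
  proof -
    have "1 \<le> x" using that by (simp add: X_def)
    then show ?thesis using that
    proof (induction x rule: int_ge_induct)
      case (step x)
      then have "x \<in> X" by (simp add: X_def)
      then show ?case using step shift[of "x + 1"] by simp
    qed simp
  qed
  obtain x where "x \<in> X" "tau x \<in> W" using W by (auto simp: V_def)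
  then show ?thesis using all W(1) by (auto simp: V_def)
qed

text \<open>The vertices that can be the end of a unit flow from \<open>u\<close> are closed under
  traversing an edge, so by connectedness they are all vertices.\<close>

lemma flow:
  assumes u: "u \<in> V" and v: "v \<in> V"
  obtains l :: "int \<Rightarrow> int" where "\<And>h. h \<in> H \<Longrightarrow> l (sg h) = - l h"
    "\<And>w. w \<in> V \<Longrightarrow> (\<Sum>h | h \<in> H \<and> tau h = w. l h) = (if w = u then 1 else 0) - (if w = v then 1 else 0)"
proof -
  define P where "P = (\<lambda>v (l :: int \<Rightarrow> int). (\<forall>h\<in>H. l (sg h) = - l h) \<and>
    (\<forall>w. (\<Sum>h | h \<in> H \<and> tau h = w. l h) = (if w = u then 1 else 0) - (if w = v then 1 else 0)))"
  define W where "W = {v \<in> V. \<exists>l. P v l}"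
  have "P u (\<lambda>_. 0)" by (simp add: P_def)
  then have "u \<in> W" using u by (auto simp: W_def)
  moreover have "tau (sg h) \<in> W" if h: "h \<in> H" and W: "tau h \<in> W" for h
  proof -
    note s = sg_H[OF h]
    obtain l where l: "P (tau h) l" using W by (auto simp: W_def)
    \<comment> \<open>One more unit along the edge of \<open>h\<close>: it cancels the -1 at
      \<open>tau h\<close> and creates a -1 at \<open>tau (sg h)\<close>.\<close>
    define l' where "l' = (\<lambda>k. l k + (if k = h then 1 else 0) - (if k = sg h then 1 else 0))"
    have "l' (sg k) = - l' k" if "k \<in> H" for k
    proof -
      have "sg k = h \<longleftrightarrow> k = sg h" "sg k = sg h \<longleftrightarrow> k = h" using s sg_H(2)[OF that] by auto
      then show ?thesis using l that by (simp add: l'_def P_def)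
    qed
    moreover have "(\<Sum>k | k \<in> H \<and> tau k = w. l' k) = (if w = u then 1 else 0) - (if w = tau (sg h) then 1 else 0)" for w
    proof -
      have "(\<Sum>k | k \<in> H \<and> tau k = w. l' k) = (\<Sum>k | k \<in> H \<and> tau k = w. l k)
         + (if tau h = w then 1 else 0) - (if tau (sg h) = w then 1 else 0)"
        using h s(1) finite_HI by (simp add: l'_def sum.distrib sum_subtractf)
      also have "(\<Sum>k | k \<in> H \<and> tau k = w. l k) = (if w = u then 1 else 0) - (if w = tau h then 1 else 0)"
        using l by (simp add: P_def)
      finally show ?thesis by (auto split: if_splits)
    qed
    ultimately have "P (tau (sg h)) l'" by (simp add: P_def)
    moreover have "tau (sg h) \<in> V" using s(1) by (auto simp: V_def H_def H1_X)
    ultimately show ?thesis by (auto simp: W_def)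
  qed
  ultimately have "W = V" by (intro H_connected) (auto simp: W_def)
  then obtain l where "P v l" using v by (auto simp: W_def)
  then show ?thesis by (intro that[of l]) (auto simp: P_def)
qed

definition Fx :: "int set set" where "Fx = tau ` {x \<in> X. S (J x) = x}"

lemma Fx_V: "Fx \<subseteq> V" by (auto simp: Fx_def V_def)

lemma Fx_unique: assumes "u \<in> Fx" "v \<in> Fx" shows "u = v"
proof -
  obtain x y where "u = tau x" "x \<in> X" "S (J x) = x" "v = tau y" "y \<in> X" "S (J y) = y"
    using assms by (auto simp: Fx_def)
  then show ?thesis using fixed_unique[of x y] tau_S[of x] by auto
qed

lemma card_le_1: "(\<And>x y. x \<in> A \<Longrightarrow> y \<in> A \<Longrightarrow> x = y) \<Longrightarrow> card A \<le> 1"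
  by (metis One_nat_def card_le_Suc0_iff_eq card.infinite le_numeral_extra(1) zero_le)

lemma tau_1_Fx: "tau 1 \<notin> Fx"
  using tau_1_not_fixed by (auto simp: Fx_def)

lemma generic_card: assumes "x \<in> X" "generic x" shows "card {h \<in> H1. tau h = tau x} = 3"
  using assms by (simp add: fiber generic_def)

lemma vertex_cases [consumes 1]:
  assumes "x \<in> X"
  obtains (generic) "generic x" "tau x \<noteq> tau 1" "tau x \<notin> Fx" | (one) "tau x = tau 1" "tau x \<notin> Fx"
    | (fixed) y where "tau x = tau y" "y \<in> X" "S (J y) = y" "tau x \<noteq> tau 1" "tau x \<in> Fx"
proof -
  have g1: "tau x \<noteq> tau 1" if "generic x"
    using generic_card[OF assms that] fiber_1 by auto
  have gF: "tau x \<notin> Fx" if "generic x"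
    using generic_card[OF assms that] fiber_fixed by (auto simp: Fx_def)
  show ?thesis
  proof (cases "tau x \<in> Fx")
    case True
    moreover obtain y where "tau x = tau y" "y \<in> X" "S (J y) = y" using True by (auto simp: Fx_def)
    ultimately show ?thesis using fixed tau_1_Fx by metis
  next
    case False
    then have "S (J x) \<noteq> x" using assms by (auto simp: Fx_def)
    then show ?thesis using nongeneric[OF assms] False generic one g1 gF by blast
  qed
qed

text \<open>At the vertex of 1 two of the three half-edges agree because \<open>J 1 = 1\<close>; at
  a vertex in \<open>Fx\<close> all three agree.\<close>

lemma card_fiber: assumes "v \<in> V"
  shows "card {h \<in> H1. tau h = v} + (if v = tau 1 then 1 else 0) + 2 * (if v \<in> Fx then 1 else 0) = 3"
proof -
  obtain x where x: "x \<in> X" "v = tau x" using assms by (auto simp: V_def)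
  from x(1) show ?thesis
  proof (cases rule: vertex_cases)
    case generic
    then show ?thesis using generic_card x by simp
  next
    case one
    then show ?thesis using fiber_1 x by auto
  next
    case (fixed y)
    then show ?thesis using fiber_fixed[of y] x by simp
  qed
qed

lemma card_V: "3 * card V = card H1 + 1 + 2 * card Fx"
proof -
  have "(\<Sum>v\<in>V. card {h \<in> H1. tau h = v}) = (\<Sum>v\<in>V. \<Sum>h\<in>{h \<in> H1. tau h = v}. 1)" by simp
  also have "\<dots> = card H1"
    by (subst sum.group[OF finite_H1 finite_V]) (auto simp: V_def H1_X)
  finally have 1: "(\<Sum>v\<in>V. card {h \<in> H1. tau h = v}) = card H1" .
  have "tau 1 \<in> V" using one_X by (simp add: V_def)
  moreover have "(\<Sum>v\<in>V. if v \<in> Fx then 1 else 0 :: nat) = card Fx"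
    using Fx_V finite_V by (simp add: sum.If_cases Int_absorb1)
  moreover have "(\<Sum>v\<in>V. card {h \<in> H1. tau h = v} + (if v = tau 1 then 1 else 0) + 2 * (if v \<in> Fx then 1 else 0)) = (\<Sum>v\<in>V. 3)"
    by (rule sum.cong[OF refl card_fiber])
  ultimately show ?thesis using 1 finite_V by (simp add: sum.distrib sum_distrib_left[symmetric])
qed

text \<open>The involution \<open>J\<close> has 1 as its only fixed point among the p - 2 elements
  of \<open>X\<close>.\<close>

lemma card_H1: "2 * int (card H1) = p - 1"
proof -
  have inj: "inj_on J H1" by (rule inj_on_inverseI[of _ J]) (simp add: H1_X)
  have "X = H1 \<union> J ` H1"
  proof (intro equalityI subsetI)
    fix x assume x: "x \<in> X"
    show "x \<in> H1 \<union> J ` H1"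
    proof (cases "x \<le> J x")
      case False
      then have "J x \<in> H1" "x = J (J x)" using x by (simp_all add: H1_def J_X)
      then show ?thesis by blast
    qed (use x in \<open>simp add: H1_def\<close>)
  qed (auto simp: H1_X J_X)
  moreover have "H1 \<inter> J ` H1 = {1}"
  proof (intro equalityI subsetI)
    fix x assume x: "x \<in> H1 \<inter> J ` H1"
    then obtain y where y: "y \<in> H1" "x = J y" by blast
    then have "x = y" using x by (auto simp: H1_def)
    then have "x = 1 \<or> x = p - 1" using J_eq_self[OF XR[OF H1_X]] y by auto
    then show "x \<in> {1}" using H1_X[OF y(1)] \<open>x = y\<close> by (auto simp: X_def)
  qed (use one_H1 J_1 in \<open>auto intro: rev_image_eqI\<close>)
  ultimately have "card H1 + card (J ` H1) = card X + 1"
    using card_Un_Int[of H1 "J ` H1"] finite_H1 by simp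
  moreover have "card X = nat (p - 2)" using ge5 by (simp add: X_def)
  ultimately show ?thesis using card_image[OF inj] ge5 by simp
qed

lemma card_H: "card H1 = card H + card I + 1"
  using finite_HI H_I one_I by (simp add: H1_eq card_Un_disjoint)


lemma H_sum:
  fixes F :: "int \<Rightarrow> 'a::comm_monoid_add"
  shows "(\<Sum>h | h \<in> H1 \<and> tau h = v. F h)
    = (\<Sum>h | h \<in> H \<and> tau h = v. F h) + (\<Sum>h | h \<in> I \<and> tau h = v. F h) + (if v = tau 1 then F 1 else 0)"
proof -
  have "{h. h \<in> H1 \<and> tau h = v} = ({h. h \<in> H \<and> tau h = v} \<union> {h. h \<in> I \<and> tau h = v}) \<union> (if v = tau 1 then {1} else {})"
    by (auto simp: H1_eq)
  moreover have "sum F (({h. h \<in> H \<and> tau h = v} \<union> {h. h \<in> I \<and> tau h = v}) \<union> (if v = tau 1 then {1} else {}))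
    = sum F ({h. h \<in> H \<and> tau h = v} \<union> {h. h \<in> I \<and> tau h = v}) + sum F (if v = tau 1 then {1} else {})"
    using finite_HI H_I(2) one_I by (intro sum.union_disjoint) (auto split: if_splits)
  moreover have "sum F ({h. h \<in> H \<and> tau h = v} \<union> {h. h \<in> I \<and> tau h = v})
    = sum F {h. h \<in> H \<and> tau h = v} + sum F {h. h \<in> I \<and> tau h = v}"
    using finite_HI H_I(1) by (intro sum.union_disjoint) auto
  ultimately show ?thesis by simp
qed

section \<open>Vertex sums compared with the three-term relations\<close>

context
  fixes M :: "'a::ab_group_add set" and q :: "int \<Rightarrow> 'a"
  assumes M: "diff_closed M" and inv: "\<And>x. x \<in> X \<Longrightarrow> q (J x) - q x \<in> M"
begin

lemma hc_cong: "x \<in> X \<Longrightarrow> q (hc x) - q x \<in> M"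
  using inv[of x] hc_cases[of x] by (auto simp: diff_closed_zero[OF M])

lemma fiber_sum_generic:
  assumes x: "x \<in> X" "generic x"
  shows "(\<Sum>h | h \<in> H1 \<and> tau h = tau x. q h) - T q x \<in> M"
proof -
  have "(\<Sum>h | h \<in> H1 \<and> tau h = tau x. q h) = q (hc x) + q (hc (S x)) + q (hc (S (J x)))"
    using x by (simp add: fiber generic_def add.assoc)
  moreover have "(q (hc x) - q x) + (q (hc (S x)) - q (S x)) + (q (hc (S (J x))) - q (S (J x))) \<in> M"
    using x by (intro diff_closed_add[OF M] hc_cong S_X J_X)
  ultimately show ?thesis by (simp add: T_def algebra_simps)
qed

lemma fiber_sum_one: "(\<Sum>h | h \<in> H1 \<and> tau h = tau 1. q h) - (q 1 + q (p - 2)) \<in> M"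
proof -
  have "p - 2 \<in> X" using ge5 by (simp add: X_def)
  then have "q (hc (p - 2)) - q (p - 2) \<in> M" by (rule hc_cong)
  then show ?thesis using fiber_1(2) by (simp add: fiber_1(1))
qed

lemma T_one: "T q 1 = q 1 + q (p - 2) + q (p - 2)"
  by (simp add: T_def S_def)

text \<open>All three terms of \<open>T\<close> belong to the one half-edge at such a vertex, so the
  relation controls only three times the vertex sum.\<close>

lemma fiber_sum_fixed:
  assumes "x \<in> X" "S (J x) = x"
  shows "T q x - ((\<Sum>h | h \<in> H1 \<and> tau h = tau x. q h) + (\<Sum>h | h \<in> H1 \<and> tau h = tau x. q h)
    + (\<Sum>h | h \<in> H1 \<and> tau h = tau x. q h)) \<in> M"
proof -
  have "S x = J x" using assms by (metis S_S)
  then have "(q (J x) - q x) - (q (hc x) - q x) - (q (hc x) - q x) - (q (hc x) - q x) \<in> M"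
    using assms by (intro diff_closed_diff[OF M] inv hc_cong)
  then show ?thesis using assms \<open>S x = J x\<close> by (simp add: fiber_fixed T_def algebra_simps)
qed

lemma T_J: "x \<in> X \<Longrightarrow> T q (J x) - T q x \<in> M"
  using inv[of x] by (simp add: T_def algebra_simps)

lemma T_S: assumes "x \<in> X" shows "T q (S x) - T q x \<in> M"
proof -
  have "q (J (S (J x))) - q (S (J x)) \<in> M" by (intro inv S_X J_X assms)
  then show ?thesis using braid[OF assms] by (simp add: T_def algebra_simps)
qed

lemma T_tau:
  assumes "x \<in> X" "y \<in> tau x"
  shows "T q y \<in> M \<longleftrightarrow> T q x \<in> M"
proof -
  have J: "T q (J z) \<in> M \<longleftrightarrow> T q z \<in> M" and S: "T q (S z) \<in> M \<longleftrightarrow> T q z \<in> M" if "z \<in> X" for z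
    using diff_closed_cong_iff[OF M T_J[OF that]] diff_closed_cong_iff[OF M T_S[OF that]] by auto
  show ?thesis using assms by (auto simp: tau_def J S J_X S_X)
qed

end

lemma sum_V: "(\<Sum>v\<in>V. \<Sum>h | h \<in> H1 \<and> tau h = v. F h) = sum F H1" for F :: "int \<Rightarrow> 'a::comm_monoid_add"
  by (subst sum.group[OF finite_H1 finite_V]) (auto simp: V_def H1_X)

text \<open>Summing all vertex relations ties the value at 2 to the values at the square roots of \<open>-1\<close>
  and forces the value at the cube roots of unity to vanish.\<close>

lemma vertex_sums:
  fixes M :: "'a::ab_group_add set"
  assumes M: "diff_closed M" and q: "slope_rel M q"
  shows "sum q I + sum q I \<in> M"
    and "\<forall>v\<in>V. (\<Sum>h | h \<in> H1 \<and> tau h = v. q h) - (if v = tau 1 then sum q I else 0) \<in> M"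
proof -
  note 0 = diff_closed_zero[OF M] and add = diff_closed_add[OF M] and diff = diff_closed_diff[OF M]
  have inv: "q (J x) - q x \<in> M" if "x \<in> X" for x
    using q XR[OF that] unfolding slope_rel_def by blast
  have TM: "T q x \<in> M" if "x \<in> X" for x by (rule slope_rel_T[OF M q that])
  have q1: "q 1 \<in> M" by (rule slope_rel_1[OF M q])
  let ?A = "\<lambda>v. \<Sum>h | h \<in> H1 \<and> tau h = v. q h" and ?s = "sum q I"
  have "q h + q h \<in> M" if h: "h \<in> I" for h
  proof -
    have hX: "h \<in> X" and Jh: "J h = p - h" using h by (simp_all add: I_def H1_X)
    have "(q h + q (p - h)) - (q (J h) - q h) \<in> M"
      by (intro diff slope_rel_odd[OF M q] XR inv hX)
    then show ?thesis using Jh by (simp add: algebra_simps)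
  qed
  then have "(\<Sum>h\<in>I. q h + q h) \<in> M" by (rule diff_closed_sum[OF M])
  then show s2: "?s + ?s \<in> M" by (simp add: sum.distrib)
  have HM: "sum q H \<in> M"
  proof -
    have "sum q H = (\<Sum>h | h \<in> H \<and> h < sg h. q h) + (\<Sum>h | h \<in> H \<and> sg h < h. q h)"
    proof -
      define A B where "A = {h \<in> H. h < sg h}" and "B = {h \<in> H. sg h < h}"
      have "h < sg h \<or> sg h < h" if "h \<in> H" for h using sg_H(3)[OF that] by linarith
      then have AB: "A \<union> B = H" unfolding A_def B_def by blast
      have "finite A" "finite B" using finite_HI(1) AB finite_Un by metis+
      moreover have "A \<inter> B = {}" by (auto simp: A_def B_def)
      ultimately have "sum q (A \<union> B) = sum q A + sum q B" by (rule sum.union_disjoint)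
      then show ?thesis unfolding AB by (simp only: A_def B_def)
    qed
    also have "(\<Sum>h | h \<in> H \<and> sg h < h. q h) = (\<Sum>h | h \<in> H \<and> h < sg h. q (sg h))"
      by (rule sum.reindex_bij_witness[of _ sg sg]) (auto simp: sg_H)
    also have "(\<Sum>h | h \<in> H \<and> h < sg h. q h) + \<dots> = (\<Sum>h | h \<in> H \<and> h < sg h. q h + q (sg h))"
      by (simp add: sum.distrib)
    also have "\<dots> \<in> M"
    proof (rule diff_closed_sum[OF M])
      fix h assume "h \<in> {h. h \<in> H \<and> h < sg h}"
      then have h: "h \<in> X" "h \<noteq> 1" by (auto simp: H_def H1_X)
      have "(q h + q (p - h)) + (q (hc (p - h)) - q (p - h)) \<in> M"
        by (intro add slope_rel_odd[OF M q] XR h hc_cong[where q = q, OF M inv] minus_X)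
      then show "q h + q (sg h) \<in> M" by (simp add: sg_def)
    qed
    finally show ?thesis .
  qed
  have gen: "?A v \<in> M" if v: "v \<in> V - {tau 1} - Fx" for v
  proof -
    obtain x where x: "x \<in> X" "v = tau x" using v by (auto simp: V_def)
    from x(1) show ?thesis
    proof (cases rule: vertex_cases)
      case generic
      then show ?thesis
        using diff_closed_cong_iff[OF M fiber_sum_generic[where q = q, OF M inv x(1) generic(1)]] TM[OF x(1)] x(2) by simp
    qed (use v x in auto)
  qed
  let ?o = "sum ?A Fx"
  have "?A v + ?A v + ?A v \<in> M" if "v \<in> Fx" for v
  proof -
    obtain x where x: "v = tau x" "x \<in> X" "S (J x) = x" using \<open>v \<in> Fx\<close> by (auto simp: Fx_def)
    then show ?thesis using diff_closed_cong_iff[OF M fiber_sum_fixed[where q = q, OF M inv x(2,3)]] TM[OF x(2)] by simp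
  qed
  then have "(\<Sum>v\<in>Fx. ?A v + ?A v + ?A v) \<in> M" by (rule diff_closed_sum[OF M])
  then have o3: "?o + ?o + ?o \<in> M" by (simp add: sum.distrib)
  have A1: "?A (tau 1) - (q 1 + q (p - 2)) \<in> M" by (rule fiber_sum_one[where q = q, OF M inv])
  \<comment> \<open>In \<open>T q 1\<close> the term at -2 occurs twice, so only twice the sum at
    the vertex of 1 is known to vanish at this stage.\<close>
  have "q 1 + q (p - 2) + q (p - 2) \<in> M" using TM[OF one_X] T_one[where q = q, OF M inv] by simp
  from add[OF add[OF A1 A1] add[OF q1 this]] have A2: "?A (tau 1) + ?A (tau 1) \<in> M"
    by (simp add: algebra_simps)
  have e1: "sum ?A V = ?A (tau 1) + (sum ?A (V - {tau 1} - Fx) + ?o)"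
  proof -
    have "tau 1 \<in> V" using one_X by (simp add: V_def)
    then have "sum ?A V = ?A (tau 1) + sum ?A (V - {tau 1})" by (rule sum.remove[OF finite_V])
    also have "sum ?A (V - {tau 1}) = sum ?A (V - {tau 1} - Fx) + ?o"
      using Fx_V tau_1_Fx finite_V by (intro sum.subset_diff) auto
    finally show ?thesis .
  qed
  have e2: "sum ?A V = q 1 + (sum q H + ?s)"
    using sum_V[of q] finite_HI H_I one_I by (simp add: H1_eq sum.union_disjoint)
  have EM: "sum ?A (V - {tau 1} - Fx) \<in> M" by (rule diff_closed_sum[OF M gen])
  \<comment> \<open>In the total over all vertices the half-edges of \<open>H\<close> cancel in
    pairs and the generic vertices contribute nothing; what survives is one linear relation between
    the three degenerate terms.\<close>
  have "?A (tau 1) + ?o - ?s = sum ?A V - sum ?A (V - {tau 1} - Fx) - ?s"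
    unfolding e1 by (simp only: algebra_simps)
  also have "\<dots> = q 1 + sum q H - sum ?A (V - {tau 1} - Fx)"
    unfolding e2 by (simp only: algebra_simps)
  finally have A1s: "?A (tau 1) + ?o - ?s \<in> M"
    using diff[OF add[OF q1 HM] EM] by simp
  \<comment> \<open>The expression equals 3 o - 2 o for \<open>?o\<close>: a term killed by 3 is, by
    the total relation, a combination of terms killed by 2, so it vanishes.\<close>
  have "(?o + ?o + ?o) - ((?A (tau 1) + ?o - ?s) + (?A (tau 1) + ?o - ?s) - (?A (tau 1) + ?A (tau 1)) + (?s + ?s)) \<in> M"
    by (intro diff o3 add A1s A2 s2)
  then have oM: "?o \<in> M" by (simp add: algebra_simps)
  have A1s': "?A (tau 1) - ?s \<in> M" using diff[OF A1s oM] by (simp add: algebra_simps)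
  show "\<forall>v\<in>V. ?A v - (if v = tau 1 then ?s else 0) \<in> M"
  proof
    fix v assume v: "v \<in> V"
    consider "v = tau 1" | "v \<in> Fx" "v \<noteq> tau 1" | "v \<in> V - {tau 1} - Fx" using v by blast
    then show "?A v - (if v = tau 1 then ?s else 0) \<in> M"
    proof cases
      case 1
      then show ?thesis using A1s' by simp
    next
      case 2
      then have "Fx = {v}" using Fx_unique by blast
      then show ?thesis using oM 2 by simp
    next
      case 3
      then show ?thesis using gen by simp
    qed
  qed
qed

text \<open>The multiple of \<open>sum q I\<close> to which the vertex sum over \<open>H\<close> is
  congruent, once the half-edge in \<open>I\<close> has been moved to the other side. These weights
  add up to zero over \<open>V\<close>, as the vertex sums of an antisymmetric function
  must.\<close>

definition wt :: "int set \<Rightarrow> int" where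
  "wt v = (if v = tau 1 then int (card I) else 0) - int (card {h. h \<in> I \<and> tau h = v})"

lemma vertex_sums_H:
  fixes q :: "int \<Rightarrow> 'b \<Rightarrow>\<^sub>0 int"
  assumes M: "diff_closed M" and q: "slope_rel M q" and v: "v \<in> V"
  shows "(\<Sum>h | h \<in> H \<and> tau h = v. q h) - frag_cmul (wt v) (sum q I) \<in> M"
proof -
  have q1: "(if v = tau 1 then q 1 else 0) \<in> M"
    using slope_rel_1[OF M q] diff_closed_zero[OF M] by simp
  have "(\<Sum>h | h \<in> H1 \<and> tau h = v. q h) - (if v = tau 1 then sum q I else 0) - (if v = tau 1 then q 1 else 0) \<in> M"
    by (rule diff_closed_diff[OF M bspec[OF vertex_sums(2)[OF M q] v] q1])
  moreover have eq: "frag_cmul (wt v) (sum q I) = (if v = tau 1 then sum q I else 0) - (\<Sum>h | h \<in> I \<and> tau h = v. q h)"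
  proof (cases rule: I_cases)
    case (2 i)
    then have "{h. h \<in> I \<and> tau h = v} = (if tau i = v then {i} else {})" by auto
    then show ?thesis using 2 by (simp add: wt_def)
  qed (simp add: wt_def)
  ultimately show ?thesis unfolding eq by (simp add: H_sum algebra_simps)
qed

lemma wt_flow:
  obtains l :: "int \<Rightarrow> int" where "\<And>h. h \<in> H \<Longrightarrow> l (sg h) = - l h"
    "\<And>v. v \<in> V \<Longrightarrow> (\<Sum>h | h \<in> H \<and> tau h = v. l h) = wt v"
proof (cases rule: I_cases)
  case 1
  then show ?thesis by (intro that[of "\<lambda>_. 0"]) (simp_all add: wt_def)
next
  case (2 i)
  then have V: "tau i \<in> V" "tau 1 \<in> V" using one_X by (auto simp: V_def I_def H1_def)
  obtain l where l: "\<And>h. h \<in> H \<Longrightarrow> l (sg h) = - l h"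
    "\<And>w. w \<in> V \<Longrightarrow> (\<Sum>h | h \<in> H \<and> tau h = w. l h) = (if w = tau 1 then 1 else 0 :: int) - (if w = tau i then 1 else 0)"
    by (rule flow[OF V(2,1)]) blast
  show ?thesis
  proof (rule that[of l, OF l(1)])
    fix v assume "v \<in> V"
    have "{h. h \<in> I \<and> tau h = v} = (if v = tau i then {i} else {})" using 2 by auto
    moreover have "card I = 1" using 2 by simp
    ultimately have "wt v = (if v = tau 1 then 1 else 0) - (if v = tau i then 1 else 0)"
      unfolding wt_def by (simp only: if_distrib[of card]) (simp split: if_split)
    then show "(\<Sum>h | h \<in> H \<and> tau h = v. l h) = wt v" using l(2)[OF \<open>v \<in> V\<close>] by (rule trans[rotated, OF sym])
  qed
qed

text \<open>The value \<open>e\<close> is taken at the square roots of \<open>-1\<close>.\<close>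

definition ext :: "(int \<Rightarrow> int) \<Rightarrow> int \<Rightarrow> int \<Rightarrow> int" where
  "ext a e x = (if x \<in> X then if hc x \<in> H then a (hc x) else if hc x \<in> I then e else 0 else 0)"

text \<open>This is the converse direction: solutions on the graph give solutions of the slope
  relations. It is used with \<open>m = 0\<close>, \<open>e = 0\<close> for the cycles and with
  \<open>m = 2\<close>, \<open>e = 1\<close> for the torsion class, where the half-edge joined to
  itself demands that \<open>2 * e\<close> vanish modulo \<open>m\<close>.\<close>

lemma slope_rel_ext:
  assumes odd: "\<And>h. h \<in> H \<Longrightarrow> a (sg h) = - a h"
    and vert: "\<And>v. v \<in> V \<Longrightarrow> m dvd (\<Sum>h | h \<in> H \<and> tau h = v. a h) - e * wt v"
    and e: "m dvd 2 * e"
  shows "slope_rel {z. m dvd z} (ext a e)"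
proof (rule slope_rel_I)
  let ?M = "{z. m dvd z}" and ?f = "ext a e"
  show M: "diff_closed ?M" by (rule diff_closed_dvd)
  show "?f 0 \<in> ?M" by (simp add: ext_def X_def)
  have hc1: "hc 1 = 1" by (simp add: hc_def)
  have f1: "?f 1 = 0" using H_I one_I by (simp add: ext_def hc1)
  then show "?f 1 \<in> ?M" by simp
  have inv: "?f (J x) = ?f x" if "x \<in> X" for x
    using that by (simp add: ext_def hc_J J_X)
  have fm1: "?f (p - 1) = 0" by (simp add: ext_def X_def)
  show "?f (J x) - ?f x \<in> ?M" if "x \<in> {1..<p}" for x
    using that inv by (cases "x = p - 1") (auto simp: X_def)
  show "?f x + ?f (p - x) \<in> ?M" if x: "x \<in> {1..<p}" for x
  proof -
    have "x \<in> X \<or> x = p - 1" using x by (auto simp: X_def)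
    then consider "x = 1" | "x = p - 1" | "x \<in> X" "x \<noteq> 1" by blast
    then show ?thesis
    proof cases
      case 3
      note m = minus_X[OF 3]
      have pm: "hc (p - x) = hc (p - hc x)"
        using hc_cases[of x] hc_J[OF m] J_uminus[OF x] by auto
      show ?thesis
      proof (cases "hc x \<in> H")
        case True
        then have "hc (p - x) = sg (hc x)" using pm by (simp add: sg_def)
        then show ?thesis using 3 m True odd[OF True] sg_H(1)[OF True] by (simp add: ext_def)
      next
        case False
        have "hc x \<noteq> 1" using 3 hc_cases[of x] by (metis JJX J_1)
        then have I: "hc x \<in> I" using False hc_H1[OF 3(1)] by (auto simp: H1_eq)
        then have "p - hc x = J (hc x)" by (simp add: I_def)
        then have "hc (p - x) = hc x" using pm hc_J[OF hc_X[OF 3(1)]] H1_hc[OF hc_H1[OF 3(1)]] by simp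
        then have "?f x + ?f (p - x) = 2 * e" using I False 3 m by (simp add: ext_def)
        then show ?thesis using e by simp
      qed
    qed (simp_all add: f1 fm1)
  qed
  have A: "m dvd (\<Sum>h | h \<in> H1 \<and> tau h = v. ?f h) - (if v = tau 1 then e * int (card I) else 0)" if v: "v \<in> V" for v
  proof -
    have h: "?f h = a h" if "h \<in> H" for h
    proof -
      have "h \<in> H1" using that by (simp add: H1_eq)
      then show ?thesis using that H1_hc H1_X by (simp add: ext_def)
    qed
    have i: "?f h = e" if "h \<in> I" for h
    proof -
      have "h \<in> H1" using that by (simp add: H1_eq)
      then show ?thesis using that H1_hc H1_X H_I(1) by (auto simp: ext_def)
    qed
    have "(\<Sum>h | h \<in> H1 \<and> tau h = v. ?f h) = (\<Sum>h | h \<in> H \<and> tau h = v. a h) + int (card {h. h \<in> I \<and> tau h = v}) * e"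
      by (simp add: H_sum h i f1)
    then show ?thesis using vert[OF v] by (auto simp: wt_def algebra_simps split: if_splits)
  qed
  have invM: "?f (J x) - ?f x \<in> ?M" if "x \<in> X" for x using inv[OF that] by simp
  show "T ?f x \<in> ?M" if x: "x \<in> X" for x
    using x
  proof (cases rule: vertex_cases)
    case generic
    have "(\<Sum>h | h \<in> H1 \<and> tau h = tau x. ?f h) \<in> ?M" using A[of "tau x"] generic x by (simp add: V_def)
    then show ?thesis using diff_closed_cong_iff[OF M fiber_sum_generic[where q = "ext a e", OF M invM x generic(1)]] by simp
  next
    case one
    have "m dvd (\<Sum>h | h \<in> H1 \<and> tau h = tau 1. ?f h) - e * int (card I)"
      using A[of "tau 1"] one_X by (simp add: V_def)
    moreover have "m dvd (\<Sum>h | h \<in> H1 \<and> tau h = tau 1. ?f h) - ?f (p - 2)"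
      using fiber_sum_one[where q = "ext a e", OF M invM] f1 by simp
    ultimately have "m dvd ((\<Sum>h | h \<in> H1 \<and> tau h = tau 1. ?f h) - e * int (card I)) - ((\<Sum>h | h \<in> H1 \<and> tau h = tau 1. ?f h) - ?f (p - 2))"
      by (rule dvd_diff)
    \<comment> \<open>The relation at 1 is twice the value at -2, and this value is
      \<open>e * int (card I)\<close> modulo \<open>m\<close>.\<close>
    then have "m dvd 2 * (?f (p - 2) - e * int (card I)) + 2 * e * int (card I)"
      by (intro dvd_add[OF dvd_mult dvd_mult2[OF e]]) simp
    then have "T ?f 1 \<in> ?M" using T_one[where q = "ext a e", OF M invM] f1 by (simp add: algebra_simps)
    moreover have "1 \<in> tau x" using one self_tau[of 1] by simp
    ultimately show ?thesis using T_tau[where q = "ext a e", OF M invM x] by blast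
  next
    case (fixed y)
    have "m dvd (\<Sum>h | h \<in> H1 \<and> tau h = tau y. ?f h)" using A[of "tau x"] fixed x by (simp add: V_def)
    then have "(\<Sum>h | h \<in> H1 \<and> tau h = tau y. ?f h) + (\<Sum>h | h \<in> H1 \<and> tau h = tau y. ?f h)
      + (\<Sum>h | h \<in> H1 \<and> tau h = tau y. ?f h) \<in> ?M" by simp
    then have "T ?f y \<in> ?M" using diff_closed_cong_iff[OF M fiber_sum_fixed[where q = "ext a e", OF M invM fixed(2,3)]] by simp
    moreover have "y \<in> tau x" using fixed self_tau[of y] by simp
    ultimately show ?thesis using T_tau[where q = "ext a e", OF M invM x] by blast
  qed
qed

section \<open>A basis of the slope relations\<close>


lemma frag_cmul_sum_left: "frag_cmul (sum a A) x = (\<Sum>i\<in>A. frag_cmul (a i) x)"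
  by (induction A rule: infinite_finite_induct) (simp_all add: frag_cmul_distrib)

text \<open>The functions \<open>f k\<close> are dual to the points \<open>r k\<close>. Those with
  \<open>k < g\<close> are integral cycles; if -1 has a square root, there is one further function,
  valid modulo 2 and equal to 1 at that root. \<open>v\<close> is the number of vertices, and the
  two equations are the Euler characteristic and the count of half-edges by vertices.\<close>

lemma slope_basis:
  obtains g v :: nat and m :: "nat \<Rightarrow> nat" and r :: "nat \<Rightarrow> int" and f :: "nat \<Rightarrow> int \<Rightarrow> int"
  where "p + 1 = 4 * int g + 4 * int v + 2 * int (card I)" "6 * int v = p + 1 + 4 * int (card Fx)"
    "\<And>k. m k = (if k < g then 0 else 2)"
    "\<And>k. k < g + card I \<Longrightarrow> slope_rel {z. int (m k) dvd z} (f k)"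
    "\<And>k. k < g + card I \<Longrightarrow> r k \<in> {1..<p}"
    "\<And>j k. j < g + card I \<Longrightarrow> k < g + card I \<Longrightarrow> f k (r j) = (if j = k then 1 else 0)"
    "\<And>M (q :: int \<Rightarrow> 'b \<Rightarrow>\<^sub>0 int) k. diff_closed M \<Longrightarrow> slope_rel M q \<Longrightarrow> k < g + card I
       \<Longrightarrow> frag_cmul (int (m k)) (q (r k)) \<in> M"
    "\<And>M (q :: int \<Rightarrow> 'b \<Rightarrow>\<^sub>0 int) x. diff_closed M \<Longrightarrow> slope_rel M q \<Longrightarrow> x \<in> {1..<p}
       \<Longrightarrow> q x - (\<Sum>k<g + card I. frag_cmul (f k x) (q (r k))) \<in> M"
proof -
  have V0: "V \<noteq> {}" using one_X by (auto simp: V_def)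
  have sgH: "\<forall>h\<in>H. sg h \<in> H \<and> sg (sg h) = h \<and> sg h \<noteq> h" using sg_H by blast
  have tauH: "tau ` H \<subseteq> V" by (auto simp: V_def H_def H1_X)
  have conn: "\<forall>W. W \<subseteq> V \<and> W \<noteq> {} \<and> (\<forall>h\<in>H. tau h \<in> W \<longrightarrow> tau (sg h) \<in> W) \<longrightarrow> W = V"
    using H_connected by blast
  from half_edge_basis[of V H sg tau, where 'b = 'b, OF finite_V V0 finite_HI(1) sgH tauH conn]
  obtain N and c :: "int \<Rightarrow> int \<Rightarrow> int" where NH: "N \<subseteq> H"
    and cN: "card H + 2 = 2 * (card N + card V)"
    and c1: "\<forall>k\<in>N. \<forall>h\<in>H. c (sg h) k = - c h k"
    and c2: "\<forall>k\<in>N. \<forall>v\<in>V. (\<Sum>h | h \<in> H \<and> tau h = v. c h k) = 0"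
    and c3: "\<forall>j\<in>N. \<forall>k\<in>N. c j k = (if j = k then 1 else 0)"
    and c4: "\<forall>M (q :: int \<Rightarrow> 'b \<Rightarrow>\<^sub>0 int). diff_closed M \<longrightarrow> (\<forall>h\<in>H. q h + q (sg h) \<in> M)
         \<longrightarrow> (\<forall>v\<in>V. (\<Sum>h | h \<in> H \<and> tau h = v. q h) \<in> M)
         \<longrightarrow> (\<forall>h\<in>H. q h - (\<Sum>k\<in>N. frag_cmul (c h k) (q k)) \<in> M)"
    by (elim exE conjE)
  obtain l where l1: "\<And>h. h \<in> H \<Longrightarrow> l (sg h) = - l h"
    and l2: "\<And>v. v \<in> V \<Longrightarrow> (\<Sum>h | h \<in> H \<and> tau h = v. l h) = wt v" by (rule wt_flow) blast
  have finN: "finite N" using NH finite_HI finite_subset by blast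
  define g where "g = card N"
  obtain b where b: "bij_betw b {..<g} N"
    using ex_bij_betw_nat_finite[OF finN] by (auto simp: g_def atLeast0LessThan)
  have bN: "b k \<in> N" if "k < g" for k using b that by (auto simp: bij_betw_def)
  \<comment> \<open>Subtracting cycles makes the flow vanish on \<open>N\<close> and leaves its
    vertex sums unchanged. Without this the last function would not be dual to the first
    \<open>g\<close> points.\<close>
  define l' where "l' = (\<lambda>h. l h - (\<Sum>k\<in>N. c h k * l k))"
  define r where "r = (\<lambda>k. if k < g then b k else the_elem I)"
  define m :: "nat \<Rightarrow> nat" where "m = (\<lambda>k. if k < g then 0 else 2)"
  define f where "f = (\<lambda>k. if k < g then ext (\<lambda>h. c h (b k)) 0 else ext l' 1)"
  have hcH: "h \<in> X \<and> hc h = h" if "h \<in> H \<union> I" for h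
    using that H1_hc H1_X by (auto simp: H1_eq)
  have ext_H: "ext a e h = a h" if "h \<in> H" for a e h
    using hcH[of h] that by (simp add: ext_def)
  have ext_I: "ext a e h = e" if "h \<in> I" for a e h
    using hcH[of h] H_I that by (auto simp: ext_def)
  have rI: "r k \<in> I \<and> I = {r k} \<and> k = g" if "\<not> k < g" "k < g + card I" for k
    using that by (cases rule: I_cases) (auto simp: r_def)
  have rH: "r k \<in> N" if "k < g" for k using that bN by (simp add: r_def)
  have rX: "r k \<in> X" if "k < g + card I" for k
    using rI[OF _ that] rH[of k] NH hcH by (cases "k < g") auto
  have l'1: "l' (sg h) = - l' h" if "h \<in> H" for h
    using that c1 l1 by (simp add: l'_def sum_negf)
  have l'2: "(\<Sum>h | h \<in> H \<and> tau h = v. l' h) = wt v" if "v \<in> V" for v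
  proof -
    have "(\<Sum>h | h \<in> H \<and> tau h = v. \<Sum>k\<in>N. c h k * l k) = (\<Sum>k\<in>N. \<Sum>h | h \<in> H \<and> tau h = v. c h k * l k)"
      by (rule sum.swap)
    also have "\<dots> = (\<Sum>k\<in>N. (\<Sum>h | h \<in> H \<and> tau h = v. c h k) * l k)" by (simp add: sum_distrib_right)
    also have "\<dots> = 0" using c2 that by simp
    finally show ?thesis using l2[OF that] by (simp add: l'_def sum_subtractf)
  qed
  have l'N: "l' j = 0" if "j \<in> N" for j
  proof -
    have "(\<Sum>k\<in>N. c j k * l k) = (\<Sum>k\<in>N. if j = k then l k else 0)"
      using c3 that by (intro sum.cong) auto
    then show ?thesis using that finN by (simp add: l'_def)
  qed
  have count: "p + 1 = 4 * int g + 4 * int (card V) + 2 * int (card I)" "6 * int (card V) = p + 1 + 4 * int (card Fx)"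
    using cN card_H card_H1 card_V by (auto simp: g_def)
  have slope: "slope_rel {z. int (m k) dvd z} (f k)" for k
  proof (cases "k < g")
    case True
    show ?thesis unfolding f_def m_def if_P[OF True]
      by (rule slope_rel_ext) (use c1 c2 bN[OF True] in auto)
  next
    case False
    show ?thesis unfolding f_def m_def if_not_P[OF False]
      by (rule slope_rel_ext) (use l'1 l'2 in auto)
  qed
  have dual: "f k (r j) = (if j = k then 1 else 0)" if j: "j < g + card I" and k: "k < g + card I" for j k
  proof (cases "j < g")
    case True
    then have "r j \<in> N" "r j \<in> H" using rH NH by auto
    show ?thesis
    proof (cases "k < g")
      case k: True
      have "b j = b k \<longleftrightarrow> j = k" using b True k by (auto simp: bij_betw_def inj_on_def)
      then show ?thesis using True k bN c3 ext_H[OF \<open>r j \<in> H\<close>] by (simp add: f_def r_def)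
    next
      case False
      then show ?thesis using True ext_H[OF \<open>r j \<in> H\<close>] l'N[OF \<open>r j \<in> N\<close>] by (simp add: f_def)
    qed
  next
    case False
    have "r j \<in> I" "j = g" using rI[OF False j] by blast+
    moreover have "k \<le> g" using rI[OF _ k] by force
    ultimately show ?thesis by (auto simp: f_def ext_I)
  qed
  have tors: "frag_cmul (int (m k)) (q (r k)) \<in> M"
    if M: "diff_closed M" and q: "slope_rel M q" and k: "k < g + card I" for M and q :: "int \<Rightarrow> 'b \<Rightarrow>\<^sub>0 int" and k
  proof (cases "k < g")
    case False
    then have "I = {r k}" using rI k by blast
    then have "q (r k) + q (r k) \<in> M" using vertex_sums(1)[OF M q] by simp
    moreover have "frag_cmul 2 x = x + x" for x :: "'b \<Rightarrow>\<^sub>0 int"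
      using frag_cmul_distrib[of 1 1 x] by simp
    ultimately show ?thesis using False by (simp add: m_def)
  qed (simp add: m_def diff_closed_zero[OF M])
  have gen: "q x - (\<Sum>k<g + card I. frag_cmul (f k x) (q (r k))) \<in> M"
    if M: "diff_closed M" and q: "slope_rel M q" and x: "x \<in> {1..<p}" for M and q :: "int \<Rightarrow> 'b \<Rightarrow>\<^sub>0 int" and x
  proof -
    define s where "s = sum q I"
    have inv: "q (J x) - q x \<in> M" if "x \<in> X" for x
      using q XR[OF that] unfolding slope_rel_def by blast
    have hcq: "q (hc y) - q y \<in> M" if "y \<in> X" for y
      using hc_cong[where q = q, OF M inv that] .
    \<comment> \<open>The vertex sums of \<open>q\<close> over \<open>H\<close> are
      \<open>wt v\<close> times \<open>s\<close>. Removing the flow times \<open>s\<close> makes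
      them vanish modulo \<open>M\<close>, so that \<open>half_edge_basis\<close> applies.\<close>
    define q' where "q' = (\<lambda>h. q h - frag_cmul (l h) s)"
    have 1: "\<forall>h\<in>H. q' h + q' (sg h) \<in> M"
    proof
      fix h assume h: "h \<in> H"
      then have hX: "h \<in> X" "h \<noteq> 1" by (auto simp: H_def H1_X)
      have "(q h + q (p - h)) + (q (hc (p - h)) - q (p - h)) \<in> M"
        by (intro diff_closed_add[OF M] slope_rel_odd[OF M q] XR hX hcq minus_X)
      then show "q' h + q' (sg h) \<in> M" using l1[OF h]
        by (simp add: q'_def sg_def minus_frag_cmul[symmetric] del: minus_frag_cmul)
    qed
    have 2: "\<forall>v\<in>V. (\<Sum>h | h \<in> H \<and> tau h = v. q' h) \<in> M"
    proof
      fix v assume v: "v \<in> V"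
      have "(\<Sum>h | h \<in> H \<and> tau h = v. q' h) = (\<Sum>h | h \<in> H \<and> tau h = v. q h) - frag_cmul (wt v) s"
        by (simp add: q'_def sum_subtractf frag_cmul_sum_left[symmetric] l2[OF v])
      then show "(\<Sum>h | h \<in> H \<and> tau h = v. q' h) \<in> M"
        using vertex_sums_H[OF M q v] by (simp add: s_def)
    qed
    let ?R = "\<lambda>h. q h - (\<Sum>k\<in>N. frag_cmul (ext (\<lambda>h. c h k) 0 h) (q k)) - frag_cmul (ext l' 1 h) s"
    have RH: "?R h \<in> M" if h: "h \<in> H" for h
    proof -
      have "(\<Sum>k\<in>N. frag_cmul (c h k) (q' k))
          = (\<Sum>k\<in>N. frag_cmul (c h k) (q k) - frag_cmul (c h k * l k) s)"
        by (intro sum.cong refl) (simp add: q'_def frag_cmul_distrib2 diff_conv_add_uminus del: add_uminus_conv_diff)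
      also have "\<dots> = (\<Sum>k\<in>N. frag_cmul (c h k) (q k)) - frag_cmul (\<Sum>k\<in>N. c h k * l k) s"
        by (simp add: sum_subtractf frag_cmul_sum_left)
      \<comment> \<open>Back in terms of \<open>q\<close>, the multiples of \<open>s\<close> collect
        to the coefficient \<open>l' h\<close>.\<close>
      finally have "q' h - (\<Sum>k\<in>N. frag_cmul (c h k) (q' k)) = ?R h"
        using h by (simp add: q'_def l'_def ext_H frag_cmul_diff_distrib algebra_simps)
      then show ?thesis using c4[rule_format, OF M _ _ h, of q'] 1 2 by auto
    qed
    have RI: "?R h \<in> M" if h: "h \<in> I" for h
    proof -
      have "I = {h}" using h I_unique by blast
      then show ?thesis using h by (simp add: ext_I s_def diff_closed_zero[OF M])
    qed
    have Rx: "?R x \<in> M"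
    proof (cases "x \<in> X")
      case True
      have e: "ext a e (hc x) = ext a e x" for a e
        using True H1_hc[OF hc_H1[OF True]] by (simp add: ext_def hc_X)
      consider "hc x = 1" | "hc x \<in> H" | "hc x \<in> I" using hc_H1[OF True] by (auto simp: H1_eq)
      then have hcM: "?R (hc x) \<in> M"
      proof cases
        case 1
        have "ext a e 1 = 0" for a e using H_I one_I by (simp add: ext_def hc_def[of 1])
        then show ?thesis using 1 slope_rel_1[OF M q] by simp
      qed (simp_all add: RH RI)
      have R: "?R x = ?R (hc x) - (q (hc x) - q x)" unfolding e by (simp add: algebra_simps)
      show ?thesis unfolding R by (rule diff_closed_diff[OF M hcM hcq[OF True]])
    next
      case False
      then have "x = p - 1" using x by (auto simp: X_def)
      then show ?thesis using False q by (simp add: ext_def slope_rel_def)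
    qed
    have "(\<Sum>k<g. frag_cmul (f k x) (q (r k))) = (\<Sum>k<g. frag_cmul (ext (\<lambda>h. c h (b k)) 0 x) (q (b k)))"
      by (intro sum.cong) (auto simp: f_def r_def)
    also have "\<dots> = (\<Sum>k\<in>N. frag_cmul (ext (\<lambda>h. c h k) 0 x) (q k))"
      by (rule sum.reindex_bij_betw[OF b])
    finally have "(\<Sum>k<g. frag_cmul (f k x) (q (r k))) = (\<Sum>k\<in>N. frag_cmul (ext (\<lambda>h. c h k) 0 x) (q k))" .
    moreover have "(\<Sum>k<g + card I. frag_cmul (f k x) (q (r k)))
      = (\<Sum>k<g. frag_cmul (f k x) (q (r k))) + frag_cmul (ext l' 1 x) s"
      by (cases rule: I_cases) (simp_all add: s_def f_def r_def)
    ultimately show ?thesis using Rx by (simp add: algebra_simps)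
  qed
  have m: "\<And>k. m k = (if k < g then 0 else 2)" by (simp add: m_def)
  have rR: "r k \<in> {1..<p}" if "k < g + card I" for k by (rule XR[OF rX[OF that]])
  show ?thesis
    by (rule that[of g "card V" m f r]) (fact count m | erule (2) tors gen | erule (1) dual | erule rR | rule slope)+
qed

end

section \<open>The slope of a pair\<close>

text \<open>The lattice of relations between the images of \<open>a\<close> and \<open>b\<close> in
  A/pA, which makes sense for every abelian group. In a \<open>p\<close>-torsion group it is the
  lattice of relations between \<open>a\<close> and \<open>b\<close> themselves.\<close>

definition rel_mod :: "int \<Rightarrow> 'a monoid \<Rightarrow> 'a \<Rightarrow> 'a \<Rightarrow> int \<Rightarrow> int \<Rightarrow> bool" where
  "rel_mod p A a b u v \<longleftrightarrow> (\<exists>y\<in>carrier A. a [^]\<^bsub>A\<^esub> u \<otimes>\<^bsub>A\<^esub> b [^]\<^bsub>A\<^esub> v = y [^]\<^bsub>A\<^esub> p)"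

definition has_slope :: "int \<Rightarrow> 'a marked \<Rightarrow> int \<Rightarrow> bool" where
  "has_slope p P x \<longleftrightarrow> (\<exists>A a b. P = (A, [a, b]) \<and> (\<forall>u v. rel_mod p A a b u v \<longleftrightarrow> p dvd u + x * v))"

text \<open>The default 0 covers all lattices that are products, slope 0 included, so that split
  pairs get the value 0 whatever \<open>f\<close> is. For prime \<open>p\<close> the choice of the
  slope is unambiguous by \<open>has_slope_unique\<close>.\<close>

definition slope_val :: "int \<Rightarrow> (int \<Rightarrow> 'b::zero) \<Rightarrow> 'a marked \<Rightarrow> 'b" where
  "slope_val p f P = (if \<exists>x\<in>{1..<p}. has_slope p P x
     then f (SOME x. x \<in> {1..<p} \<and> has_slope p P x) else 0)"

lemma marked_iso_trans:
  assumes "marked_iso P Q" "marked_iso Q R"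
  shows "marked_iso P R"
proof -
  obtain A S B U C W where PQ: "P = (A, S)" "Q = (B, U)" "R = (C, W)" by (cases P, cases Q, cases R)
  obtain h k where h: "h \<in> iso A B" "map h S = U" "k \<in> iso B C" "map k U = W"
    using assms by (auto simp: PQ marked_iso_def)
  then have "k \<circ> h \<in> iso A C" "map (k \<circ> h) S = W" by (auto intro: iso_set_trans)
  then show ?thesis unfolding PQ marked_iso_def by blast
qed

lemma rel_mod_iso:
  assumes A: "group A" and B: "group B" and h: "h \<in> iso A B" and a: "a \<in> carrier A" "b \<in> carrier A"
  shows "rel_mod p B (h a) (h b) u v \<longleftrightarrow> rel_mod p A a b u v"
proof -
  interpret h: group_hom A B h
    using A B h by (simp add: group_hom_def group_hom_axioms_def iso_def)
  have inj: "inj_on h (carrier A)" and img: "carrier B = h ` carrier A"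
    using h by (auto simp: iso_def bij_betw_def)
  have eq: "h a [^]\<^bsub>B\<^esub> u \<otimes>\<^bsub>B\<^esub> h b [^]\<^bsub>B\<^esub> v = h (a [^]\<^bsub>A\<^esub> u \<otimes>\<^bsub>A\<^esub> b [^]\<^bsub>A\<^esub> v)"
    using a by (simp add: h.hom_int_pow)
  have "h (a [^]\<^bsub>A\<^esub> u \<otimes>\<^bsub>A\<^esub> b [^]\<^bsub>A\<^esub> v) = h y [^]\<^bsub>B\<^esub> p \<longleftrightarrow> a [^]\<^bsub>A\<^esub> u \<otimes>\<^bsub>A\<^esub> b [^]\<^bsub>A\<^esub> v = y [^]\<^bsub>A\<^esub> p"
    if "y \<in> carrier A" for y
    using that a inj_on_eq_iff[OF inj] by (simp add: h.hom_int_pow[symmetric] del: h.hom_mult)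
  then show ?thesis by (simp add: rel_mod_def eq img)
qed

lemma has_slope_iso:
  assumes P: "marked_group P" and Q: "marked_group Q" and "marked_iso P Q"
  shows "has_slope p P x \<longleftrightarrow> has_slope p Q x"
proof -
  obtain A S B U where PQ: "P = (A, S)" "Q = (B, U)" by (cases P, cases Q)
  obtain h where h: "h \<in> iso A B" "map h S = U" using assms by (auto simp: PQ marked_iso_def)
  have A: "group A" "set S \<subseteq> carrier A" and B: "group B"
    using P Q by (auto simp: PQ marked_group_def comm_group_def)
  have "(\<exists>a b. S = [a, b] \<and> (\<forall>u v. rel_mod p A a b u v \<longleftrightarrow> p dvd u + x * v))
    \<longleftrightarrow> (\<exists>a b. U = [a, b] \<and> (\<forall>u v. rel_mod p B a b u v \<longleftrightarrow> p dvd u + x * v))"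
  proof (cases "\<exists>a b. S = [a, b]")
    case True
    then obtain a b where S: "S = [a, b]" by blast
    then have U: "U = [h a, h b]" using h(2) by simp
    show ?thesis using rel_mod_iso[OF A(1) B h(1), of a b p] A(2) by (simp add: S U)
  next
    case False
    then have "\<not> (\<exists>a b. U = [a, b])" using h(2) by (auto simp: map_eq_Cons_conv)
    then show ?thesis using False by blast
  qed
  then show ?thesis by (simp add: has_slope_def PQ)
qed

lemma slope_val_iso:
  assumes "marked_group P" "marked_group Q" "marked_iso P Q"
  shows "slope_val p f P = slope_val p f Q"
  using has_slope_iso[OF assms] by (simp add: slope_val_def)

lemma slope_val_length: "length (snd P) \<noteq> 2 \<Longrightarrow> slope_val p f P = 0"
  by (auto simp: slope_val_def has_slope_def)

lemma rel_mod_swap: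
  assumes "comm_group A" "a \<in> carrier A" "b \<in> carrier A"
  shows "rel_mod p A b a u v \<longleftrightarrow> rel_mod p A a b v u"
proof -
  interpret comm_group A by fact
  show ?thesis using assms(2,3) by (simp add: rel_mod_def m_comm)
qed

lemma rel_mod_shear:
  assumes "comm_group A" "a \<in> carrier A" "b \<in> carrier A"
  shows "rel_mod p A a (b \<otimes>\<^bsub>A\<^esub> inv\<^bsub>A\<^esub> a) u v \<longleftrightarrow> rel_mod p A a b (u - v) v"
proof -
  interpret comm_group A by fact
  have "a [^]\<^bsub>A\<^esub> u \<otimes>\<^bsub>A\<^esub> (b \<otimes>\<^bsub>A\<^esub> inv\<^bsub>A\<^esub> a) [^]\<^bsub>A\<^esub> v
      = a [^]\<^bsub>A\<^esub> u \<otimes>\<^bsub>A\<^esub> (b [^]\<^bsub>A\<^esub> v \<otimes>\<^bsub>A\<^esub> inv\<^bsub>A\<^esub> (a [^]\<^bsub>A\<^esub> v))"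
    using assms(2,3) by (simp add: int_pow_distrib int_pow_inv)
  also have "\<dots> = (a [^]\<^bsub>A\<^esub> u \<otimes>\<^bsub>A\<^esub> inv\<^bsub>A\<^esub> (a [^]\<^bsub>A\<^esub> v)) \<otimes>\<^bsub>A\<^esub> b [^]\<^bsub>A\<^esub> v"
    using assms(2,3) by (simp add: m_ac)
  also have "\<dots> = a [^]\<^bsub>A\<^esub> (u - v) \<otimes>\<^bsub>A\<^esub> b [^]\<^bsub>A\<^esub> v"
    using assms(2,3) by (simp add: int_pow_diff)
  finally show ?thesis by (simp add: rel_mod_def)
qed

lemma has_slope_pair: "has_slope p (A, [a, b]) x \<longleftrightarrow> (\<forall>u v. rel_mod p A a b u v \<longleftrightarrow> p dvd u + x * v)"
  by (simp add: has_slope_def)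

lemma has_slope_shear:
  assumes "comm_group A" "a \<in> carrier A" "b \<in> carrier A"
  shows "has_slope p (A, [a, b \<otimes>\<^bsub>A\<^esub> inv\<^bsub>A\<^esub> a]) (x - 1) \<longleftrightarrow> has_slope p (A, [a, b]) x"
proof -
  have e: "(u - v) + x * v = u + (x - 1) * v" for u v by (simp add: algebra_simps)
  have "(\<forall>u v. rel_mod p A a b u v \<longleftrightarrow> p dvd u + x * v)
     \<longleftrightarrow> (\<forall>u v. rel_mod p A a b (u - v) v \<longleftrightarrow> p dvd (u - v) + x * v)"
    by (metis diff_add_cancel add_diff_cancel_right')
  then show ?thesis by (simp add: has_slope_pair rel_mod_shear[OF assms] e)
qed

context prime_residues begin

lemma has_slope_cong: "p dvd x - y \<Longrightarrow> has_slope p P x \<Longrightarrow> has_slope p P y"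
proof -
  assume "p dvd x - y"
  then have "p dvd u + x * v \<longleftrightarrow> p dvd u + y * v" for u v
  proof -
    have "(u + x * v) - (u + y * v) = (x - y) * v" by (simp add: algebra_simps)
    then have "p dvd (u + x * v) - (u + y * v)" using \<open>p dvd x - y\<close> by simp
    then show ?thesis using dvd_diff_right_iff dvd_diff_left_iff by (metis diff_eq_eq dvd_add_right_iff)
  qed
  then show "has_slope p P x \<Longrightarrow> has_slope p P y" by (simp add: has_slope_def)
qed

lemma has_slope_unique:
  assumes "has_slope p P x" "has_slope p P y" "x \<in> {0..<p}" "y \<in> {0..<p}"
  shows "x = y"
proof -
  obtain A a b where P: "P = (A, [a, b])" using assms(1) by (auto simp: has_slope_def)
  have "rel_mod p A a b (- x) 1" using assms(1) by (simp add: P has_slope_pair)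
  then have "p dvd y - x" using assms(2) by (simp add: P has_slope_pair)
  then show ?thesis using dvd_diff_eq[of y x] assms by auto
qed

lemma slope_val_eq:
  assumes "has_slope p P x" "x \<in> {1..<p}"
  shows "slope_val p f P = f x"
proof -
  have "(SOME x. x \<in> {1..<p} \<and> has_slope p P x) = x"
  proof (rule some_equality)
    fix y assume "y \<in> {1..<p} \<and> has_slope p P y"
    then show "y = x" using has_slope_unique[OF _ assms(1), of y] assms(2) by simp
  qed (use assms in simp)
  then show ?thesis using assms by (auto simp: slope_val_def)
qed

lemma slope_val_zero: assumes "has_slope p P 0" shows "slope_val p f P = 0"
proof -
  have "\<not> has_slope p P x" if "x \<in> {1..<p}" for x
    using has_slope_unique[OF assms, of x] that by auto
  then show ?thesis by (auto simp: slope_val_def)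
qed

lemma has_slope_swap:
  assumes A: "comm_group A" "a \<in> carrier A" "b \<in> carrier A" and x: "x \<in> {1..<p}" and s: "has_slope p (A, [a, b]) x"
  shows "has_slope p (A, [b, a]) (J x)"
proof -
  have "p dvd v + x * u \<longleftrightarrow> p dvd u + J x * v" for u v
  proof -
    have Jx: "p dvd x * J x - 1" "J x \<in> {1..<p}" using J_ex[OF x] by auto
    have "p dvd v + x * u \<longleftrightarrow> p dvd J x * (v + x * u)"
      using not_dvd[OF Jx(2)] by (simp add: dvd_mult_iff)
    also have "J x * (v + x * u) = (u + J x * v) + (x * J x - 1) * u" by (simp add: algebra_simps)
    also have "p dvd (u + J x * v) + (x * J x - 1) * u \<longleftrightarrow> p dvd u + J x * v"
      using Jx(1) by (simp add: dvd_add_left_iff)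
    finally show ?thesis .
  qed
  then show ?thesis using s by (simp add: has_slope_pair rel_mod_swap[OF A])
qed

lemma slope_val_rel:
  fixes f :: "int \<Rightarrow> 'b::ab_group_add"
  assumes M: "diff_closed M" and f: "slope_rel M f"
    and A: "comm_group A" and a: "a \<in> carrier A" and b: "b \<in> carrier A"
  shows "slope_val p f (A, [a, b]) - slope_val p f (A, [a, b \<otimes>\<^bsub>A\<^esub> inv\<^bsub>A\<^esub> a])
    - slope_val p f (A, [b, a \<otimes>\<^bsub>A\<^esub> inv\<^bsub>A\<^esub> b]) \<in> M"
proof -
  have f0: "f 0 \<in> M" and fm: "f (p - 1) \<in> M" using f by (auto simp: slope_rel_def)
  \<comment> \<open>Slope 0 is included because x - 1 or 1/x - 1 may be 0. There the default value 0
    and \<open>f 0\<close> differ by an element of \<open>M\<close>.\<close>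
  have val: "slope_val p f P - f x \<in> M" if "has_slope p P x" "x \<in> {0..<p}" for P :: "'a marked" and x
  proof (cases "x = 0")
    case True
    then show ?thesis using slope_val_zero[of P f] that f0 diff_closed_uminus[OF M] by simp
  next
    case False
    then show ?thesis using slope_val_eq[OF that(1), of f] that diff_closed_zero[OF M] by simp
  qed
  show ?thesis
  proof (cases "\<exists>x\<in>{1..<p}. has_slope p (A, [a, b]) x")
    case True
    then obtain x where x: "x \<in> {1..<p}" "has_slope p (A, [a, b]) x" by blast
    have 1: "slope_val p f (A, [a, b]) - f x \<in> M" using x by (intro val) auto
    have 2: "slope_val p f (A, [a, b \<otimes>\<^bsub>A\<^esub> inv\<^bsub>A\<^esub> a]) - f (x - 1) \<in> M"
      using x has_slope_shear[OF A a b, of p x] by (intro val) auto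
    have 3: "slope_val p f (A, [b, a \<otimes>\<^bsub>A\<^esub> inv\<^bsub>A\<^esub> b]) - f (J x - 1) \<in> M"
      using J_ex(1)[OF x(1)] has_slope_shear[OF A b a, of p "J x"] has_slope_swap[OF A a b x] by (intro val) auto
    have 4: "f x - f (x - 1) - f (J x - 1) \<in> M" using f x(1) unfolding slope_rel_def by blast
    from diff_closed_diff[OF M diff_closed_diff[OF M diff_closed_add[OF M 1 4] 2] 3]
    show ?thesis by (simp add: algebra_simps)
  next
    case False
    have no: "\<not> has_slope p (A, [b, a]) x" if "x \<in> {1..<p}" for x
      using has_slope_swap[OF A b a that] J_ex(1)[OF that] False by blast
    have sh: "slope_val p f (A, [c, d \<otimes>\<^bsub>A\<^esub> inv\<^bsub>A\<^esub> c]) \<in> M"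
      if c: "c \<in> carrier A" "d \<in> carrier A" and n: "\<And>x. x \<in> {1..<p} \<Longrightarrow> \<not> has_slope p (A, [c, d]) x" for c d
    proof (cases "\<exists>y\<in>{1..<p}. has_slope p (A, [c, d \<otimes>\<^bsub>A\<^esub> inv\<^bsub>A\<^esub> c]) y")
      case True
      then obtain y where y: "y \<in> {1..<p}" "has_slope p (A, [c, d \<otimes>\<^bsub>A\<^esub> inv\<^bsub>A\<^esub> c]) y" by blast
      then have "has_slope p (A, [c, d]) (y + 1)" using has_slope_shear[OF A c, of p "y + 1"] by simp
      \<comment> \<open>A pair without unit slope acquires one by this subtraction only if its slope
        was 0. The new slope is then -1, and \<open>f\<close> takes a value in \<open>M\<close>
        there.\<close>
      then have "y = p - 1" using n[of "y + 1"] y(1) by force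
      then show ?thesis using slope_val_eq[OF y(2,1), of f] fm by simp
    next
      case False
      then have "slope_val p f (A, [c, d \<otimes>\<^bsub>A\<^esub> inv\<^bsub>A\<^esub> c]) = 0" unfolding slope_val_def by (rule if_not_P)
      then show ?thesis by (simp add: diff_closed_zero[OF M])
    qed
    have z: "slope_val p f (A, [a, b]) = 0" unfolding slope_val_def by (rule if_not_P[OF False])
    have "slope_val p f (A, [a, b \<otimes>\<^bsub>A\<^esub> inv\<^bsub>A\<^esub> a]) \<in> M" by (rule sh[OF a b]) (use False in blast)
    moreover have "slope_val p f (A, [b, a \<otimes>\<^bsub>A\<^esub> inv\<^bsub>A\<^esub> b]) \<in> M" by (rule sh[OF b a no])
    ultimately show ?thesis unfolding z by (intro diff_closed_diff[OF M] diff_closed_zero[OF M])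
  qed
qed

lemma slope_val_split:
  assumes split: "\<And>u v. rel_mod p A a b u v \<Longrightarrow> rel_mod p A a b u 0"
  shows "slope_val p f (A, [a, b]) = 0"
proof -
  have "\<not> has_slope p (A, [a, b]) x" if "x \<in> {1..<p}" for x
  proof
    assume s: "has_slope p (A, [a, b]) x"
    \<comment> \<open>The vector (-x, 1) lies in the lattice of slope x, whereas (-x, 0) does
      not.\<close>
    then have "rel_mod p A a b (- x) 1" by (simp add: has_slope_pair)
    then have "p dvd - x" using split[of "- x" 1] s by (simp add: has_slope_pair)
    then show False using not_dvd[OF that] by simp
  qed
  then show ?thesis by (auto simp: slope_val_def)
qed

text \<open>When the second entry is 0 its coefficient is free, so the lattice is a product. This
  makes every multiple of t invisible to the functionals.\<close>

lemma slope_val_append_zero: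
  assumes "marked_group P"
  shows "slope_val p f (append_zero P) = 0"
proof -
  obtain A S where P: "P = (A, S)" by (cases P)
  show ?thesis
  proof (cases "length S = 1")
    case True
    then obtain a where S: "S = [a]" by (auto simp: length_Suc_conv)
    interpret group A using assms by (simp add: P marked_group_def comm_group_def)
    have "a \<in> carrier A" using assms by (auto simp: P S marked_group_def)
    then have "slope_val p f (A, [a, \<one>\<^bsub>A\<^esub>]) = 0" by (intro slope_val_split) (simp add: rel_mod_def)
    then show ?thesis by (simp add: P S append_zero_def)
  next
    case False
    then show ?thesis by (intro slope_val_length) (simp add: P append_zero_def)
  qed
qed

end

section \<open>Pairs in products of cyclic groups\<close>

context comm_group begin

lemma int_pow_pair_add:
  fixes u u' v v' :: int
  assumes "a \<in> carrier G" "b \<in> carrier G"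
  shows "a [^] (u + u') \<otimes> b [^] (v + v') = (a [^] u \<otimes> b [^] v) \<otimes> (a [^] u' \<otimes> b [^] v')"
  using assms by (simp add: int_pow_mult m_ac)

lemma int_pow_pair_eq_iff:
  fixes u u' v v' :: int
  assumes "a \<in> carrier G" "b \<in> carrier G"
  shows "a [^] u \<otimes> b [^] v = a [^] u' \<otimes> b [^] v' \<longleftrightarrow> a [^] (u - u') \<otimes> b [^] (v - v') = \<one>"
proof -
  have eq: "a [^] u \<otimes> b [^] v = (a [^] (u - u') \<otimes> b [^] (v - v')) \<otimes> (a [^] u' \<otimes> b [^] v')"
    using int_pow_pair_add[OF assms, of "u - u'" u' "v - v'" v'] by simp
  show ?thesis unfolding eq using assms by (intro r_cancel_one) auto
qed

lemma generate_pair: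
  assumes a: "a \<in> carrier G" and b: "b \<in> carrier G" and x: "x \<in> generate G {a, b}"
  obtains u v :: int where "x = a [^] u \<otimes> b [^] v"
proof -
  let ?K = "{a [^] u \<otimes> b [^] v | (u :: int) (v :: int). True}"
  have "subgroup ?K G"
  proof (rule subgroupI)
    show "?K \<subseteq> carrier G" "?K \<noteq> {}" using a b by auto
    fix x y assume "x \<in> ?K" "y \<in> ?K"
    then obtain u v u' v' :: int where xy: "x = a [^] u \<otimes> b [^] v" "y = a [^] u' \<otimes> b [^] v'" by blast
    have "inv x = a [^] (- u) \<otimes> b [^] (- v)" using a b by (simp add: xy inv_mult int_pow_neg)
    then show "inv x \<in> ?K" by blast
    have "x \<otimes> y = a [^] (u + u') \<otimes> b [^] (v + v')" by (simp add: xy int_pow_pair_add[OF a b])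
    then show "x \<otimes> y \<in> ?K" by blast
  qed
  moreover have "a = a [^] (1::int) \<otimes> b [^] (0::int)" "b = a [^] (0::int) \<otimes> b [^] (1::int)" using a b by simp_all
  then have "{a, b} \<subseteq> ?K" by blast
  ultimately have "generate G {a, b} \<subseteq> ?K" by (intro generate_subgroup_incl)
  then show ?thesis using x that by blast
qed

end

text \<open>Both groups are the quotient of the free abelian group on two generators by the same
  lattice of relations.\<close>

lemma marked_iso_pairI:
  assumes P: "marked_group (A, [a, b])" and Q: "marked_group (B, [c, d])"
    and rel: "\<And>(u::int) (v::int). a [^]\<^bsub>A\<^esub> u \<otimes>\<^bsub>A\<^esub> b [^]\<^bsub>A\<^esub> v = \<one>\<^bsub>A\<^esub> \<longleftrightarrow> c [^]\<^bsub>B\<^esub> u \<otimes>\<^bsub>B\<^esub> d [^]\<^bsub>B\<^esub> v = \<one>\<^bsub>B\<^esub>"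
  shows "marked_iso (A, [a, b]) (B, [c, d])"
proof -
  have A: "comm_group A" and ab: "a \<in> carrier A" "b \<in> carrier A" and gA: "generate A {a, b} = carrier A"
    and B: "comm_group B" and cd: "c \<in> carrier B" "d \<in> carrier B" and gB: "generate B {c, d} = carrier B"
    using P Q by (auto simp: marked_group_def)
  interpret A: comm_group A by (rule A)
  interpret B: comm_group B by (rule B)
  define h where "h = (\<lambda>x. SOME y. \<exists>(u::int) (v::int). x = a [^]\<^bsub>A\<^esub> u \<otimes>\<^bsub>A\<^esub> b [^]\<^bsub>A\<^esub> v \<and> y = c [^]\<^bsub>B\<^esub> u \<otimes>\<^bsub>B\<^esub> d [^]\<^bsub>B\<^esub> v)"
  have eq: "a [^]\<^bsub>A\<^esub> u \<otimes>\<^bsub>A\<^esub> b [^]\<^bsub>A\<^esub> v = a [^]\<^bsub>A\<^esub> u' \<otimes>\<^bsub>A\<^esub> b [^]\<^bsub>A\<^esub> v'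
    \<longleftrightarrow> c [^]\<^bsub>B\<^esub> u \<otimes>\<^bsub>B\<^esub> d [^]\<^bsub>B\<^esub> v = c [^]\<^bsub>B\<^esub> u' \<otimes>\<^bsub>B\<^esub> d [^]\<^bsub>B\<^esub> v'" for u v u' v' :: int
    unfolding A.int_pow_pair_eq_iff[OF ab] B.int_pow_pair_eq_iff[OF cd] by (rule rel)
  have h: "h (a [^]\<^bsub>A\<^esub> u \<otimes>\<^bsub>A\<^esub> b [^]\<^bsub>A\<^esub> v) = c [^]\<^bsub>B\<^esub> u \<otimes>\<^bsub>B\<^esub> d [^]\<^bsub>B\<^esub> v" for u v :: int
    unfolding h_def
  proof (rule some_equality)
    fix y assume "\<exists>(u'::int) (v'::int). a [^]\<^bsub>A\<^esub> u \<otimes>\<^bsub>A\<^esub> b [^]\<^bsub>A\<^esub> v = a [^]\<^bsub>A\<^esub> u' \<otimes>\<^bsub>A\<^esub> b [^]\<^bsub>A\<^esub> v' \<and> y = c [^]\<^bsub>B\<^esub> u' \<otimes>\<^bsub>B\<^esub> d [^]\<^bsub>B\<^esub> v'"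
    then obtain u' v' :: int where "a [^]\<^bsub>A\<^esub> u \<otimes>\<^bsub>A\<^esub> b [^]\<^bsub>A\<^esub> v = a [^]\<^bsub>A\<^esub> u' \<otimes>\<^bsub>A\<^esub> b [^]\<^bsub>A\<^esub> v'" "y = c [^]\<^bsub>B\<^esub> u' \<otimes>\<^bsub>B\<^esub> d [^]\<^bsub>B\<^esub> v'" by blast
    then show "y = c [^]\<^bsub>B\<^esub> u \<otimes>\<^bsub>B\<^esub> d [^]\<^bsub>B\<^esub> v" using eq[of u v u' v'] by simp
  qed blast
  have A_ex: "\<exists>(u::int) (v::int). x = a [^]\<^bsub>A\<^esub> u \<otimes>\<^bsub>A\<^esub> b [^]\<^bsub>A\<^esub> v" if "x \<in> carrier A" for x
    using A.generate_pair[OF ab, of x] that gA by blast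
  have B_ex: "\<exists>(u::int) (v::int). x = c [^]\<^bsub>B\<^esub> u \<otimes>\<^bsub>B\<^esub> d [^]\<^bsub>B\<^esub> v" if "x \<in> carrier B" for x
    using B.generate_pair[OF cd, of x] that gB by blast
  have hom: "h \<in> hom A B"
  proof (rule homI)
    fix x y assume "x \<in> carrier A" "y \<in> carrier A"
    then obtain u v u' v' :: int where xy: "x = a [^]\<^bsub>A\<^esub> u \<otimes>\<^bsub>A\<^esub> b [^]\<^bsub>A\<^esub> v" "y = a [^]\<^bsub>A\<^esub> u' \<otimes>\<^bsub>A\<^esub> b [^]\<^bsub>A\<^esub> v'"
      using A_ex by meson
    show "h x \<in> carrier B" using cd by (simp add: xy h)
    show "h (x \<otimes>\<^bsub>A\<^esub> y) = h x \<otimes>\<^bsub>B\<^esub> h y"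
      unfolding xy A.int_pow_pair_add[OF ab, symmetric] h by (rule B.int_pow_pair_add[OF cd])
  qed
  have "inj_on h (carrier A)"
  proof (rule inj_onI)
    fix x y assume "x \<in> carrier A" "y \<in> carrier A" and e: "h x = h y"
    then obtain u v u' v' :: int where xy: "x = a [^]\<^bsub>A\<^esub> u \<otimes>\<^bsub>A\<^esub> b [^]\<^bsub>A\<^esub> v" "y = a [^]\<^bsub>A\<^esub> u' \<otimes>\<^bsub>A\<^esub> b [^]\<^bsub>A\<^esub> v'"
      using A_ex by meson
    show "x = y" using e unfolding xy h eq .
  qed
  moreover have "h ` carrier A = carrier B"
  proof (intro equalityI subsetI)
    fix y assume "y \<in> carrier B"
    then obtain u v :: int where "y = c [^]\<^bsub>B\<^esub> u \<otimes>\<^bsub>B\<^esub> d [^]\<^bsub>B\<^esub> v" using B_ex by meson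
    then have "y = h (a [^]\<^bsub>A\<^esub> u \<otimes>\<^bsub>A\<^esub> b [^]\<^bsub>A\<^esub> v)" by (simp add: h)
    then show "y \<in> h ` carrier A" using ab by blast
  qed (use hom_in_carrier[OF hom] in blast)
  ultimately have "h \<in> iso A B" using hom by (simp add: iso_def bij_betw_def)
  moreover have "h a = c" "h b = d" using h[of 1 0] h[of 0 1] ab cd by simp_all
  ultimately show ?thesis by (auto simp: marked_iso_def)
qed

lemma int_pow_product_group:
  assumes "\<And>i. i \<in> I \<Longrightarrow> group (G i)" "x \<in> carrier (product_group I G)"
  shows "x [^]\<^bsub>product_group I G\<^esub> (n :: int) = (\<lambda>i\<in>I. x i [^]\<^bsub>G i\<^esub> n)"
proof -
  have g: "group (product_group I G)" using assms(1) by simp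
  have "x [^]\<^bsub>product_group I G\<^esub> n \<in> carrier (product_group I G)"
    using group.int_pow_closed[OF g assms(2)] .
  moreover have "(x [^]\<^bsub>product_group I G\<^esub> n) i = x i [^]\<^bsub>G i\<^esub> n" if "i \<in> I" for i
  proof -
    have "(\<lambda>f. f i) \<in> hom (product_group I G) (G i)" using that by (auto simp: hom_def)
    from hom_int_pow[OF this assms(2) g assms(1)[OF that]] show ?thesis .
  qed
  ultimately show ?thesis by (intro ext) (auto simp: PiE_def extensional_def)
qed

lemma cyclic_sum_2:
  "cyclic_sum 2 a g = (product_group {..<2} (\<lambda>i. integer_mod_group (a i)),
     [\<lambda>k\<in>{..<2}. if k = 0 then g 0 else 0, \<lambda>k\<in>{..<2}. if k = 1 then g 1 else 0])"
proof -
  have "[0..<2] = [0, 1::nat]" by (simp add: upt_rec)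
  then show ?thesis by (auto simp: cyclic_sum_def restrict_def fun_eq_iff)
qed

lemma cyclic_sum_2_pow:
  fixes u v :: int and a :: "nat \<Rightarrow> nat" and g :: "nat \<Rightarrow> int"
  assumes "g 0 \<in> carrier (integer_mod_group (a 0))" "g 1 \<in> carrier (integer_mod_group (a 1))"
  defines "G \<equiv> product_group {..<2} (\<lambda>i. integer_mod_group (a i))"
  shows "(\<lambda>k\<in>{..<2}. if k = 0 then g 0 else 0) [^]\<^bsub>G\<^esub> u \<otimes>\<^bsub>G\<^esub> (\<lambda>k\<in>{..<2}. if k = 1 then g 1 else 0) [^]\<^bsub>G\<^esub> v
    = (\<lambda>k\<in>{..<2}. (if k = 0 then u * g 0 else v * g 1) mod int (a k))"
proof -
  have lt2: "k = 1" if "k < 2" "k \<noteq> 0" for k :: nat using that by simp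
  have 0: "(\<lambda>k\<in>{..<2}. if k = 0 then g 0 else 0) \<in> carrier G" using assms(1) by (simp add: G_def)
  have 1: "(\<lambda>k\<in>{..<2}. if k = 1 then g 1 else 0) \<in> carrier G" using assms(2) by (simp add: G_def)
  show ?thesis
    unfolding int_pow_product_group[OF group_integer_mod_group 0[unfolded G_def], folded G_def]
      int_pow_product_group[OF group_integer_mod_group 1[unfolded G_def], folded G_def]
    by (auto simp: G_def int_pow_integer_mod_group fun_eq_iff dest: lt2)
qed

lemma generate_one_mod: "generate (integer_mod_group n) {1 mod int n} = carrier (integer_mod_group n)"
proof (intro equalityI subsetI)
  have one: "1 mod int n \<in> carrier (integer_mod_group n)"
    by (simp add: carrier_integer_mod_group)
  interpret group "integer_mod_group n" by simp
  show "x \<in> carrier (integer_mod_group n)" if "x \<in> generate (integer_mod_group n) {1 mod int n}" for x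
    using generate_in_carrier[OF _ that] one by blast
  fix x assume x: "x \<in> carrier (integer_mod_group n)"
  have "(1 mod int n) [^]\<^bsub>integer_mod_group n\<^esub> x \<in> generate (integer_mod_group n) {1 mod int n}"
    using one by (intro subgroup_int_pow_closed generate_is_subgroup generate.incl) auto
  moreover have "(1 mod int n) [^]\<^bsub>integer_mod_group n\<^esub> x = x"
    using x by (auto simp: int_pow_integer_mod_group mod_mult_right_eq carrier_integer_mod_group split: if_splits)
  ultimately show "x \<in> generate (integer_mod_group n) {1 mod int n}" by simp
qed

context prime_residues begin

lemma slope_val_cyclic_sum:
  assumes g: "\<forall>i<r. g i \<in> carrier (integer_mod_group (a i))"
  shows "slope_val p f (cyclic_sum r a g) = 0"
proof (cases "r = 2")
  case True
  let ?G = "product_group {..<2} (\<lambda>i. integer_mod_group (a i))"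
  have g01: "g 0 \<in> carrier (integer_mod_group (a 0))" "g 1 \<in> carrier (integer_mod_group (a 1))"
    using g True by simp_all
  show ?thesis
    unfolding True cyclic_sum_2
  proof (rule slope_val_split)
    fix u v assume "rel_mod p ?G (\<lambda>k\<in>{..<2}. if k = 0 then g 0 else 0) (\<lambda>k\<in>{..<2}. if k = 1 then g 1 else 0) u v"
    then obtain y where y: "y \<in> carrier ?G"
      and eq: "(\<lambda>k\<in>{..<2}. (if k = 0 then u * g 0 else v * g 1) mod int (a k)) = y [^]\<^bsub>?G\<^esub> p"
      unfolding rel_mod_def cyclic_sum_2_pow[OF g01] by blast
    \<comment> \<open>A \<open>p\<close>-th power in the product remains one when its second
      coordinate is cleared.\<close>
    define z where "z = (\<lambda>k\<in>{..<2::nat}. if k = 0 then y 0 else 0)"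
    have y0: "y 0 \<in> carrier (integer_mod_group (a 0))" using y by (simp add: PiE_iff)
    then have z: "z \<in> carrier ?G" unfolding carrier_product_group z_def by (intro restrict_PiE_iff[THEN iffD2]) simp
    have "u * g 0 mod int (a 0) = (y [^]\<^bsub>?G\<^esub> p) 0"
      using fun_cong[OF eq, of 0] by simp
    also have "\<dots> = p * y 0 mod int (a 0)"
      unfolding int_pow_product_group[OF group_integer_mod_group y] by (simp add: int_pow_integer_mod_group)
    finally have "u * g 0 mod int (a 0) = p * y 0 mod int (a 0)" .
    then have "(\<lambda>k\<in>{..<2}. (if k = 0 then u * g 0 else 0 * g 1) mod int (a k)) = z [^]\<^bsub>?G\<^esub> p"
      unfolding int_pow_product_group[OF group_integer_mod_group z]
      by (auto simp: fun_eq_iff z_def int_pow_integer_mod_group)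
    then show "rel_mod p ?G (\<lambda>k\<in>{..<2}. if k = 0 then g 0 else 0) (\<lambda>k\<in>{..<2}. if k = 1 then g 1 else 0) u 0"
      unfolding rel_mod_def cyclic_sum_2_pow[OF g01] using z by blast
  qed
next
  case False
  then show ?thesis by (intro slope_val_length) (simp add: cyclic_sum_def)
qed

lemma bezout: assumes "\<not> p dvd v" obtains n m where "n * v = 1 + p * m"
proof -
  have "coprime v p" using assms prime by (metis coprime_commute prime_imp_coprime)
  then obtain n where "[v * n = 1] (mod p)" using cong_solve_coprime_int by blast
  then have "p dvd n * v - 1" by (simp add: cong_iff_dvd_diff mult.commute)
  then obtain m where "n * v - 1 = p * m" by blast
  then show ?thesis by (intro that[of n m]) simp
qed

text \<open>Since \<open>K\<close> contains p times every vector, it amounts to a subspace of the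
  plane over the field with \<open>p\<close> elements. The whole plane, zero and the two axes are
  products; every other line has a unit slope.\<close>

lemma lattice_cases:
  assumes diff: "\<And>u v u' v'. K u v \<Longrightarrow> K u' v' \<Longrightarrow> K (u - u') (v - v')"
    and scale: "\<And>n u v. K u v \<Longrightarrow> K (n * u) (n * v)"
    and p: "K p 0" "K 0 p"
  shows "(\<exists>a\<in>{1, p}. \<exists>b\<in>{1, p}. \<forall>u v. K u v \<longleftrightarrow> a dvd u \<and> b dvd v)
     \<or> (\<exists>x\<in>{1..<p}. \<forall>u v. K u v \<longleftrightarrow> p dvd u + x * v)"
proof -
  have add: "K (u + u') (v + v')" if "K u v" "K u' v'" for u v u' v'
    using diff[OF that(1) scale[OF that(2), of "- 1"]] by simp
  have K0: "K 0 0" using diff[OF p(1) p(1)] by simp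
  have pu: "K (p * u) 0" "K 0 (p * u)" for u
    using scale[OF p(1), of u] scale[OF p(2), of u] by (simp_all add: mult.commute)
  have unit1: "K 1 0" if Ku: "K u 0" and nd: "\<not> p dvd u" for u
  proof -
    obtain n m where nm: "n * u = 1 + p * m" by (rule bezout[OF nd])
    show ?thesis using diff[OF scale[OF Ku, of n] pu(1)[of m]] by (simp add: nm)
  qed
  have unit2: "K 0 1" if Ku: "K 0 u" and nd: "\<not> p dvd u" for u
  proof -
    obtain n m where nm: "n * u = 1 + p * m" by (rule bezout[OF nd])
    show ?thesis using diff[OF scale[OF Ku, of n] pu(2)[of m]] by (simp add: nm)
  qed
  have K1: "K u 0 \<longleftrightarrow> (if K 1 0 then 1 else p) dvd u" for u
    using unit1[of u] scale[of 1 0 u] pu(1) by auto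
  have K2: "K 0 v \<longleftrightarrow> (if K 0 1 then 1 else p) dvd v" for v
    using unit2[of v] scale[of 0 1 v] pu(2) by auto
  show ?thesis
  proof (cases "\<forall>u v. K u v \<longrightarrow> K u 0 \<and> K 0 v")
    case True
    have "K u v \<longleftrightarrow> K u 0 \<and> K 0 v" for u v
      using True add[of u 0 0 v] by auto
    then have "\<forall>u v. K u v \<longleftrightarrow> (if K 1 0 then 1 else p) dvd u \<and> (if K 0 1 then 1 else p) dvd v"
      unfolding K1[symmetric] K2[symmetric] by blast
    moreover have "(if K 1 0 then 1 else p) \<in> {1, p}" "(if K 0 1 then 1 else p) \<in> {1, p}" by auto
    ultimately show ?thesis by blast
  next
    case False
    then obtain u v where uv: "K u v" "\<not> (K u 0 \<and> K 0 v)" by blast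
    have both: "\<not> K u 0" "\<not> K 0 v"
      using uv diff[OF uv(1), of u 0] diff[OF uv(1), of 0 v] by auto
    have n1: "\<not> K 1 0" using scale[of 1 0 u] both by auto
    have n2: "\<not> K 0 1" using scale[of 0 1 v] both by auto
    have pv: "\<not> p dvd v" using both(2) pu(2) by auto
    obtain n m where nm: "n * v = 1 + p * m" by (rule bezout[OF pv])
    \<comment> \<open>Scaling by the inverse \<open>n\<close> of \<open>v\<close> modulo
      \<open>p\<close> turns the second coordinate into 1; the slope is minus the resulting first
      coordinate.\<close>
    define x where "x = (- (n * u)) mod p"
    have "K (n * u) 1" using diff[OF scale[OF uv(1), of n] pu(2)[of m]] by (simp add: nm)
    moreover have "p dvd n * u + x"
    proof -
      have "(n * u + x) mod p = (n * u + - (n * u)) mod p" unfolding x_def by (rule mod_add_right_eq)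
      then show ?thesis by (simp add: dvd_eq_mod_eq_0)
    qed
    then obtain k where k: "n * u + x = p * k" by blast
    ultimately have Kx: "K (- x) 1" using diff[of "n * u" 1 "p * k" 0] pu(1)[of k] by (simp add: k[symmetric])
    have x: "x \<in> {1..<p}"
    proof -
      have "x \<noteq> 0" using Kx n2 by auto
      moreover have "0 \<le> x" "x < p" using ge5 by (simp_all add: x_def)
      ultimately show ?thesis by simp
    qed
    have "K u v \<longleftrightarrow> p dvd u + x * v" for u v
    proof -
      have "K u v \<longleftrightarrow> K (u + x * v) 0"
        using diff[of u v "v * (- x)" "v * 1"] add[of "u + x * v" 0 "v * (- x)" "v * 1"] scale[OF Kx, of v]
        by (auto simp: mult.commute)
      then show ?thesis using K1[of "u + x * v"] n1 by simp
    qed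
    then show ?thesis using x by blast
  qed
qed

end

section \<open>Functionals on the module\<close>

lemma marked_iso_length: "marked_iso P Q \<Longrightarrow> length (snd P) = length (snd Q)"
  by (auto simp: marked_iso_def split: prod.splits)

lemma length_nat_copy: "marked_group P \<Longrightarrow> length (snd (nat_copy P)) = length (snd P)"
  using nat_copy marked_iso_length by metis

lemma length_marked_quotient:
  assumes "I \<subseteq> {..<j}" "I \<noteq> {}" "j \<le> length (snd P)"
  shows "length (snd (marked_quotient P j I k)) + card I = Suc (length (snd P))"
proof -
  have "{i. i < length [0..<j] \<and> [0..<j] ! i \<notin> I} = {..<j} - I" by auto
  then have "length (filter (\<lambda>i. i \<notin> I) [0..<j]) = card ({..<j} - I)"
    unfolding length_filter_conv_card by simp
  also have "\<dots> = j - card I" using assms(1) finite_subset by (subst card_Diff_subset) auto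
  finally have "length (filter (\<lambda>i. i \<notin> I) [0..<j]) = j - card I" .
  moreover have "card I \<le> j" using card_mono[OF _ assms(1)] by simp
  ultimately show ?thesis
    using assms(3) by (cases P) (simp add: marked_quotient_def Let_def)
qed

lemma t_free_pow_of: "(t_free ^^ n) (frag_of Q) = frag_of ((append_zero ^^ n) Q)"
  by (induction n) (simp_all add: t_free_def)

lemma length_append_zero_pow: "length (snd ((append_zero ^^ n) Q)) = length (snd Q) + n"
proof (induction n)
  case (Suc n)
  have "length (snd (append_zero R)) = Suc (length (snd R))" for R :: "'a marked"
    by (cases R) (simp add: append_zero_def)
  then show ?case using Suc by simp
qed simp

lemma append_zero_pow_in: "admissible T \<Longrightarrow> Q \<in> T \<Longrightarrow> (append_zero ^^ n) Q \<in> T"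
  by (induction n) (simp_all add: admissible_append_zero)

lemma singleton_quotient:
  assumes P: "marked_group (A, S)" and k: "k < j" and j: "j \<le> length S"
  shows "marked_iso (A, S ! k # map (\<lambda>i. S ! i \<otimes>\<^bsub>A\<^esub> inv\<^bsub>A\<^esub> (S ! k)) (filter (\<lambda>i. i \<noteq> k) [0..<j]) @ drop j S)
    (marked_quotient (A, S) j {k} k)"
proof -
  have A: "comm_group A" and S: "set S \<subseteq> carrier A" using P by (auto simp: marked_group_def)
  interpret A: comm_group A by (rule A)
  have "S ! k \<in> carrier A" using k j S by auto
  then have H: "generate A ((\<lambda>i. S ! i \<otimes>\<^bsub>A\<^esub> inv\<^bsub>A\<^esub> (S ! k)) ` {k}) = {\<one>\<^bsub>A\<^esub>}"
    by (simp add: A.generate_one)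
  have coset: "{\<one>\<^bsub>A\<^esub>} #>\<^bsub>A\<^esub> x = {x}" if "x \<in> carrier A" for x
    using that by (auto simp: r_coset_def)
  have n: "{\<one>\<^bsub>A\<^esub>} \<lhd> A" by (rule A.one_is_normal)
  have "(\<lambda>x. {\<one>\<^bsub>A\<^esub>} #>\<^bsub>A\<^esub> x) \<in> iso A (A Mod {\<one>\<^bsub>A\<^esub>})"
    using normal.r_coset_hom_Mod[OF n]
    by (auto simp: iso_def bij_betw_def carrier_FactGroup coset inj_on_def)
  then show ?thesis
    unfolding marked_quotient_def marked_iso_def prod.case Let_def H by auto
qed

text \<open>Relation (iii) up to terms divisible by \<open>t\<close>.\<close>

lemma quotient_sum:
  assumes T: "admissible T" and P: "P \<in> T" and j: "j \<le> length (snd P)"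
    and c: "\<forall>I. I \<noteq> {} \<and> I \<subseteq> {..<j} \<longrightarrow> c I \<in> I"
  obtains y where "Poly_Mapping.keys y \<subseteq> {Q \<in> T. Suc (length (snd Q)) = length (snd P)}"
    "(\<Sum>I \<in> {I. I \<noteq> {} \<and> I \<subseteq> {..<j}}. frag_cmul ((-1) ^ (card I - 1))
         ((t_free ^^ (card I - 1)) (frag_of (nat_copy (marked_quotient P j I (c I))))))
     = (\<Sum>k<j. frag_of (nat_copy (marked_quotient P j {k} k))) + t_free y"
proof -
  let ?F = "\<lambda>I. frag_cmul ((-1) ^ (card I - 1))
         ((t_free ^^ (card I - 1)) (frag_of (nat_copy (marked_quotient P j I (c I)))))"
  let ?N = "\<lambda>I. nat_copy (marked_quotient P j I (c I))"
  define B where "B = {I. I \<noteq> {} \<and> I \<subseteq> {..<j} \<and> card I \<noteq> 1}"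
  \<comment> \<open>One factor t is pulled out of each term with at least two elements in
    \<open>I\<close>, which leaves the exponent \<open>card I - 2\<close>. A quotient by
    \<open>I\<close> has shortened the sequence by \<open>card I - 1\<close>, so all terms of
    \<open>y\<close> are one shorter than the given pair.\<close>
  define y where "y = (\<Sum>I\<in>B. frag_cmul ((-1) ^ (card I - 1)) ((t_free ^^ (card I - 2)) (frag_of (?N I))))"
  have mP: "marked_group P" using admissible_subset[OF T] P by (auto simp: all_pairs_def)
  have fin: "finite B" by (rule finite_subset[of _ "Pow {..<j}"]) (auto simp: B_def)
  have card2: "card I \<ge> 2" if "I \<in> B" for I
  proof -
    have "finite I" "I \<noteq> {}" using that finite_subset[of I "{..<j}"] by (auto simp: B_def)
    then have "card I \<noteq> 0" by simp
    then show ?thesis using that by (simp add: B_def)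
  qed
  have Fy: "sum ?F B = t_free y"
  proof -
    have "t_free y = (\<Sum>I\<in>B. t_free (frag_cmul ((-1) ^ (card I - 1)) ((t_free ^^ (card I - 2)) (frag_of (?N I)))))"
      unfolding y_def t_free_def by (simp add: frag_extend_sum[OF fin] o_def)
    also have "\<dots> = sum ?F B"
    proof (rule sum.cong[OF refl])
      fix I assume I: "I \<in> B"
      have e: "card I - 1 = Suc (card I - 2)" using card2[OF I] by simp
      show "t_free (frag_cmul ((-1) ^ (card I - 1)) ((t_free ^^ (card I - 2)) (frag_of (?N I)))) = ?F I"
        unfolding e by (simp add: t_free_def frag_extend_cmul)
    qed
    finally show ?thesis by simp
  qed
  have "{I. I \<noteq> {} \<and> I \<subseteq> {..<j}} = (\<lambda>k. {k}) ` {..<j} \<union> B"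
    by (auto simp: B_def card_1_singleton_iff)
  moreover have "(\<lambda>k. {k}) ` {..<j} \<inter> B = {}" by (auto simp: B_def)
  ultimately have "sum ?F {I. I \<noteq> {} \<and> I \<subseteq> {..<j}} = sum ?F ((\<lambda>k. {k}) ` {..<j}) + sum ?F B"
    using fin by (simp add: sum.union_disjoint)
  also have "sum ?F ((\<lambda>k. {k}) ` {..<j}) = (\<Sum>k<j. frag_of (nat_copy (marked_quotient P j {k} k)))"
  proof -
    have "c {k} = k" if "k < j" for k using c[rule_format, of "{k}"] that by auto
    then show ?thesis by (subst sum.reindex) auto
  qed
  finally have 2: "sum ?F {I. I \<noteq> {} \<and> I \<subseteq> {..<j}} = (\<Sum>k<j. frag_of (nat_copy (marked_quotient P j {k} k))) + t_free y"
    by (simp only: Fy)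
  have "Poly_Mapping.keys y \<subseteq> {Q \<in> T. Suc (length (snd Q)) = length (snd P)}"
  proof -
    have "Poly_Mapping.keys (frag_cmul ((-1) ^ (card I - 1)) ((t_free ^^ (card I - 2)) (frag_of (?N I))))
      \<subseteq> {Q \<in> T. Suc (length (snd Q)) = length (snd P)}" if I: "I \<in> B" for I
    proof -
      have I': "I \<subseteq> {..<j}" "c I \<in> I" "I \<noteq> {}" using I c by (auto simp: B_def)
      have "?N I \<in> T" by (rule admissible_marked_quotient[OF T P I'(1,2) j])
      moreover have "length (snd (?N I)) + card I = Suc (length (snd P))"
        using length_nat_copy[OF marked_group_marked_quotient[OF mP I'(1,2) j]]
          length_marked_quotient[OF I'(1,3) j] by simp
      ultimately have "(append_zero ^^ (card I - 2)) (?N I) \<in> {Q \<in> T. Suc (length (snd Q)) = length (snd P)}"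
        using append_zero_pow_in[OF T] card2[OF I] by (simp add: length_append_zero_pow)
      then show ?thesis unfolding t_free_pow_of by auto
    qed
    then show ?thesis unfolding y_def by (intro order.trans[OF keys_sum]) auto
  qed
  then show ?thesis using 2 by (rule that)
qed

section \<open>Linear extension of functions of pairs\<close>

definition Psi :: "(nat marked \<Rightarrow> int) \<Rightarrow> frag \<Rightarrow> int" where
  "Psi \<phi> x = (\<Sum>P\<in>Poly_Mapping.keys x. Poly_Mapping.lookup x P * \<phi> P)"

lemma Psi_superset: "finite F \<Longrightarrow> Poly_Mapping.keys x \<subseteq> F \<Longrightarrow> Psi \<phi> x = (\<Sum>P\<in>F. Poly_Mapping.lookup x P * \<phi> P)"
  unfolding Psi_def by (rule sum.mono_neutral_left) (auto simp: in_keys_iff)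

lemma Psi_0 [simp]: "Psi \<phi> 0 = 0" by (simp add: Psi_def)

lemma Psi_of [simp]: "Psi \<phi> (frag_of P) = \<phi> P" by (simp add: Psi_def keys_frag_of)

lemma Psi_add: "Psi \<phi> (x + y) = Psi \<phi> x + Psi \<phi> y"
proof -
  let ?F = "Poly_Mapping.keys x \<union> Poly_Mapping.keys y"
  have "finite ?F" by simp
  then show ?thesis
    using keys_add[of x y] by (simp add: Psi_superset[of ?F] lookup_add distrib_right sum.distrib)
qed

lemma Psi_cmul: "Psi \<phi> (frag_cmul n x) = n * Psi \<phi> x"
  using Psi_superset[of "Poly_Mapping.keys x" "frag_cmul n x" \<phi>] keys_cmul[of n x]
  by (simp add: Psi_def sum_distrib_left mult.assoc)

lemma Psi_diff: "Psi \<phi> (x - y) = Psi \<phi> x - Psi \<phi> y"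
  using Psi_add[of \<phi> "x - y" y] by simp

lemma Psi_sum: "Psi \<phi> (\<Sum>i\<in>A. g i) = (\<Sum>i\<in>A. Psi \<phi> (g i))"
  by (induction A rule: infinite_finite_induct) (simp_all add: Psi_add)

lemma Psi_t_free:
  assumes "\<And>P. P \<in> Poly_Mapping.keys x \<Longrightarrow> \<phi> (append_zero P) = 0"
  shows "Psi \<phi> (t_free x) = 0"
  using assms by (simp add: t_free_def frag_extend_def Psi_sum Psi_cmul)

lemma marked_group_shear:
  assumes P: "marked_group (A, [a, b])"
  shows "marked_group (A, [a, b \<otimes>\<^bsub>A\<^esub> inv\<^bsub>A\<^esub> a])"
proof -
  have A: "comm_group A" and ab: "a \<in> carrier A" "b \<in> carrier A" and gen: "generate A {a, b} = carrier A"
    and fin: "finite (carrier A)"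
    using P by (auto simp: marked_group_def)
  interpret A: comm_group A by (rule A)
  let ?c = "b \<otimes>\<^bsub>A\<^esub> inv\<^bsub>A\<^esub> a"
  have c: "?c \<in> carrier A" using ab by simp
  let ?H = "generate A {a, ?c}"
  have H: "subgroup ?H A" using ab c by (intro A.generate_is_subgroup) auto
  have aH: "a \<in> ?H" and cH: "?c \<in> ?H" by (auto intro: generate.incl)
  have "?c \<otimes>\<^bsub>A\<^esub> a \<in> ?H" by (rule subgroup.m_closed[OF H cH aH])
  then have "b \<in> ?H" using ab by (simp add: A.m_assoc)
  then have "generate A {a, b} \<subseteq> ?H" using aH by (intro A.generate_subgroup_incl[OF _ H]) auto
  then have "?H = carrier A" using gen subgroup.subset[OF H] by auto
  then show ?thesis using A ab c fin by (simp add: marked_group_def)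
qed

lemma marked_group_swap: "marked_group (A, [a, b]) \<Longrightarrow> marked_group (A, [b, a])"
  by (simp add: marked_group_def insert_commute)

lemma quotient_pair:
  assumes P: "marked_group (A, [a, b])"
  shows "marked_iso (A, [a, b \<otimes>\<^bsub>A\<^esub> inv\<^bsub>A\<^esub> a]) (nat_copy (marked_quotient (A, [a, b]) 2 {0} 0))"
    and "marked_iso (A, [b, a \<otimes>\<^bsub>A\<^esub> inv\<^bsub>A\<^esub> b]) (nat_copy (marked_quotient (A, [a, b]) 2 {1} 1))"
proof -
  have up: "[0..<2] = [0, 1::nat]" by (simp add: upt_rec)
  have f: "filter (\<lambda>i. i \<noteq> 0) [0..<2] = [1::nat]" "filter (\<lambda>i. i \<noteq> 1) [0..<2] = [0::nat]"
    unfolding up by simp_all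
  have "marked_iso (A, [a, b \<otimes>\<^bsub>A\<^esub> inv\<^bsub>A\<^esub> a]) (marked_quotient (A, [a, b]) 2 {0} 0)"
    using singleton_quotient[OF P, of 0 2] unfolding f by simp
  moreover have "marked_group (marked_quotient (A, [a, b]) 2 {0} 0)"
    by (rule marked_group_marked_quotient[OF P]) auto
  ultimately show "marked_iso (A, [a, b \<otimes>\<^bsub>A\<^esub> inv\<^bsub>A\<^esub> a]) (nat_copy (marked_quotient (A, [a, b]) 2 {0} 0))"
    using nat_copy marked_iso_trans by blast
  have "marked_iso (A, [b, a \<otimes>\<^bsub>A\<^esub> inv\<^bsub>A\<^esub> b]) (marked_quotient (A, [a, b]) 2 {1} 1)"
    using singleton_quotient[OF P, of 1 2] unfolding f by simp
  moreover have "marked_group (marked_quotient (A, [a, b]) 2 {1} 1)"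
    by (rule marked_group_marked_quotient[OF P]) auto
  ultimately show "marked_iso (A, [b, a \<otimes>\<^bsub>A\<^esub> inv\<^bsub>A\<^esub> b]) (nat_copy (marked_quotient (A, [a, b]) 2 {1} 1))"
    using nat_copy marked_iso_trans by blast
qed

context prime_residues begin

lemma Psi_kernel:
  fixes m :: int and f :: "int \<Rightarrow> int"
  defines "K \<equiv> {x. Poly_Mapping.keys x \<subseteq> all_pairs \<and> m dvd Psi (slope_val p f) x}"
  shows "subgroup K (free_Abelian_group all_pairs)" "t_free ` K \<subseteq> K"
proof -
  let ?\<phi> = "slope_val p f" and ?F = "free_Abelian_group all_pairs"
  show "subgroup K ?F"
  proof (rule group.subgroupI[OF group_free_Abelian_group])
    show "K \<subseteq> carrier ?F" by (auto simp: K_def)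
    have "0 \<in> K" by (simp add: K_def)
    then show "K \<noteq> {}" by blast
    fix x y assume xy: "x \<in> K" "y \<in> K"
    have "Psi ?\<phi> (- x) = - Psi ?\<phi> x" using Psi_diff[of ?\<phi> 0 x] by simp
    then show "inv\<^bsub>?F\<^esub> x \<in> K" using xy by (simp add: K_def)
    show "x \<otimes>\<^bsub>?F\<^esub> y \<in> K" using xy keys_add[of x y] by (auto simp: K_def Psi_add)
  qed
  have "Psi ?\<phi> (t_free y) = 0" if "Poly_Mapping.keys y \<subseteq> all_pairs" for y
    using that by (intro Psi_t_free slope_val_append_zero) (auto simp: all_pairs_def)
  then show "t_free ` K \<subseteq> K" using t_free_closed[of all_pairs] by (auto simp: K_def)
qed

text \<open>Beyond invariance under isomorphism, only degree 2 needs an argument. There permutations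
  are covered by the invariance of \<open>f\<close> under \<open>J\<close>, and relation (iii) is
  left with its two terms for |I| = 1, because the functional kills t; this is
  \<open>slope_val_rel\<close>.\<close>

lemma Psi_relations:
  assumes f: "slope_rel {z. m dvd z} f" and x: "x \<in> relations all_pairs"
  shows "m dvd Psi (slope_val p f) x"
proof -
  let ?\<phi> = "slope_val p f" and ?F = "free_Abelian_group all_pairs"
  define K where "K = {x. Poly_Mapping.keys x \<subseteq> all_pairs \<and> m dvd Psi ?\<phi> x}"
  have tz: "Psi ?\<phi> (t_free y) = 0" if "Poly_Mapping.keys y \<subseteq> all_pairs" for y
    using that by (intro Psi_t_free slope_val_append_zero) (auto simp: all_pairs_def)
  have "perm_relators all_pairs \<union> iso_relators all_pairs \<union> quotient_relators all_pairs \<subseteq> K"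
  proof
    fix r assume r: "r \<in> perm_relators all_pairs \<union> iso_relators all_pairs \<union> quotient_relators all_pairs"
    then have "r \<in> carrier ?F" by (rule subsetD[OF relators_closed[OF admissible_simps(1)]])
    then have kr: "Poly_Mapping.keys r \<subseteq> all_pairs" by simp
    from r consider "r \<in> perm_relators all_pairs" | "r \<in> iso_relators all_pairs" | "r \<in> quotient_relators all_pairs"
      by blast
    then have "m dvd Psi ?\<phi> r"
    proof cases
      case 1
      then obtain A S S' where 1: "r = frag_of (A, S) - frag_of (A, S')" "(A, S) \<in> all_pairs" "mset S' = mset S"
        unfolding perm_relators_def by blast
      have A: "comm_group A" "set S \<subseteq> carrier A" using 1(2) by (auto simp: all_pairs_def marked_group_def)
      have M: "diff_closed {z. m dvd z}" by (rule diff_closed_dvd)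
      show ?thesis
      proof (cases "length S = 2")
        case True
        then obtain a b where S: "S = [a, b]" by (auto simp: length_Suc_conv numeral_2_eq_2)
        have "length S' = 2" using 1(3) True by (metis size_mset)
        then obtain c d where S': "S' = [c, d]" by (auto simp: length_Suc_conv numeral_2_eq_2)
        have "c = a \<and> d = b \<or> c = b \<and> d = a"
          using 1(3) unfolding S S' by (auto simp: add_eq_conv_ex add_mset_eq_single)
        moreover have "m dvd ?\<phi> (A, [a, b]) - ?\<phi> (A, [b, a])"
        proof -
          have ab: "a \<in> carrier A" "b \<in> carrier A" using A(2) S by auto
          show ?thesis
          proof (cases "\<exists>x\<in>{1..<p}. has_slope p (A, [a, b]) x")
            case True
            then obtain x where x: "x \<in> {1..<p}" "has_slope p (A, [a, b]) x" by blast
            have "m dvd f (J x) - f x" using f x(1) unfolding slope_rel_def by blast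
            then show ?thesis
              using slope_val_eq[OF x(2,1), of f] slope_val_eq[OF has_slope_swap[OF A(1) ab x] J_ex(1)[OF x(1)], of f]
              by (simp add: dvd_diff_commute)
          next
            case False
            then have "\<not> (\<exists>x\<in>{1..<p}. has_slope p (A, [b, a]) x)"
              using has_slope_swap[OF A(1) ab(2,1)] J_ex(1) by blast
            then have "?\<phi> (A, [a, b]) = 0" "?\<phi> (A, [b, a]) = 0"
              using False by (simp_all only: slope_val_def if_False)
            then show ?thesis by simp
          qed
        qed
        ultimately show ?thesis unfolding 1(1) S S' Psi_diff Psi_of by auto
      next
        case False
        moreover have "length S' = length S" using 1(3) by (metis size_mset)
        ultimately show ?thesis unfolding 1(1) Psi_diff Psi_of by (simp add: slope_val_length)
      qed
    next
      case 2
      then obtain P Q where "r = frag_of P - frag_of Q" "P \<in> all_pairs" "Q \<in> all_pairs" "marked_iso P Q"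
        unfolding iso_relators_def by blast
      then show ?thesis using slope_val_iso[of P Q p f] by (simp add: Psi_diff all_pairs_def)
    next
      case 3
      then obtain P j c where 3: "r = frag_of P - (\<Sum>I \<in> {I. I \<noteq> {} \<and> I \<subseteq> {..<j}}.
         frag_cmul ((-1) ^ (card I - 1))
           ((t_free ^^ (card I - 1)) (frag_of (nat_copy (marked_quotient P j I (c I))))))"
        "P \<in> all_pairs" "2 \<le> j" "j \<le> length (snd P)" "\<forall>I. I \<noteq> {} \<and> I \<subseteq> {..<j} \<longrightarrow> c I \<in> I"
        unfolding quotient_relators_def by blast
      obtain y where y: "Poly_Mapping.keys y \<subseteq> {Q \<in> all_pairs. Suc (length (snd Q)) = length (snd P)}"
        and eq: "(\<Sum>I \<in> {I. I \<noteq> {} \<and> I \<subseteq> {..<j}}. frag_cmul ((-1) ^ (card I - 1))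
         ((t_free ^^ (card I - 1)) (frag_of (nat_copy (marked_quotient P j I (c I))))))
         = (\<Sum>k<j. frag_of (nat_copy (marked_quotient P j {k} k))) + t_free y"
        by (rule quotient_sum[OF admissible_simps(1) 3(2,4,5)])
      have ty: "Psi ?\<phi> (t_free y) = 0" using y by (intro tz) blast
      have mP: "marked_group P" using 3(2) by (simp add: all_pairs_def)
      have val: "Psi ?\<phi> r = ?\<phi> P - (\<Sum>k<j. ?\<phi> (nat_copy (marked_quotient P j {k} k)))"
        unfolding 3(1) eq by (simp add: Psi_diff Psi_add Psi_sum ty)
      show ?thesis
      proof (cases "length (snd P) = 2")
        case True
        then have j: "j = 2" using 3 by simp
        obtain A a b where P: "P = (A, [a, b])"
          using True by (cases P) (auto simp: length_Suc_conv numeral_2_eq_2)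
        note m = mP[unfolded P]
        have A: "comm_group A" "a \<in> carrier A" "b \<in> carrier A" using m by (auto simp: marked_group_def)
        have mq: "marked_group (nat_copy (marked_quotient (A, [a, b]) 2 {k} k))" if "k < 2" for k
          using nat_copy[OF marked_group_marked_quotient[OF m, of "{k}" 2 k]] that by simp
        have "?\<phi> (A, [a, b \<otimes>\<^bsub>A\<^esub> inv\<^bsub>A\<^esub> a]) = ?\<phi> (nat_copy (marked_quotient (A, [a, b]) 2 {0} 0))"
          by (rule slope_val_iso[OF marked_group_shear[OF m] mq quotient_pair(1)[OF m]]) simp
        moreover have "?\<phi> (A, [b, a \<otimes>\<^bsub>A\<^esub> inv\<^bsub>A\<^esub> b]) = ?\<phi> (nat_copy (marked_quotient (A, [a, b]) 2 {1} 1))"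
          by (rule slope_val_iso[OF marked_group_shear[OF marked_group_swap[OF m]] mq quotient_pair(2)[OF m]]) simp
        moreover have "(\<Sum>k<2. ?\<phi> (nat_copy (marked_quotient (A, [a, b]) 2 {k} k)))
          = ?\<phi> (nat_copy (marked_quotient (A, [a, b]) 2 {0} 0)) + ?\<phi> (nat_copy (marked_quotient (A, [a, b]) 2 {1} 1))"
          by (simp add: numeral_2_eq_2)
        ultimately show ?thesis
          using slope_val_rel[OF diff_closed_dvd f A] unfolding val j P by (simp add: algebra_simps)
      next
        case False
        have "?\<phi> (nat_copy (marked_quotient P j {k} k)) = 0" if "k < j" for k
        proof (rule slope_val_length)
          have "length (snd (nat_copy (marked_quotient P j {k} k))) = length (snd (marked_quotient P j {k} k))"
            by (rule length_nat_copy[OF marked_group_marked_quotient[OF mP]]) (use that 3 in auto)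
          then show "length (snd (nat_copy (marked_quotient P j {k} k))) \<noteq> 2"
            using length_marked_quotient[of "{k}" j P k] that 3 False by simp
        qed
        then show ?thesis unfolding val using slope_val_length[OF False, of p f] by simp
      qed
    qed
    then show "r \<in> K" using kr by (simp add: K_def)
  qed
  then have "relations all_pairs \<subseteq> K"
    unfolding relations_def using Psi_kernel[of m f, folded K_def] by (intro zt_span_least)
  then show ?thesis using x by (auto simp: K_def)
qed

end

section \<open>Classes modulo the submodule of split pairs\<close>

lemma group_hom_B_class:
  assumes "admissible T"
  shows "group_hom (free_Abelian_group T) (B_module T) (B_class T)"
proof -
  have "relations T \<lhd> free_Abelian_group T"
    using relations_closed(1)[OF assms] comm_group.normal_iff_subgroup[OF abelian_free_Abelian_group] by blast
  from normal.r_coset_hom_Mod[OF this] have "B_class T \<in> hom (free_Abelian_group T) (B_module T)"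
    by (simp add: B_module_def B_class_def[abs_def])
  then show ?thesis
    using comm_group_B_module[OF assms] by (simp add: group_hom_def group_hom_axioms_def comm_group_def)
qed

lemma B_class_eqD:
  assumes T: "admissible T" and "B_class T x = B_class T y"
  shows "x - y \<in> relations T"
proof -
  have "0 \<in> relations T" using subgroup.one_closed[OF relations_closed(1)[OF T]] by simp
  then have "x \<in> B_class T x" by (auto simp: B_class_eq intro: exI[of _ 0])
  then have "x \<in> B_class T y" using assms(2) by simp
  then show ?thesis by (auto simp: B_class_eq)
qed

text \<open>Congruence modulo \<open>C_submodule\<close>, expressed on representatives in the free
  module: a set closed under differences, to which the graph lemmas apply with \<open>M\<close>
  equal to it.\<close>

definition C_frags :: "frag set" where
  "C_frags = {x. Poly_Mapping.keys x \<subseteq> all_pairs \<and> B_class all_pairs x \<in> C_submodule}"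

lemma diff_closed_C_frags: "diff_closed C_frags"
  unfolding diff_closed_def
proof (intro conjI ballI)
  interpret h: group_hom "free_Abelian_group all_pairs" "B_module all_pairs" "B_class all_pairs"
    by (rule group_hom_B_class) simp
  have C: "subgroup C_submodule (B_module all_pairs)" by (rule C_submodule_closed)
  have "B_class all_pairs 0 = \<one>\<^bsub>B_module all_pairs\<^esub>" using h.hom_one by simp
  then show "0 \<in> C_frags" using subgroup.one_closed[OF C] by (simp add: C_frags_def)
  fix x y assume xy: "x \<in> C_frags" "y \<in> C_frags"
  then have "B_class all_pairs (x + - y) = B_class all_pairs x \<otimes>\<^bsub>B_module all_pairs\<^esub> inv\<^bsub>B_module all_pairs\<^esub> B_class all_pairs y"
    using h.hom_mult[of x "- y"] h.hom_inv[of y] by (simp add: C_frags_def)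
  also have "\<dots> \<in> C_submodule"
    using xy by (intro subgroup.m_closed[OF C] subgroup.m_inv_closed[OF C]) (auto simp: C_frags_def)
  finally show "x - y \<in> C_frags" using xy keys_diff[of x y] by (auto simp: C_frags_def)
qed

lemma relations_C_frags: "relations all_pairs \<subseteq> C_frags"
proof
  fix x assume x: "x \<in> relations all_pairs"
  have "B_class all_pairs x = B_class all_pairs 0" using B_class_absorb[OF admissible_simps(1) x, of 0] by simp
  moreover have "0 \<in> C_frags" by (rule diff_closed_zero[OF diff_closed_C_frags])
  moreover have "Poly_Mapping.keys x \<subseteq> all_pairs"
    using subgroup.mem_carrier[OF relations_closed(1)[OF admissible_simps(1)] x] by simp
  ultimately show "x \<in> C_frags" by (simp add: C_frags_def)
qed

lemma iso_C_frags:
  assumes "marked_group P" "marked_group Q" "marked_iso P Q"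
  shows "frag_of P - frag_of Q \<in> C_frags"
proof -
  have "frag_of P - frag_of Q \<in> iso_relators all_pairs"
    using assms unfolding iso_relators_def all_pairs_def by blast
  then have "frag_of P - frag_of Q \<in> relations all_pairs"
    using relations_closed(3)[OF admissible_simps(1)] by blast
  then show ?thesis using relations_C_frags by blast
qed

lemma swap_C_frags:
  assumes "marked_group (A, [a, b])"
  shows "frag_of (A, [a, b]) - frag_of (A, [b, a]) \<in> C_frags"
proof -
  have "mset [b, a] = mset [a, b]" by (simp add: add_mset_commute)
  moreover have "(A, [a, b]) \<in> all_pairs" using assms by (simp add: all_pairs_def)
  ultimately have "frag_of (A, [a, b]) - frag_of (A, [b, a]) \<in> perm_relators all_pairs"
    unfolding perm_relators_def by blast
  then have "frag_of (A, [a, b]) - frag_of (A, [b, a]) \<in> relations all_pairs"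
    using relations_closed(3)[OF admissible_simps(1)] by blast
  then show ?thesis using relations_C_frags by blast
qed

lemma cyclic_sum_C_frags:
  assumes "\<forall>i<r. 0 < a i \<and> g i \<in> carrier (integer_mod_group (a i))
          \<and> generate (integer_mod_group (a i)) {g i} = carrier (integer_mod_group (a i))"
  shows "frag_of (nat_copy (cyclic_sum r a g)) \<in> C_frags"
proof -
  have "B_symbol all_pairs (nat_copy (cyclic_sum r a g)) \<in> C_submodule"
    using assms unfolding C_submodule_def zt_span_def by blast
  moreover have "nat_copy (cyclic_sum r a g) \<in> all_pairs"
    using nat_copy[OF marked_group_cyclic_sum[OF assms]] by (simp add: all_pairs_def)
  ultimately show ?thesis by (simp add: C_frags_def B_symbol_def)
qed

context prime_residues begin

abbreviation TP :: "nat marked set" where "TP \<equiv> torsion_pairs (nat p)"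

text \<open>The classes that have a representative with value divisible by \<open>m\<close> form a
  submodule, and it contains the generators of \<open>C_submodule\<close> since their lattices are
  products. Any other representative differs by relations, on which the value is divisible by
  \<open>m\<close> too.\<close>

lemma Psi_C_frags:
  assumes f: "slope_rel {z. m dvd z} f" and x: "x \<in> C_frags"
  shows "m dvd Psi (slope_val p f) x"
proof -
  let ?F = "free_Abelian_group all_pairs" and ?B = "B_module all_pairs" and ?\<phi> = "slope_val p f"
  define K where "K = {x. Poly_Mapping.keys x \<subseteq> all_pairs \<and> m dvd Psi ?\<phi> x}"
  note K = Psi_kernel[of m f, folded K_def]
  interpret h: group_hom ?F ?B "B_class all_pairs" by (rule group_hom_B_class) simp
  have "C_submodule \<subseteq> B_class all_pairs ` K"
    unfolding C_submodule_def
  proof (rule zt_span_least)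
    show "subgroup (B_class all_pairs ` K) ?B" by (rule h.subgroup_img_is_subgroup[OF K(1)])
    show "t_module all_pairs ` B_class all_pairs ` K \<subseteq> B_class all_pairs ` K"
      using K(2) by (auto simp: t_module_B_class)
    show "{B_symbol all_pairs (nat_copy (cyclic_sum r a g)) | r a g.
        \<forall>i<r. 0 < a i \<and> g i \<in> carrier (integer_mod_group (a i))
          \<and> generate (integer_mod_group (a i)) {g i} = carrier (integer_mod_group (a i))} \<subseteq> B_class all_pairs ` K"
    proof
      fix Y assume "Y \<in> {B_symbol all_pairs (nat_copy (cyclic_sum r a g)) | r a g.
        \<forall>i<r. 0 < a i \<and> g i \<in> carrier (integer_mod_group (a i))
          \<and> generate (integer_mod_group (a i)) {g i} = carrier (integer_mod_group (a i))}"
      then obtain r a g where Y: "Y = B_symbol all_pairs (nat_copy (cyclic_sum r a g))" and g: "\<forall>i<r. 0 < a i \<and> g i \<in> carrier (integer_mod_group (a i))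
          \<and> generate (integer_mod_group (a i)) {g i} = carrier (integer_mod_group (a i))"
        by blast
      have m: "marked_group (cyclic_sum r a g)" by (rule marked_group_cyclic_sum[OF g])
      have "slope_val p f (nat_copy (cyclic_sum r a g)) = slope_val p f (cyclic_sum r a g)"
        using slope_val_iso[OF m] nat_copy[OF m] by metis
      also have "\<dots> = 0" using g by (intro slope_val_cyclic_sum) blast
      finally have "frag_of (nat_copy (cyclic_sum r a g)) \<in> K"
        using nat_copy[OF m] by (simp add: K_def all_pairs_def)
      then show "Y \<in> B_class all_pairs ` K"
        unfolding Y B_symbol_def by (rule imageI)
    qed
  qed
  then obtain y where y: "y \<in> K" "B_class all_pairs x = B_class all_pairs y" using x by (auto simp: C_frags_def)
  have "m dvd Psi ?\<phi> (x - y)"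
    by (rule Psi_relations[OF f B_class_eqD[OF _ y(2)]]) simp
  moreover have "m dvd Psi ?\<phi> y" using y by (simp add: K_def)
  ultimately show ?thesis using dvd_add[of m "Psi ?\<phi> (x - y)" "Psi ?\<phi> y"] by (simp add: Psi_diff)
qed

lemma int_nat_p: "int (nat p) = p" using ge5 by simp

lemma TP_iff: "(A, U) \<in> TP \<longleftrightarrow> marked_group (A, U) \<and> (\<forall>x\<in>carrier A. x [^]\<^bsub>A\<^esub> p = \<one>\<^bsub>A\<^esub>)"
proof -
  have "x [^]\<^bsub>A\<^esub> nat p = x [^]\<^bsub>A\<^esub> p" for x
    using int_pow_int[of A x "nat p"] unfolding int_nat_p by simp
  then show ?thesis by (simp add: torsion_pairs_def)
qed

lemma TP_D: assumes "(A, U) \<in> TP"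
  shows "marked_group (A, U)" "x \<in> carrier A \<Longrightarrow> x [^]\<^bsub>A\<^esub> p = \<one>\<^bsub>A\<^esub>"
  using assms by (auto simp: TP_iff)

lemma rel_mod_TP:
  assumes "marked_group (A, U)" and "\<forall>x\<in>carrier A. x [^]\<^bsub>A\<^esub> p = \<one>\<^bsub>A\<^esub>"
  shows "rel_mod p A a b u v \<longleftrightarrow> a [^]\<^bsub>A\<^esub> u \<otimes>\<^bsub>A\<^esub> b [^]\<^bsub>A\<^esub> v = \<one>\<^bsub>A\<^esub>"
proof -
  interpret comm_group A using assms by (simp add: marked_group_def)
  show ?thesis using assms(2) one_closed unfolding rel_mod_def by metis
qed

lemma product_C_frags:
  assumes P: "(A, [a, b]) \<in> TP" and c: "c \<in> {1, p}" and d: "d \<in> {1, p}"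
    and rel: "\<And>u v. rel_mod p A a b u v \<longleftrightarrow> c dvd u \<and> d dvd v"
  shows "frag_of (A, [a, b]) \<in> C_frags"
proof -
  define \<alpha> where "\<alpha> = (\<lambda>i::nat. nat (if i = 0 then c else d))"
  \<comment> \<open>Reducing 1 gives the right generator 0 in a summand that is trivial.\<close>
  define g where "g = (\<lambda>i. 1 mod int (\<alpha> i))"
  have \<alpha>: "0 < \<alpha> i" "int (\<alpha> 0) = c" "int (\<alpha> 1) = d" for i using c d ge5 by (auto simp: \<alpha>_def)
  have g: "\<forall>i<2. 0 < \<alpha> i \<and> g i \<in> carrier (integer_mod_group (\<alpha> i))
          \<and> generate (integer_mod_group (\<alpha> i)) {g i} = carrier (integer_mod_group (\<alpha> i))"
    using \<alpha>(1) generate_one_mod by (simp add: g_def carrier_integer_mod_group)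
  let ?G = "product_group {..<2} (\<lambda>i. integer_mod_group (\<alpha> i))"
  have g01: "g 0 \<in> carrier (integer_mod_group (\<alpha> 0))" "g 1 \<in> carrier (integer_mod_group (\<alpha> 1))"
    using g by simp_all
  have m: "marked_group (cyclic_sum 2 \<alpha> g)" by (rule marked_group_cyclic_sum[OF g])
  have mP: "marked_group (A, [a, b])" by (rule TP_D[OF P])
  have "marked_iso (A, [a, b]) (cyclic_sum 2 \<alpha> g)"
    unfolding cyclic_sum_2
  proof (rule marked_iso_pairI[OF mP m[unfolded cyclic_sum_2]])
    fix u v :: int
    have "a [^]\<^bsub>A\<^esub> u \<otimes>\<^bsub>A\<^esub> b [^]\<^bsub>A\<^esub> v = \<one>\<^bsub>A\<^esub> \<longleftrightarrow> c dvd u \<and> d dvd v"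
      using rel_mod_TP[OF mP] TP_D(2)[OF P] rel by blast
    moreover have "(\<lambda>k\<in>{..<2}. (if k = 0 then u * g 0 else v * g 1) mod int (\<alpha> k)) = \<one>\<^bsub>?G\<^esub> \<longleftrightarrow> c dvd u \<and> d dvd v"
    proof -
      have "(\<lambda>k\<in>{..<2}. (if k = 0 then u * g 0 else v * g 1) mod int (\<alpha> k)) = \<one>\<^bsub>?G\<^esub>
        \<longleftrightarrow> (\<forall>k\<in>{..<2}. (if k = 0 then u * g 0 else v * g 1) mod int (\<alpha> k) = 0)"
        by (auto simp: fun_eq_iff restrict_def)
      also have "\<dots> \<longleftrightarrow> u mod c = 0 \<and> v mod d = 0"
        using \<alpha>(2,3) by (simp add: g_def mod_mult_right_eq numeral_2_eq_2 lessThan_Suc conj_commute)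
      finally show ?thesis by (simp add: dvd_eq_mod_eq_0)
    qed
    ultimately show "a [^]\<^bsub>A\<^esub> u \<otimes>\<^bsub>A\<^esub> b [^]\<^bsub>A\<^esub> v = \<one>\<^bsub>A\<^esub> \<longleftrightarrow>
      (\<lambda>k\<in>{..<2}. if k = 0 then g 0 else 0) [^]\<^bsub>?G\<^esub> u \<otimes>\<^bsub>?G\<^esub> (\<lambda>k\<in>{..<2}. if k = 1 then g 1 else 0) [^]\<^bsub>?G\<^esub> v = \<one>\<^bsub>?G\<^esub>"
      unfolding cyclic_sum_2_pow[OF g01] by simp
  qed
  then have "marked_iso (A, [a, b]) (nat_copy (cyclic_sum 2 \<alpha> g))"
    using nat_copy[OF m] marked_iso_trans by blast
  then have "frag_of (A, [a, b]) - frag_of (nat_copy (cyclic_sum 2 \<alpha> g)) \<in> C_frags"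
    using nat_copy[OF m] mP by (intro iso_C_frags) auto
  then show ?thesis
    using cyclic_sum_C_frags[OF g] diff_closed_cong_iff[OF diff_closed_C_frags] by blast
qed

lemma slope_iso:
  assumes P: "P \<in> TP" and Q: "Q \<in> TP" and s: "has_slope p P x" "has_slope p Q x"
  shows "marked_iso P Q"
proof -
  obtain A a b B c d where PQ: "P = (A, [a, b])" "Q = (B, [c, d])"
    using s by (auto simp: has_slope_def)
  have m: "marked_group (A, [a, b])" "marked_group (B, [c, d])" using P Q TP_D(1) by (auto simp: PQ)
  have "a [^]\<^bsub>A\<^esub> u \<otimes>\<^bsub>A\<^esub> b [^]\<^bsub>A\<^esub> v = \<one>\<^bsub>A\<^esub> \<longleftrightarrow> p dvd u + x * v" for u v :: int
    using rel_mod_TP[OF m(1)] TP_D(2)[OF P[unfolded PQ]] s(1) by (simp add: PQ has_slope_pair)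
  moreover have "c [^]\<^bsub>B\<^esub> u \<otimes>\<^bsub>B\<^esub> d [^]\<^bsub>B\<^esub> v = \<one>\<^bsub>B\<^esub> \<longleftrightarrow> p dvd u + x * v" for u v :: int
    using rel_mod_TP[OF m(2)] TP_D(2)[OF Q[unfolded PQ]] s(2) by (simp add: PQ has_slope_pair)
  ultimately show ?thesis unfolding PQ by (intro marked_iso_pairI m) simp
qed

lemma TP_cases:
  assumes P: "(A, [a, b]) \<in> TP"
  shows "(\<exists>c\<in>{1, p}. \<exists>d\<in>{1, p}. \<forall>u v. rel_mod p A a b u v \<longleftrightarrow> c dvd u \<and> d dvd v)
     \<or> (\<exists>x\<in>{1..<p}. has_slope p (A, [a, b]) x)"
proof -
  have mP: "marked_group (A, [a, b])" and tors: "\<And>x. x \<in> carrier A \<Longrightarrow> x [^]\<^bsub>A\<^esub> p = \<one>\<^bsub>A\<^esub>"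
    using TP_D[OF P] by auto
  have A: "comm_group A" and ab: "a \<in> carrier A" "b \<in> carrier A" using mP by (auto simp: marked_group_def)
  interpret A: comm_group A by (rule A)
  have rel: "rel_mod p A a b u v \<longleftrightarrow> a [^]\<^bsub>A\<^esub> u \<otimes>\<^bsub>A\<^esub> b [^]\<^bsub>A\<^esub> v = \<one>\<^bsub>A\<^esub>" for u v
    using rel_mod_TP[OF mP] tors by blast
  have "(\<exists>c\<in>{1, p}. \<exists>d\<in>{1, p}. \<forall>u v. rel_mod p A a b u v \<longleftrightarrow> c dvd u \<and> d dvd v)
     \<or> (\<exists>x\<in>{1..<p}. \<forall>u v. rel_mod p A a b u v \<longleftrightarrow> p dvd u + x * v)"
  proof (rule lattice_cases)
    show "rel_mod p A a b (u - u') (v - v')" if "rel_mod p A a b u v" "rel_mod p A a b u' v'" for u v u' v'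
      using that A.int_pow_pair_eq_iff[OF ab, of u v u' v'] by (simp add: rel)
    show "rel_mod p A a b (n * u) (n * v)" if "rel_mod p A a b u v" for n u v
    proof -
      have "(a [^]\<^bsub>A\<^esub> u \<otimes>\<^bsub>A\<^esub> b [^]\<^bsub>A\<^esub> v) [^]\<^bsub>A\<^esub> n = a [^]\<^bsub>A\<^esub> (n * u) \<otimes>\<^bsub>A\<^esub> b [^]\<^bsub>A\<^esub> (n * v)"
        using ab by (simp add: A.int_pow_distrib A.int_pow_pow mult.commute)
      then show ?thesis using that by (simp add: rel)
    qed
    show "rel_mod p A a b p 0" "rel_mod p A a b 0 p" using ab by (simp_all add: rel tors)
  qed
  then show ?thesis by (simp add: has_slope_pair)
qed

section \<open>Standard pairs and the relations between their classes\<close>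

definition std :: "int \<Rightarrow> nat marked" where
  "std x = nat_copy (integer_mod_group (nat p), [1, x])"

lemma std:
  assumes x: "x \<in> {0..<p}"
  shows "std x \<in> TP" "has_slope p (std x) x"
proof -
  let ?Z = "integer_mod_group (nat p)"
  have Z: "carrier ?Z = {0..<p}" using ge5 by (simp add: carrier_integer_mod_group)
  have "generate ?Z {1} = carrier ?Z" using generate_one_mod[of "nat p"] ge5 by simp
  moreover have "generate ?Z {1} \<subseteq> generate ?Z {1, x}" by (rule group.mono_generate) auto
  moreover have "generate ?Z {1, x} \<subseteq> carrier ?Z" using x ge5 Z by (intro group.generate_incl) auto
  ultimately have m: "marked_group (?Z, [1, x])" using x ge5 by (auto simp: marked_group_def Z)
  have tors: "\<forall>y\<in>carrier ?Z. y [^]\<^bsub>?Z\<^esub> p = \<one>\<^bsub>?Z\<^esub>" using ge5 by (simp add: int_pow_integer_mod_group)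
  have slope: "has_slope p (?Z, [1, x]) x"
    using rel_mod_TP[OF m tors] ge5
    by (simp add: has_slope_pair int_pow_integer_mod_group mod_add_eq dvd_eq_mod_eq_0 mult.commute)
  obtain B U where BU: "nat_copy (?Z, [1, x]) = (B, U)" by (cases "nat_copy (?Z, [1, x])")
  have B: "marked_group (B, U)" "marked_iso (?Z, [1, x]) (B, U)" using nat_copy[OF m] by (simp_all add: BU)
  then obtain h where h: "h \<in> iso ?Z B" by (auto simp: marked_iso_def)
  have gB: "group B" using B by (simp add: marked_group_def comm_group_def)
  have "y [^]\<^bsub>B\<^esub> p = \<one>\<^bsub>B\<^esub>" if y: "y \<in> carrier B" for y
  proof -
    interpret h: group_hom ?Z B h using h gB by (simp add: group_hom_def group_hom_axioms_def iso_def)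
    obtain z where z: "z \<in> carrier ?Z" "y = h z" using h y by (auto simp: iso_def bij_betw_def)
    then show ?thesis using tors h.hom_int_pow[OF z(1), of p] h.hom_one by simp
  qed
  then show "std x \<in> TP" using B by (simp add: std_def BU TP_iff)
  show "has_slope p (std x) x" using slope has_slope_iso[OF m B] by (simp add: std_def BU)
qed

definition q :: "int \<Rightarrow> frag" where "q x = frag_of (std x)"

text \<open>This is \<open>slope_val\<close> with the symbols themselves as values. It turns every
  congruence between torsion pairs into one between values of \<open>q\<close>.\<close>

lemma slope_val_q:
  assumes P: "(A, [a, b]) \<in> TP"
  shows "frag_of (A, [a, b]) - slope_val p q (A, [a, b]) \<in> C_frags"
proof (cases "\<exists>x\<in>{1..<p}. has_slope p (A, [a, b]) x")
  case True
  then obtain x where x: "x \<in> {1..<p}" "has_slope p (A, [a, b]) x" by blast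
  then have s: "std x \<in> TP" "has_slope p (std x) x" using std[of x] by auto
  have "marked_iso (A, [a, b]) (std x)" by (rule slope_iso[OF P s(1) x(2) s(2)])
  moreover have "marked_group (std x)" using TP_D(1) s(1) by (cases "std x") auto
  ultimately show ?thesis using slope_val_eq[OF x(2,1), of q] TP_D(1)[OF P] by (simp add: q_def iso_C_frags)
next
  case False
  then have "slope_val p q (A, [a, b]) = 0" unfolding slope_val_def by (rule if_not_P)
  moreover obtain c d where "c \<in> {1, p}" "d \<in> {1, p}" "\<And>u v. rel_mod p A a b u v \<longleftrightarrow> c dvd u \<and> d dvd v"
    using TP_cases[OF P] False by blast
  then have "frag_of (A, [a, b]) \<in> C_frags" by (rule product_C_frags[OF P])
  ultimately show ?thesis by simp
qed

lemma append_zero_C_frags: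
  assumes "(A, [a]) \<in> TP"
  shows "frag_of (append_zero (A, [a])) \<in> C_frags"
proof -
  have m: "marked_group (A, [a])" using TP_D(1)[OF assms] .
  have T: "(A, [a, \<one>\<^bsub>A\<^esub>]) \<in> TP"
    using admissible_append_zero[OF _ assms] by (simp add: append_zero_def)
  have "slope_val p q (A, [a, \<one>\<^bsub>A\<^esub>]) = 0"
    using slope_val_append_zero[OF m, of q] by (simp add: append_zero_def)
  then show ?thesis using slope_val_q[OF T] by (simp add: append_zero_def)
qed

text \<open>In relation (iii) with \<open>j = 2\<close> the set I with two elements contributes t
  times a pair of length 1. Such a term has a zero entry and so lies in
  \<open>C_frags\<close>.\<close>

lemma quotient_C_frags:
  assumes P: "(A, [a, b]) \<in> TP"
  shows "frag_of (A, [a, b]) - frag_of (A, [a, b \<otimes>\<^bsub>A\<^esub> inv\<^bsub>A\<^esub> a]) - frag_of (A, [b, a \<otimes>\<^bsub>A\<^esub> inv\<^bsub>A\<^esub> b]) \<in> C_frags"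
proof -
  note M = diff_closed_C_frags
  let ?P = "(A, [a, b])"
  have m: "marked_group ?P" by (rule TP_D(1)[OF P])
  define c :: "nat set \<Rightarrow> nat" where "c = (\<lambda>I. SOME i. i \<in> I)"
  have c: "\<forall>I. I \<noteq> {} \<and> I \<subseteq> {..<2} \<longrightarrow> c I \<in> I" by (auto simp: c_def some_in_eq)
  let ?\<Sigma> = "\<Sum>I \<in> {I. I \<noteq> {} \<and> I \<subseteq> {..<2}}. frag_cmul ((-1) ^ (card I - 1))
         ((t_free ^^ (card I - 1)) (frag_of (nat_copy (marked_quotient ?P 2 I (c I)))))"
  obtain y where y: "Poly_Mapping.keys y \<subseteq> {Q \<in> TP. Suc (length (snd Q)) = length (snd ?P)}"
    and eq: "?\<Sigma> = (\<Sum>k<2. frag_of (nat_copy (marked_quotient ?P 2 {k} k))) + t_free y"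
    by (rule quotient_sum[OF _ P _ c]) auto
  have "t_free y \<in> C_frags"
    unfolding t_free_def frag_extend_def
  proof (rule diff_closed_sum[OF M], rule diff_closed_frag_cmul[OF M])
    fix Q assume "Q \<in> Poly_Mapping.keys y"
    then have "Q \<in> TP" "length (snd Q) = 1" using y by auto
    then show "frag_of (append_zero Q) \<in> C_frags"
      using append_zero_C_frags by (cases Q) (auto simp: length_Suc_conv)
  qed
  moreover have "frag_of ?P - ?\<Sigma> \<in> C_frags"
  proof -
    have "?P \<in> all_pairs" using m by (simp add: all_pairs_def)
    moreover have "2 \<le> (2::nat)" "2 \<le> length (snd ?P)" by simp_all
    ultimately have "frag_of ?P - ?\<Sigma> \<in> quotient_relators all_pairs"
      unfolding quotient_relators_def using c by blast
    then show ?thesis using relations_closed(3)[OF admissible_simps(1)] relations_C_frags by blast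
  qed
  moreover have mq: "marked_group (nat_copy (marked_quotient ?P 2 {k} k))" if "k < 2" for k
    using nat_copy[OF marked_group_marked_quotient[OF m, of "{k}" 2 k]] that by simp
  have q0: "frag_of (A, [a, b \<otimes>\<^bsub>A\<^esub> inv\<^bsub>A\<^esub> a]) - frag_of (nat_copy (marked_quotient ?P 2 {0} 0)) \<in> C_frags" (is "?x0 \<in> _")
    by (rule iso_C_frags[OF marked_group_shear[OF m] mq quotient_pair(1)[OF m]]) simp
  have q1: "frag_of (A, [b, a \<otimes>\<^bsub>A\<^esub> inv\<^bsub>A\<^esub> b]) - frag_of (nat_copy (marked_quotient ?P 2 {1} 1)) \<in> C_frags" (is "?x1 \<in> _")
    by (rule iso_C_frags[OF marked_group_shear[OF marked_group_swap[OF m]] mq quotient_pair(2)[OF m]]) simp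
  have two: "(\<Sum>k<2. frag_of (nat_copy (marked_quotient ?P 2 {k} k)))
     = frag_of (nat_copy (marked_quotient ?P 2 {0} 0)) + frag_of (nat_copy (marked_quotient ?P 2 {1} 1))"
    by (simp add: numeral_2_eq_2)
  have "(frag_of ?P - ?\<Sigma>) + t_free y - ?x0 - ?x1 \<in> C_frags"
    by (intro diff_closed_diff[OF M] diff_closed_add[OF M] q0 q1 calculation)
  then show ?thesis unfolding eq two by (simp add: algebra_simps)
qed

lemma slope_rel_q: "slope_rel C_frags q"
proof -
  note M = diff_closed_C_frags
  have shearT: "(A, [a, b \<otimes>\<^bsub>A\<^esub> inv\<^bsub>A\<^esub> a]) \<in> TP" if "(A, [a, b]) \<in> TP" for A a b
    using that marked_group_shear by (auto simp: TP_iff)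
  have swapT: "(A, [b, a]) \<in> TP" if "(A, [a, b]) \<in> TP" for A a b
    using that marked_group_swap by (auto simp: TP_iff)
  have comm: "comm_group A" "a \<in> carrier A" "b \<in> carrier A" if "(A, [a, b]) \<in> TP" for A a b
    using TP_D(1)[OF that] by (auto simp: marked_group_def)
  have rel: "slope_val p q (A, [a, b]) - slope_val p q (A, [a, b \<otimes>\<^bsub>A\<^esub> inv\<^bsub>A\<^esub> a])
      - slope_val p q (A, [b, a \<otimes>\<^bsub>A\<^esub> inv\<^bsub>A\<^esub> b]) \<in> C_frags" if P: "(A, [a, b]) \<in> TP" for A a b
  proof -
    have "(frag_of (A, [a, b]) - frag_of (A, [a, b \<otimes>\<^bsub>A\<^esub> inv\<^bsub>A\<^esub> a]) - frag_of (A, [b, a \<otimes>\<^bsub>A\<^esub> inv\<^bsub>A\<^esub> b]))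
      - (frag_of (A, [a, b]) - slope_val p q (A, [a, b]))
      + (frag_of (A, [a, b \<otimes>\<^bsub>A\<^esub> inv\<^bsub>A\<^esub> a]) - slope_val p q (A, [a, b \<otimes>\<^bsub>A\<^esub> inv\<^bsub>A\<^esub> a]))
      + (frag_of (A, [b, a \<otimes>\<^bsub>A\<^esub> inv\<^bsub>A\<^esub> b]) - slope_val p q (A, [b, a \<otimes>\<^bsub>A\<^esub> inv\<^bsub>A\<^esub> b])) \<in> C_frags"
      by (rule diff_closed_add[OF M diff_closed_add[OF M diff_closed_diff[OF M quotient_C_frags[OF P] slope_val_q[OF P]]
          slope_val_q[OF shearT[OF P]]] slope_val_q[OF shearT[OF swapT[OF P]]]])
    then show ?thesis by (simp add: algebra_simps)
  qed
  have pair: "\<exists>A a b. std x = (A, [a, b]) \<and> (A, [a, b]) \<in> TP \<and> has_slope p (A, [a, b]) x" if "x \<in> {0..<p}" for x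
  proof -
    have s: "has_slope p (std x) x" "std x \<in> TP" using std[OF that] by auto
    then obtain A a b where "std x = (A, [a, b])" by (auto simp: has_slope_def)
    then show ?thesis using s by metis
  qed
  have q0: "q 0 \<in> C_frags"
  proof -
    obtain A a b where A: "std 0 = (A, [a, b])" "(A, [a, b]) \<in> TP" "has_slope p (A, [a, b]) 0"
      using pair[of 0] ge5 by auto
    show ?thesis using slope_val_q[OF A(2)] slope_val_zero[OF A(3), of q] A(1) by (simp add: q_def)
  qed
  have val: "slope_val p q P - q x \<in> C_frags" if "has_slope p P x" "x \<in> {0..<p}" for P :: "nat marked" and x
  proof (cases "x = 0")
    case True
    then show ?thesis using slope_val_zero[of P q] that q0 diff_closed_uminus[OF M] by simp
  next
    case False
    then show ?thesis using slope_val_eq[OF that(1), of q] that diff_closed_zero[OF M] by simp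
  qed
  \<comment> \<open>A torsion pair of slope 0 is (a, 0), for which relation (iii) reads (a, 0) = (a,
    -a) + (0, a). The outer two have product lattices, hence so much the more (a, -a), of slope -1,
    is zero modulo C.\<close>
  have qm1: "q (p - 1) \<in> C_frags"
  proof -
    obtain A a b where P: "(A, [a, b]) \<in> TP" "has_slope p (A, [a, b]) 0"
      using pair[of 0] ge5 by auto
    have "has_slope p (A, [a, b \<otimes>\<^bsub>A\<^esub> inv\<^bsub>A\<^esub> a]) (0 - 1)" using has_slope_shear[OF comm[OF P(1)]] P(2) by blast
    then have "has_slope p (A, [a, b \<otimes>\<^bsub>A\<^esub> inv\<^bsub>A\<^esub> a]) (p - 1)" by (rule has_slope_cong[rotated]) simp
    then have v1: "slope_val p q (A, [a, b \<otimes>\<^bsub>A\<^esub> inv\<^bsub>A\<^esub> a]) = q (p - 1)" using ge5 by (intro slope_val_eq) auto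
    have r: "rel_mod p A b (a \<otimes>\<^bsub>A\<^esub> inv\<^bsub>A\<^esub> b) u v \<longleftrightarrow> p dvd v" for u v
      using P(2) comm[OF P(1)] by (simp add: rel_mod_shear rel_mod_swap[of A b a] has_slope_pair)
    have "\<not> has_slope p (A, [b, a \<otimes>\<^bsub>A\<^esub> inv\<^bsub>A\<^esub> b]) x" for x
    proof
      assume "has_slope p (A, [b, a \<otimes>\<^bsub>A\<^esub> inv\<^bsub>A\<^esub> b]) x"
      then have "p dvd 0 \<longleftrightarrow> p dvd 1 + x * 0" unfolding has_slope_pair r by blast
      then show False using not_dvd[of 1] ge5 by simp
    qed
    then have v2: "slope_val p q (A, [b, a \<otimes>\<^bsub>A\<^esub> inv\<^bsub>A\<^esub> b]) = 0" by (simp add: slope_val_def)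
    have "- q (p - 1) \<in> C_frags"
      using rel[OF P(1)] slope_val_zero[OF P(2), of q] v1 v2 by simp
    then show ?thesis using diff_closed_uminus[OF M] by fastforce
  qed
  have inv: "q (J x) - q x \<in> C_frags" if x: "x \<in> {1..<p}" for x
  proof -
    obtain A a b where P: "(A, [a, b]) \<in> TP" "has_slope p (A, [a, b]) x"
      using pair[of x] x by auto
    have 1: "slope_val p q (A, [a, b]) = q x" by (rule slope_val_eq[OF P(2) x])
    have 2: "slope_val p q (A, [b, a]) = q (J x)"
      by (rule slope_val_eq[OF has_slope_swap[OF comm[OF P(1)] x P(2)] J_ex(1)[OF x]])
    have "(frag_of (A, [a, b]) - slope_val p q (A, [a, b])) - (frag_of (A, [b, a]) - slope_val p q (A, [b, a]))
       - (frag_of (A, [a, b]) - frag_of (A, [b, a])) \<in> C_frags"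
      by (rule diff_closed_diff[OF M diff_closed_diff[OF M slope_val_q[OF P(1)] slope_val_q[OF swapT[OF P(1)]]]
          swap_C_frags[OF TP_D(1)[OF P(1)]]])
    then show ?thesis by (simp add: 1 2)
  qed
  have rel': "q x - q (x - 1) - q (J x - 1) \<in> C_frags" if x: "x \<in> {1..<p}" for x
  proof -
    obtain A a b where P: "(A, [a, b]) \<in> TP" "has_slope p (A, [a, b]) x"
      using pair[of x] x by auto
    note A = comm[OF P(1)]
    have 1: "slope_val p q (A, [a, b]) = q x" by (rule slope_val_eq[OF P(2) x])
    have 2: "slope_val p q (A, [a, b \<otimes>\<^bsub>A\<^esub> inv\<^bsub>A\<^esub> a]) - q (x - 1) \<in> C_frags"
      using has_slope_shear[OF A, of p x] P(2) x by (intro val) auto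
    have 3: "slope_val p q (A, [b, a \<otimes>\<^bsub>A\<^esub> inv\<^bsub>A\<^esub> b]) - q (J x - 1) \<in> C_frags"
      using has_slope_shear[OF A(1,3,2), of p "J x"] has_slope_swap[OF A x P(2)] J_ex(1)[OF x] by (intro val) auto
    from diff_closed_add[OF M diff_closed_add[OF M rel[OF P(1)] 2] 3] show ?thesis
      by (simp add: 1 algebra_simps)
  qed
  show ?thesis using q0 qm1 inv rel' unfolding slope_rel_def by blast
qed

end

section \<open>The quotient\<close>

lemma generate_frag_of:
  assumes "Q \<subseteq> T"
  shows "generate (free_Abelian_group T) (frag_of ` Q) = {x. Poly_Mapping.keys x \<subseteq> Q}"
proof (intro equalityI subsetI)
  let ?F = "free_Abelian_group T"
  have sub: "frag_of ` Q \<subseteq> carrier ?F" using assms by auto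
  have H: "subgroup (generate ?F (frag_of ` Q)) ?F"
    by (rule group.generate_is_subgroup[OF group_free_Abelian_group sub])
  show "x \<in> generate ?F (frag_of ` Q)" if "x \<in> {x. Poly_Mapping.keys x \<subseteq> Q}" for x
  proof -
    have "Poly_Mapping.keys x \<subseteq> Q" using that by simp
    then show ?thesis
    proof (induction x rule: frag_induction)
      case zero
      then show ?case using subgroup.one_closed[OF H] by simp
    next
      case (one x)
      then show ?case by (intro generate.incl) simp
    next
      case (diff a b)
      have "Poly_Mapping.keys b \<subseteq> T" using subgroup.mem_carrier[OF H diff(2)] by simp
      then have "inv\<^bsub>?F\<^esub> b = - b" by simp
      then show ?case using subgroup.m_closed[OF H diff(1) subgroup.m_inv_closed[OF H diff(2)]] by simp
    qed
  qed
  show "x \<in> {x. Poly_Mapping.keys x \<subseteq> Q}" if "x \<in> generate ?F (frag_of ` Q)" for x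
    using that
  proof (induction rule: generate.induct)
    case (inv h)
    then show ?case using assms by auto
  next
    case (eng h1 h2)
    then show ?case using keys_add[of h1 h2] by auto
  qed auto
qed

context prime_residues begin

definition D_frags :: "frag set" where
  "D_frags = {x. Poly_Mapping.keys x \<subseteq> {P \<in> TP. length (snd P) = 2}}"

lemma torsion_degree_eq: "torsion_degree (nat p) 2 = B_class all_pairs ` D_frags"
proof -
  let ?Q = "{P \<in> TP. length (snd P) = 2}"
  interpret h: group_hom "free_Abelian_group TP" "B_module TP" "B_class TP"
    by (rule group_hom_B_class) simp
  have "{B_symbol TP (A, U) | A U. (A, U) \<in> TP \<and> length U = 2} = B_class TP ` frag_of ` ?Q"
    by (force simp: B_symbol_def image_iff)
  then have "B_degree TP 2 = B_class TP ` generate (free_Abelian_group TP) (frag_of ` ?Q)"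
    unfolding B_degree_def by (simp only:) (rule h.generate_img, auto)
  also have "\<dots> = B_class TP ` D_frags"
    by (subst generate_frag_of) (auto simp: D_frags_def)
  finally show ?thesis
    by (simp add: torsion_degree_def image_image torsion_embed_B_class)
qed

text \<open>The \<open>f k\<close> supply coordinates on the quotient: \<open>slope\<close> makes
  them well defined and zero on C, \<open>gen\<close> and \<open>tors\<close> show that only
  elements of C have all coordinates zero, and \<open>dual\<close> shows that all values
  occur.\<close>

lemma C_quotient_iso:
  fixes m :: "nat \<Rightarrow> nat"
  assumes slope: "\<And>k. k < n \<Longrightarrow> slope_rel {z. int (m k) dvd z} (f k)"
    and r: "\<And>k. k < n \<Longrightarrow> r k \<in> {1..<p}"
    and dual: "\<And>j k. j < n \<Longrightarrow> k < n \<Longrightarrow> f k (r j) = (if j = k then 1 else 0)"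
    and tors: "\<And>k. k < n \<Longrightarrow> frag_cmul (int (m k)) (q (r k)) \<in> C_frags"
    and gen: "\<And>x. x \<in> {1..<p} \<Longrightarrow> q x - (\<Sum>k<n. frag_cmul (f k x) (q (r k))) \<in> C_frags"
  shows "C_quotient (nat p) 2 \<cong> product_group {..<n} (\<lambda>k. integer_mod_group (m k))"
proof -
  note M = diff_closed_C_frags
  let ?F = "free_Abelian_group all_pairs" and ?B = "B_module all_pairs"
  let ?G = "product_group {..<n} (\<lambda>k. integer_mod_group (m k))"
  define \<psi> where "\<psi> = (\<lambda>k. Psi (slope_val p (f k)))"
  define \<Psi> where "\<Psi> = (\<lambda>x. \<lambda>k\<in>{..<n}. \<psi> k x mod int (m k))"
  define D where "D = B_class all_pairs ` D_frags"
  interpret h: group_hom ?F ?B "B_class all_pairs" by (rule group_hom_B_class) simp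
  have TPA: "TP \<subseteq> all_pairs" by (simp add: admissible_subset)
  have Dk: "Poly_Mapping.keys x \<subseteq> all_pairs" if "x \<in> D_frags" for x using that TPA by (auto simp: D_frags_def)
  have D0: "subgroup D_frags ?F"
  proof (rule group.subgroupI[OF group_free_Abelian_group])
    show "D_frags \<subseteq> carrier ?F" using Dk by auto
    have "0 \<in> D_frags" by (simp add: D_frags_def)
    then show "D_frags \<noteq> {}" by blast
    fix x y assume xy: "x \<in> D_frags" "y \<in> D_frags"
    show "inv\<^bsub>?F\<^esub> x \<in> D_frags" using xy Dk by (simp add: D_frags_def)
    show "x \<otimes>\<^bsub>?F\<^esub> y \<in> D_frags" using xy keys_add[of x y] by (auto simp: D_frags_def)
  qed
  have D: "subgroup D ?B" unfolding D_def by (rule h.subgroup_img_is_subgroup[OF D0])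
  have \<Psi>_G: "\<Psi> x \<in> carrier ?G" for x
    by (auto simp: \<Psi>_def carrier_integer_mod_group)
  have \<Psi>_cong: "\<Psi> x = \<Psi> y" if "x - y \<in> relations all_pairs" for x y
  proof -
    have "\<psi> k x mod int (m k) = \<psi> k y mod int (m k)" if "k < n" for k
      using Psi_relations[OF slope[OF that] \<open>x - y \<in> relations all_pairs\<close>]
      by (simp add: \<psi>_def Psi_diff mod_eq_dvd_iff)
    then show ?thesis by (auto simp: \<Psi>_def)
  qed
  \<comment> \<open>A coset is evaluated on some representative in \<open>D_frags\<close>; any two
    differ by relations, so \<open>\<Psi>_cong\<close> makes the choice immaterial.\<close>
  define \<Theta> where "\<Theta> = (\<lambda>X. \<Psi> (SOME x. x \<in> D_frags \<and> B_class all_pairs x = X))"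
  have \<Theta>: "\<Theta> (B_class all_pairs x) = \<Psi> x" if "x \<in> D_frags" for x
    unfolding \<Theta>_def
  proof (rule someI2[of _ x])
    fix y assume "y \<in> D_frags \<and> B_class all_pairs y = B_class all_pairs x"
    then show "\<Psi> y = \<Psi> x" by (intro \<Psi>_cong B_class_eqD) auto
  qed (use that in simp)
  have G: "group ?G" by simp
  interpret \<theta>: group_hom "?B\<lparr>carrier := D\<rparr>" ?G \<Theta>
  proof (unfold group_hom_def group_hom_axioms_def, intro conjI)
    show "group (?B\<lparr>carrier := D\<rparr>)" by (rule h.H.subgroup_imp_group[OF D])
    show "\<Theta> \<in> hom (?B\<lparr>carrier := D\<rparr>) ?G"
    proof (rule homI)
      fix X Y assume "X \<in> carrier (?B\<lparr>carrier := D\<rparr>)" "Y \<in> carrier (?B\<lparr>carrier := D\<rparr>)"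
      then obtain x y where xy: "x \<in> D_frags" "X = B_class all_pairs x" "y \<in> D_frags" "Y = B_class all_pairs y"
        by (auto simp: D_def)
      have "x + y \<in> D_frags" using xy keys_add[of x y] by (auto simp: D_frags_def)
      moreover have "X \<otimes>\<^bsub>?B\<^esub> Y = B_class all_pairs (x + y)"
        using h.hom_mult[of x y] xy Dk by simp
      ultimately have "\<Theta> (X \<otimes>\<^bsub>?B\<^esub> Y) = \<Psi> (x + y)" by (simp add: \<Theta>)
      also have "\<dots> = \<Psi> x \<otimes>\<^bsub>?G\<^esub> \<Psi> y"
        by (auto simp: \<Psi>_def \<psi>_def Psi_add mod_add_eq fun_eq_iff)
      finally show "\<Theta> (X \<otimes>\<^bsub>?B\<lparr>carrier := D\<rparr>\<^esub> Y) = \<Theta> X \<otimes>\<^bsub>?G\<^esub> \<Theta> Y"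
        using xy by (simp add: \<Theta>)
    next
      fix X assume "X \<in> carrier (?B\<lparr>carrier := D\<rparr>)"
      then obtain x where "x \<in> D_frags" "X = B_class all_pairs x" by (auto simp: D_def)
      then show "\<Theta> X \<in> carrier ?G" using \<Theta> \<Psi>_G by simp
    qed
  qed (rule G)
  have red: "x - (\<Sum>k<n. frag_cmul (\<psi> k x) (q (r k))) \<in> C_frags" if "x \<in> D_frags" for x
  proof -
    have "Poly_Mapping.keys x \<subseteq> {P \<in> TP. length (snd P) = 2}" using that by (simp add: D_frags_def)
    then show ?thesis
    proof (induction x rule: frag_induction)
      case zero
      then show ?case by (simp add: \<psi>_def diff_closed_zero[OF M])
    next
      case (one P)
      then obtain A a b where P: "P = (A, [a, b])" "(A, [a, b]) \<in> TP"
        by (cases P) (auto simp: length_Suc_conv numeral_2_eq_2)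
      have "slope_val p q P - (\<Sum>k<n. frag_cmul (slope_val p (f k) P) (q (r k))) \<in> C_frags"
      proof (cases "\<exists>x\<in>{1..<p}. has_slope p P x")
        case True
        then obtain x where x: "x \<in> {1..<p}" "has_slope p P x" by blast
        have "slope_val p q P = q x" "slope_val p (f k) P = f k x" for k
          by (rule slope_val_eq[OF x(2,1)])+
        then show ?thesis using gen[OF x(1)] by simp
      next
        case False
        then have "slope_val p q P = 0" "slope_val p (f k) P = 0" for k by (simp_all only: slope_val_def if_False)
        then show ?thesis by (simp add: diff_closed_zero[OF M])
      qed
      from diff_closed_add[OF M slope_val_q[OF P(2), folded P(1)] this]
      show ?case by (simp add: \<psi>_def)
    next
      case (diff a b)
      have eq: "(\<Sum>k<n. frag_cmul (\<psi> k (a - b)) (q (r k)))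
        = (\<Sum>k<n. frag_cmul (\<psi> k a) (q (r k))) - (\<Sum>k<n. frag_cmul (\<psi> k b) (q (r k)))"
        by (simp add: \<psi>_def Psi_diff frag_cmul_diff_distrib sum_subtractf)
      show ?case unfolding eq using diff_closed_diff[OF M diff] by (simp add: algebra_simps)
    qed
  qed
  have ker: "kernel (?B\<lparr>carrier := D\<rparr>) ?G \<Theta> = C_submodule \<inter> D"
  proof -
    have "\<Theta> X = \<one>\<^bsub>?G\<^esub> \<longleftrightarrow> X \<in> C_submodule" if X: "X \<in> D" for X
    proof -
      obtain x where x: "x \<in> D_frags" "X = B_class all_pairs x" using X by (auto simp: D_def)
      have "\<Theta> X = \<one>\<^bsub>?G\<^esub> \<longleftrightarrow> (\<forall>k<n. int (m k) dvd \<psi> k x)"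
        using x by (auto simp: \<Theta> \<Psi>_def fun_eq_iff restrict_def dvd_eq_mod_eq_0)
      also have "\<dots> \<longleftrightarrow> x \<in> C_frags"
      proof
        assume d: "\<forall>k<n. int (m k) dvd \<psi> k x"
        have "frag_cmul (\<psi> k x) (q (r k)) \<in> C_frags" if k: "k \<in> {..<n}" for k
        proof -
          obtain z where "\<psi> k x = int (m k) * z" using d k by blast
          then have "frag_cmul (\<psi> k x) (q (r k)) = frag_cmul z (frag_cmul (int (m k)) (q (r k)))"
            by (simp add: mult.commute)
          then show ?thesis using diff_closed_frag_cmul[OF M tors, of k z] k by simp
        qed
        then have "(\<Sum>k<n. frag_cmul (\<psi> k x) (q (r k))) \<in> C_frags" by (rule diff_closed_sum[OF M])
        then show "x \<in> C_frags" using diff_closed_cong_iff[OF M red[OF x(1)]] by blast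
      next
        assume "x \<in> C_frags"
        then show "\<forall>k<n. int (m k) dvd \<psi> k x"
          using Psi_C_frags[OF slope] by (simp add: \<psi>_def)
      qed
      also have "\<dots> \<longleftrightarrow> X \<in> C_submodule" using x Dk by (simp add: C_frags_def)
      finally show ?thesis .
    qed
    then show ?thesis by (auto simp: kernel_def)
  qed
  have surj: "\<Theta> ` carrier (?B\<lparr>carrier := D\<rparr>) = carrier ?G"
  proof (intro equalityI subsetI)
    fix z assume z: "z \<in> carrier ?G"
    have std_D: "q (r k) \<in> D_frags" if "k < n" for k
    proof -
      have "r k \<in> {0..<p}" using r[OF that] by auto
      then have "std (r k) \<in> TP" "has_slope p (std (r k)) (r k)" by (rule std)+
      then show ?thesis by (auto simp: D_frags_def q_def has_slope_def)
    qed
    define x where "x = (\<Sum>k<n. frag_cmul (z k) (q (r k)))"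
    have "Poly_Mapping.keys x \<subseteq> (\<Union>k\<in>{..<n}. Poly_Mapping.keys (q (r k)))"
      unfolding x_def using keys_cmul by (intro order.trans[OF keys_sum]) blast
    then have x: "x \<in> D_frags" using std_D by (fastforce simp: D_frags_def)
    have "\<psi> k x = z k" if k: "k < n" for k
    proof -
      have "\<psi> k (q (r j)) = (if j = k then 1 else 0)" if "j < n" for j
      proof -
        have "has_slope p (std (r j)) (r j)" using r[OF that] by (intro std) auto
        from slope_val_eq[OF this r[OF that], of "f k"] show ?thesis
          using dual[OF that k] by (simp add: \<psi>_def q_def)
      qed
      then have "\<psi> k x = (\<Sum>j<n. if j = k then z k else 0)"
        unfolding x_def \<psi>_def Psi_sum Psi_cmul by (intro sum.cong) auto
      then show ?thesis using k by simp
    qed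
    moreover have "z k mod int (m k) = z k" if "k < n" for k
    proof -
      have "z k \<in> carrier (integer_mod_group (m k))" using z that by (auto simp: PiE_iff)
      then show ?thesis by (auto simp: carrier_integer_mod_group split: if_splits)
    qed
    moreover have "z k = undefined" if "\<not> k < n" for k
      using z that by (auto simp: PiE_iff extensional_def)
    ultimately have "\<Psi> x = z" by (auto simp: \<Psi>_def fun_eq_iff)
    then have "z = \<Theta> (B_class all_pairs x)" using \<Theta>[OF x] by simp
    then show "z \<in> \<Theta> ` carrier (?B\<lparr>carrier := D\<rparr>)" using x by (auto simp: D_def)
  qed (use \<theta>.hom_closed in blast)
  have "?B\<lparr>carrier := D\<rparr> Mod (C_submodule \<inter> D) \<cong> ?G"
    using \<theta>.FactGroup_iso[OF surj] unfolding ker .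
  then show ?thesis unfolding C_quotient_def torsion_degree_eq D_def .
qed

end

text \<open>\<open>integer_mod_group 0\<close> is the group of all integers.\<close>

lemma product_group_free_Z:
  "product_group {..<g} (\<lambda>k. integer_mod_group (if k < g then 0 else 2)) = free_Z g"
proof -
  have "(\<Pi>\<^sub>E k\<in>{..<g}. carrier (integer_mod_group (if k < g then 0 else 2))) = (\<Pi>\<^sub>E k\<in>{..<g}. carrier integer_group)"
    by (rule PiE_cong) (simp add: integer_mod_group_def)
  then show ?thesis
    by (simp add: product_group_def integer_mod_group_def integer_group_def restrict_def fun_eq_iff)
qed

lemma product_group_Suc_iso:
  "product_group {..<Suc g} (\<lambda>k. integer_mod_group (if k < g then 0 else 2))
    \<cong> integer_mod_group 2 \<times>\<times> free_Z g" (is "?P \<cong> ?Q")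
proof -
  define h :: "(nat \<Rightarrow> int) \<Rightarrow> int \<times> (nat \<Rightarrow> int)" where "h = (\<lambda>x. (x g, restrict x {..<g}))"
  have P: "x \<in> carrier ?P \<longleftrightarrow> x g \<in> {0..<2} \<and> (\<forall>k. \<not> k < Suc g \<longrightarrow> x k = undefined)" for x
  proof -
    have "x \<in> carrier ?P \<longleftrightarrow> (\<forall>k<Suc g. x k \<in> (if k < g then UNIV else {0..<2})) \<and> (\<forall>k. \<not> k < Suc g \<longrightarrow> x k = undefined)"
      by (simp add: PiE_iff extensional_def carrier_integer_mod_group Ball_def)
    then show ?thesis by (auto simp: less_Suc_eq)
  qed
  have Q: "(c, y) \<in> carrier ?Q \<longleftrightarrow> c \<in> {0..<2} \<and> (\<forall>k. \<not> k < g \<longrightarrow> y k = undefined)" for c y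
    by (simp add: PiE_iff extensional_def carrier_integer_mod_group Ball_def)
  have "h \<in> hom ?P ?Q"
  proof (rule homI)
    fix x y assume xy: "x \<in> carrier ?P" "y \<in> carrier ?P"
    show "h x \<in> carrier ?Q" using xy(1) unfolding h_def P Q by simp
    show "h (x \<otimes>\<^bsub>?P\<^esub> y) = h x \<otimes>\<^bsub>?Q\<^esub> h y" by (auto simp: h_def fun_eq_iff)
  qed
  moreover have "bij_betw h (carrier ?P) (carrier ?Q)"
  proof (rule bij_betw_byWitness[where f' = "\<lambda>(c, y). (y(g := c))"])
    show "\<forall>x\<in>carrier ?P. (\<lambda>(c, y). (y(g := c))) (h x) = x"
    proof (intro ballI)
      fix x assume "x \<in> carrier ?P"
      then have u: "x k = undefined" if "\<not> k < Suc g" for k using that P by blast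
      show "(\<lambda>(c, y). (y(g := c))) (h x) = x"
      proof
        fix k
        show "(\<lambda>(c, y). (y(g := c))) (h x) k = x k" using u[of k] by (simp add: h_def)
      qed
    qed
    show "\<forall>z\<in>carrier ?Q. h ((\<lambda>(c, y). (y(g := c))) z) = z"
    proof (intro ballI)
      fix z assume "z \<in> carrier ?Q"
      then obtain c y where "z = (c, y)" "\<forall>k. \<not> k < g \<longrightarrow> y k = undefined" using Q by (cases z) blast
      moreover have "restrict (y(g := c)) {..<g} = y"
      proof
        fix k
        show "restrict (y(g := c)) {..<g} k = y k" using calculation(2) by simp
      qed
      ultimately show "h ((\<lambda>(c, y). (y(g := c))) z) = z" by (simp add: h_def)
    qed
    show "h ` carrier ?P \<subseteq> carrier ?Q"
      unfolding h_def by (rule image_subsetI) (simp only: P Q, simp)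
    show "(\<lambda>(c, y). (y(g := c))) ` carrier ?Q \<subseteq> carrier ?P"
    proof (rule image_subsetI)
      fix z assume z: "z \<in> carrier ?Q"
      obtain c y where "z = (c, y)" by (cases z)
      then show "(\<lambda>(c, y). (y(g := c))) z \<in> carrier ?P" using z by (simp only: P Q prod.case) simp
    qed
  qed
  ultimately have "h \<in> iso ?P ?Q" by (simp add: iso_def)
  then show ?thesis by (auto simp: is_iso_def)
qed

text \<open>Eliminating \<open>v\<close> gives 12 g + 6 i + 8 e = p + 1, the genus formula for
  X_0(p). In the application 2 i and 2 e are the numbers of square roots of -1 and of primitive cube
  roots of unity modulo \<open>p\<close>, which are the numbers of elliptic points of order 2 and
  3.\<close>

lemma genus_count:
  assumes "int p + 1 = 4 * int g + 4 * int v + 2 * int i" "6 * int v = int p + 1 + 4 * int e"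
    and "i \<le> 1" "e \<le> 1" "p \<ge> 5"
  shows "genus_X0 p = g" "p mod 4 = 1 \<Longrightarrow> i = 1" "p mod 4 = 3 \<Longrightarrow> i = 0"
proof -
  have 1: "p + 1 = 4 * g + 4 * v + 2 * i" "6 * v = p + 1 + 4 * e" using assms by linarith+
  \<comment> \<open>The first equation gives p + 1 = 2 i modulo 4, so the Euler characteristic
    itself decides whether -1 is a square.\<close>
  show "p mod 4 = 1 \<Longrightarrow> i = 1" "p mod 4 = 3 \<Longrightarrow> i = 0" using 1(1) assms(3) by presburger+
  have i: "i = 0 \<or> i = 1" and e: "e = 0 \<or> e = 1" using assms by auto
  have "12 * g + 6 * i + 8 * e = p + 1" using 1 by linarith
  moreover have "g \<noteq> 0" if "i = 0" "e = 0" using \<open>12 * g + 6 * i + 8 * e = p + 1\<close> that by auto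
  \<comment> \<open>The four alternatives belong to (i, e) = (0, 0), (1, 0), (0, 1) and (1, 1), in
    this order.\<close>
  ultimately have "p = 12 * (g - 1) + 11 \<and> g \<noteq> 0 \<or> p = 12 * g + 5 \<or> p = 12 * g + 7 \<or> p = 12 * (g + 1) + 1"
    using i e by auto
  moreover have "(12 * a + c) mod 12 = c" "(12 * a + c) div 12 = a" if "c < 12" for a c :: nat
    using that by simp_all
  ultimately show "genus_X0 p = g" by (elim disjE conjE) (simp_all add: genus_X0_def)
qed

theorem proposition4p3:
  fixes p :: nat
  assumes "prime p" and "p \<ge> 5"
  shows "(p mod 4 = 1 \<longrightarrow> C_quotient p 2 \<cong> integer_mod_group 2 \<times>\<times> free_Z (genus_X0 p))
    \<and> (p mod 4 = 3 \<longrightarrow> C_quotient p 2 \<cong> free_Z (genus_X0 p))"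
proof -
  interpret prime_residues "int p" by unfold_locales (use assms in auto)
  show ?thesis
  proof (rule slope_basis[where 'b = "nat marked"])
    fix g v :: nat and m :: "nat \<Rightarrow> nat" and r :: "nat \<Rightarrow> int" and f :: "nat \<Rightarrow> int \<Rightarrow> int"
    assume count: "int p + 1 = 4 * int g + 4 * int v + 2 * int (card I)" "6 * int v = int p + 1 + 4 * int (card Fx)"
      and m: "\<And>k. m k = (if k < g then 0 else 2)"
      and slope: "\<And>k. k < g + card I \<Longrightarrow> slope_rel {z. int (m k) dvd z} (f k)"
      and r: "\<And>k. k < g + card I \<Longrightarrow> r k \<in> {1..<int p}"
      and dual: "\<And>j k. j < g + card I \<Longrightarrow> k < g + card I \<Longrightarrow> f k (r j) = (if j = k then 1 else 0)"
      and tors: "\<And>M (q :: int \<Rightarrow> frag) k. diff_closed M \<Longrightarrow> slope_rel M q \<Longrightarrow> k < g + card I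
         \<Longrightarrow> frag_cmul (int (m k)) (q (r k)) \<in> M"
      and gen: "\<And>M (q :: int \<Rightarrow> frag) x. diff_closed M \<Longrightarrow> slope_rel M q \<Longrightarrow> x \<in> {1..<int p}
         \<Longrightarrow> q x - (\<Sum>k<g + card I. frag_cmul (f k x) (q (r k))) \<in> M"
    have "C_quotient (nat (int p)) 2 \<cong> product_group {..<g + card I} (\<lambda>k. integer_mod_group (m k))"
      by (rule C_quotient_iso[OF slope r dual tors[OF diff_closed_C_frags slope_rel_q] gen[OF diff_closed_C_frags slope_rel_q]])
    then have iso: "C_quotient p 2 \<cong> product_group {..<g + card I} (\<lambda>k. integer_mod_group (if k < g then 0 else 2))"
      by (simp add: m)
    have "card I \<le> 1" "card Fx \<le> 1" using card_le_1 I_unique Fx_unique by metis+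
    note genus = genus_count[OF count this assms(2)]
    show ?thesis
    proof (intro conjI impI)
      assume "p mod 4 = 1"
      then show "C_quotient p 2 \<cong> integer_mod_group 2 \<times>\<times> free_Z (genus_X0 p)"
        using iso genus(1,2) iso_trans[OF _ product_group_Suc_iso] by simp
    next
      assume "p mod 4 = 3"
      then show "C_quotient p 2 \<cong> free_Z (genus_X0 p)"
        using iso genus(1,3) by (simp add: product_group_free_Z)
    qed
  qed
qed

end
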